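(* Let $k$ be a field, $S=k[x_1,\dots,x_n]$, $\mathfrak m=(x_1,\dots,x_n)$, and $I=(f_1,\dots,f_r)$ a linearly presented $\mathfrak m$-primary ideal generated in degree $d$. Let $B=k[T_1,\dots,T_r]$, $W\subseteq\mathbb P^{r-1}$ the image of the map $\mathbb P^{n-1}\to\mathbb P^{r-1}$ defined by $f_1,\dots,f_r$, $I(W)\subseteq B$ its homogeneous ideal, $\Theta$ the Jacobian dual matrix of a presentation matrix of $I$, and $I_n(\Theta)$ its ideal of $n\times n$ minors. Then: (1) If $I_n(\Theta)$ has a linear resolution, then $I^{n-1}=\mathfrak m^{d(n-1)}$ (equivalently $\mathrm{reg}(I^{n-1})=(n-1)d$). (2) If $I_n(\Theta)=I(W)_{\ge n}$, then $I_n(\Theta)$ has a linear resolution if and only if $I^{n-1}=\mathfrak m^{d(n-1)}$.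
   Context: "Linearly presented" means the syzygy module of the forms $f_1,\dots,f_r$ (all of degree $d$) is generated by linear syzygies $\sum_i a_i(\mathbf x)f_i=0$. The defining ideal $J$ of $\mathrm{Sym}(I)$ is generated by the bilinear forms $\sum_i a_i(\mathbf x)T_i$; with $L_1,\dots,L_N$ minimal generators of $J$, $\Theta$ is the $N\times n$ matrix of linear forms in the $T_i$ with $\Theta(x_1,\dots,x_n)^T=(L_1,\dots,L_N)^T$, so $I_n(\Theta)$ is generated in degree $n$. $I(W)$ is the kernel of $B\to S$, $T_i\mapsto f_i$, and $I(W)_{\ge n}$ is the ideal of its elements of degree $\ge n$. "Linear resolution" means its minimal graded free resolution is linear, i.e. $\mathrm{reg}\,I_n(\Theta)=n$. *)

theory Defs
  imports "HOL-Library.Poly_Mapping" "HOL-Combinatorics.Permutations"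
begin

text \<open>Polynomials over a field 'a in countably many variables X_0, X_1, ...;
  a monomial is an exponent vector nat =>0 nat.  The ring k[X_0..X_(m-1)] is the set of
  polynomials all of whose monomials only involve variables with index < m.
  S = k[x_1..x_n] is modelled with m = n (x_(i+1) = X_i), B = k[T_1..T_r] with m = r.\<close>

type_synonym 'a mpoly = "(nat \<Rightarrow>\<^sub>0 nat) \<Rightarrow>\<^sub>0 'a"

definition Var :: "nat \<Rightarrow> 'a::comm_ring_1 mpoly" where
  "Var i = Poly_Mapping.single (Poly_Mapping.single i 1) 1"

definition Const :: "'a::comm_ring_1 \<Rightarrow> 'a mpoly" where
  "Const c = Poly_Mapping.single 0 c"

definition in_ring :: "nat \<Rightarrow> 'a::comm_ring_1 mpoly \<Rightarrow> bool" where
  "in_ring m p \<longleftrightarrow> (\<forall>mon\<in>Poly_Mapping.keys p. \<forall>i\<in>Poly_Mapping.keys mon. i < m)"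

definition tdeg :: "(nat \<Rightarrow>\<^sub>0 nat) \<Rightarrow> nat" where
  "tdeg mon = (\<Sum>i\<in>Poly_Mapping.keys mon. Poly_Mapping.lookup mon i)"

text \<open>homogeneous of degree d (the zero polynomial is homogeneous of every degree)\<close>
definition homog :: "nat \<Rightarrow> 'a::comm_ring_1 mpoly \<Rightarrow> bool" where
  "homog d p \<longleftrightarrow> (\<forall>mon\<in>Poly_Mapping.keys p. tdeg mon = d)"

definition gen_ideal :: "nat \<Rightarrow> 'a::comm_ring_1 mpoly set \<Rightarrow> 'a mpoly set" where
  "gen_ideal m G = {p. \<exists>F c. finite F \<and> F \<subseteq> G \<and> (\<forall>g\<in>F. in_ring m (c g))
                         \<and> p = (\<Sum>g\<in>F. c g * g)}"

definition ideal_prod :: "nat \<Rightarrow> 'a::comm_ring_1 mpoly set \<Rightarrow> 'a mpoly set \<Rightarrow> 'a mpoly set" where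
  "ideal_prod m I J = gen_ideal m {a * b | a b. a \<in> I \<and> b \<in> J}"

fun ideal_pow :: "nat \<Rightarrow> 'a::comm_ring_1 mpoly set \<Rightarrow> nat \<Rightarrow> 'a mpoly set" where
  "ideal_pow m I 0 = gen_ideal m {1}"
| "ideal_pow m I (Suc t) = ideal_prod m (ideal_pow m I t) I"

definition max_ideal :: "nat \<Rightarrow> 'a::comm_ring_1 mpoly set" where
  "max_ideal m = gen_ideal m (Var ` {..<m})"

definition radical :: "nat \<Rightarrow> 'a::comm_ring_1 mpoly set \<Rightarrow> 'a mpoly set" where
  "radical m I = {p. in_ring m p \<and> (\<exists>t. p ^ t \<in> I)}"

definition primary_for :: "nat \<Rightarrow> 'a::comm_ring_1 mpoly set \<Rightarrow> 'a mpoly set \<Rightarrow> bool" where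
  "primary_for m Q I \<longleftrightarrow> 1 \<notin> I \<and> radical m I = Q \<and>
     (\<forall>a b. in_ring m a \<longrightarrow> in_ring m b \<longrightarrow> a * b \<in> I \<longrightarrow> a \<notin> I \<longrightarrow> b \<in> radical m I)"

definition syz :: "nat \<Rightarrow> nat \<Rightarrow> (nat \<Rightarrow> 'a::comm_ring_1 mpoly) \<Rightarrow> (nat \<Rightarrow> 'a mpoly) set" where
  "syz n r f = {a. (\<forall>i<r. in_ring n (a i)) \<and> (\<forall>i\<ge>r. a i = 0) \<and> (\<Sum>i<r. a i * f i) = 0}"

definition lin_syz :: "nat \<Rightarrow> nat \<Rightarrow> (nat \<Rightarrow> 'a::comm_ring_1 mpoly) \<Rightarrow> (nat \<Rightarrow> 'a mpoly) set" where
  "lin_syz n r f = {a \<in> syz n r f. \<forall>i<r. homog 1 (a i)}"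

definition linearly_presented :: "nat \<Rightarrow> nat \<Rightarrow> (nat \<Rightarrow> 'a::comm_ring_1 mpoly) \<Rightarrow> bool" where
  "linearly_presented n r f \<longleftrightarrow>
     (\<forall>s\<in>syz n r f. \<exists>F c. finite F \<and> F \<subseteq> lin_syz n r f \<and> (\<forall>a\<in>F. in_ring n (c a))
        \<and> s = (\<lambda>i. \<Sum>a\<in>F. c a * a i))"

text \<open>a_0..a_(N-1) is a k-basis of the space of linear syzygies; the associated bilinear
  forms L_j = sum_i a_j i * T_i are then a minimal generating set of the defining ideal J
  of Sym(I) (when I is linearly presented)\<close>
definition lin_syz_basis :: "nat \<Rightarrow> nat \<Rightarrow> (nat \<Rightarrow> 'a::field mpoly) \<Rightarrow> nat \<Rightarrow> (nat \<Rightarrow> nat \<Rightarrow> 'a mpoly) \<Rightarrow> bool" where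
  "lin_syz_basis n r f N a \<longleftrightarrow>
     (\<forall>j<N. a j \<in> lin_syz n r f)
   \<and> (\<forall>c::nat \<Rightarrow> 'a. (\<forall>i. (\<Sum>j<N. Const (c j) * a j i) = 0) \<longrightarrow> (\<forall>j<N. c j = 0))
   \<and> (\<forall>s\<in>lin_syz n r f. \<exists>c::nat \<Rightarrow> 'a. s = (\<lambda>i. \<Sum>j<N. Const (c j) * a j i))"

text \<open>Jacobian dual matrix (N x n, entries linear forms in T_0..T_(r-1)):
  L_j = sum_l Theta j l * x_l, i.e. Theta j l = sum_i (coefficient of x_l in a j i) * T_i\<close>
definition jac_dual :: "nat \<Rightarrow> (nat \<Rightarrow> nat \<Rightarrow> 'a::comm_ring_1 mpoly) \<Rightarrow> nat \<Rightarrow> nat \<Rightarrow> 'a mpoly" where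
  "jac_dual r a j l = (\<Sum>i<r. Const (Poly_Mapping.lookup (a j i) (Poly_Mapping.single l 1)) * Var i)"

definition det_n :: "nat \<Rightarrow> (nat \<Rightarrow> nat \<Rightarrow> 'a::comm_ring_1) \<Rightarrow> 'a" where
  "det_n n M = (\<Sum>p | p permutes {..<n}. of_int (sign p) * (\<Prod>i<n. M i (p i)))"

definition minors_ideal :: "nat \<Rightarrow> nat \<Rightarrow> nat \<Rightarrow> (nat \<Rightarrow> nat \<Rightarrow> 'a::comm_ring_1 mpoly) \<Rightarrow> 'a mpoly set" where
  "minors_ideal r N n Th = gen_ideal r
     {det_n n (\<lambda>i l. Th (\<rho> i) l) | \<rho>. inj_on \<rho> {..<n} \<and> \<rho> ` {..<n} \<subseteq> {..<N}}"

definition subst :: "(nat \<Rightarrow> 'a::comm_ring_1 mpoly) \<Rightarrow> 'a mpoly \<Rightarrow> 'a mpoly" where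
  "subst f p = (\<Sum>mon\<in>Poly_Mapping.keys p. Const (Poly_Mapping.lookup p mon) * (\<Prod>i\<in>Poly_Mapping.keys mon. f i ^ Poly_Mapping.lookup mon i))"

definition IW :: "nat \<Rightarrow> (nat \<Rightarrow> 'a::comm_ring_1 mpoly) \<Rightarrow> 'a mpoly set" where
  "IW r f = {p. in_ring r p \<and> subst f p = 0}"

definition ideal_ge :: "nat \<Rightarrow> nat \<Rightarrow> 'a::comm_ring_1 mpoly set \<Rightarrow> 'a mpoly set" where
  "ideal_ge m D I = gen_ideal m {p \<in> I. \<exists>e\<ge>D. homog e p}"

definition vecs :: "nat \<Rightarrow> nat \<Rightarrow> (nat \<Rightarrow> 'a::comm_ring_1 mpoly) set" where
  "vecs m b = {v. (\<forall>j<b. in_ring m (v j)) \<and> (\<forall>j\<ge>b. v j = 0)}"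

definition mat_app :: "(nat \<Rightarrow> nat \<Rightarrow> 'a::comm_ring_1 mpoly) \<Rightarrow> nat \<Rightarrow> nat \<Rightarrow> (nat \<Rightarrow> 'a mpoly) \<Rightarrow> nat \<Rightarrow> 'a mpoly" where
  "mat_app M b' b v = (\<lambda>j. if j < b then (\<Sum>k<b'. M j k * v k) else 0)"

text \<open>J (an ideal of k[X_0..X_(m-1)]) has a linear resolution with generators in degree D:
  there is a graded free resolution
    ... -> B^(b 2) --M 2--> B^(b 1) --M 1--> B^(b 0) --g--> J -> 0
  with J minimally generated in degree D by g 0..g (b 0 - 1) and all differentials M t
  (t >= 1) given by matrices of linear forms.  (A resolution with linear differentials is
  minimal, so this says that the minimal graded free resolution of J is linear.)\<close>
definition linear_resolution :: "nat \<Rightarrow> nat \<Rightarrow> 'a::comm_ring_1 mpoly set \<Rightarrow> bool" where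
  "linear_resolution m D J \<longleftrightarrow>
    (\<exists>(b::nat \<Rightarrow> nat) (g::nat \<Rightarrow> 'a mpoly) (M::nat \<Rightarrow> nat \<Rightarrow> nat \<Rightarrow> 'a mpoly).
        (\<forall>j<b 0. in_ring m (g j) \<and> homog D (g j))
      \<and> J = gen_ideal m (g ` {..<b 0})
      \<and> (\<forall>t\<ge>1. \<forall>j<b (t - 1). \<forall>k<b t. in_ring m (M t j k) \<and> homog 1 (M t j k))
      \<and> {v \<in> vecs m (b 0). (\<Sum>j<b 0. v j * g j) = 0} = mat_app (M 1) (b 1) (b 0) ` vecs m (b 1)
      \<and> (\<forall>t\<ge>1. {v \<in> vecs m (b t). mat_app (M t) (b t) (b (t - 1)) v = (\<lambda>_. 0)}
                 = mat_app (M (t + 1)) (b (t + 1)) (b t) ` vecs m (b (t + 1))))"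

end

theory Submission
  imports Defs "Jordan_Normal_Form.Determinant" "HOL-Library.Function_Algebras"
begin

text \<open>
  Write \<open>S\<close> and \<open>B\<close> for the two polynomial rings, \<open>J = I\<^sub>n(\<Theta>)\<close>, and \<open>A\<close> for the subalgebra of \<open>S\<close>
  generated by the \<open>f\<^sub>i\<close>, which is the coordinate ring of \<open>W\<close>. A graded \<open>B\<close>-module generated in
  degree \<open>\<delta>\<close> has a linear resolution iff its Koszul homology \<open>H\<^sub>i\<close> with respect to the variables
  vanishes in all internal degrees above \<open>\<delta> + i\<close>. Since \<open>I\<close> contains powers of all variables,
  \<open>H\<^sub>i(f; S)\<close> vanishes in degrees above \<open>d (i + n) - n\<close>. If \<open>I\<^sup>n\<^sup>-\<^sup>1\<close> is a power of the maximal
  ideal, then \<open>A\<close> agrees with the Veronese subring \<open>S\<^sup>(\<^sup>d\<^sup>)\<close> from degree \<open>n - 1\<close> on, and the long exact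
  sequence of \<open>0 \<rightarrow> I(W) \<rightarrow> B \<rightarrow> A \<rightarrow> 0\<close> transfers this vanishing to the truncation of \<open>I(W)\<close> at \<open>n\<close>.

  Conversely, let \<open>J\<close> have a linear resolution. The \<open>(n - 1)\<close>-minors of \<open>\<Theta>\<close> generate an ideal
  primary to the irrelevant ideal of \<open>B\<close>: otherwise \<open>\<Theta> y = 0\<close> would hold along a line on which all
  \<open>f\<^sub>i\<close> are proportional, because linear syzygies generate the Koszul syzygies. Substituting the
  vectors of maximal minors for \<open>x\<close> shows that \<open>I(W) / J\<close> and \<open>S\<^sup>(\<^sup>d\<^sup>) / A\<close> are torsion with respect
  to the \<open>T\<^sub>l\<close>, so either has a nonzero socle element in every degree range where it is nonzero.
  A socle element of \<open>I(W) / J\<close> in degree at least \<open>n\<close> would give a nonzero class in \<open>H\<^sub>r\<^sub>-\<^sub>1(T; J)\<close>, in a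
  degree where it vanishes. Hence \<open>J\<close> and \<open>I(W)\<close> agree from degree \<open>n\<close> on, and the same long exact
  sequence gives the vanishing of \<open>H\<^sub>r\<^sub>-\<^sub>1(f; A)\<close> that excludes socle elements of \<open>S\<^sup>(\<^sup>d\<^sup>) / A\<close> from
  degree \<open>n - 1\<close> on, so \<open>S\<^sub>d\<^sub>(\<^sub>n\<^sub>-\<^sub>1\<^sub>) \<subseteq> A\<close>.
\<close>

section \<open>Additive subgroups, subrings and submodules\<close>

definition is_add_subgroup :: "'a::ab_group_add set \<Rightarrow> bool" where
  "is_add_subgroup G \<longleftrightarrow> 0 \<in> G \<and> (\<forall>x\<in>G. \<forall>y\<in>G. x - y \<in> G)"

lemma is_add_subgroupI:
  assumes "0 \<in> G" "\<And>x y. x \<in> G \<Longrightarrow> y \<in> G \<Longrightarrow> x - y \<in> G"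
  shows "is_add_subgroup G"
  using assms by (simp add: is_add_subgroup_def)

context
  fixes G :: "'a::ab_group_add set"
  assumes G: "is_add_subgroup G"
begin

lemma add_subgroup_zero: "0 \<in> G"
  using G by (simp add: is_add_subgroup_def)

lemma add_subgroup_diff: "x \<in> G \<Longrightarrow> y \<in> G \<Longrightarrow> x - y \<in> G"
  using G by (simp add: is_add_subgroup_def)

lemma add_subgroup_uminus: "x \<in> G \<Longrightarrow> - x \<in> G"
  using add_subgroup_diff[OF add_subgroup_zero, of x] by simp

lemma add_subgroup_add: "x \<in> G \<Longrightarrow> y \<in> G \<Longrightarrow> x + y \<in> G"
  using add_subgroup_diff[of x "- y"] add_subgroup_uminus[of y] by simp

lemma add_subgroup_sum: "(\<And>x. x \<in> X \<Longrightarrow> g x \<in> G) \<Longrightarrow> sum g X \<in> G"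
  by (induction X rule: infinite_finite_induct) (auto simp: add_subgroup_zero add_subgroup_add)

lemma add_subgroup_image:
  assumes "additive h"
  shows "is_add_subgroup (h ` G)"
proof (rule is_add_subgroupI)
  interpret additive h by fact
  show "0 \<in> h ` G" using zero add_subgroup_zero by (intro image_eqI[of _ _ 0]) auto
  fix x y assume "x \<in> h ` G" "y \<in> h ` G"
  then obtain u v where "u \<in> G" "v \<in> G" "x = h u" "y = h v" by blast
  then show "x - y \<in> h ` G"
    using add_subgroup_diff by (intro image_eqI[of _ _ "u - v"]) (auto simp: diff)
qed

end

lemma is_add_subgroup_Int: "is_add_subgroup G \<Longrightarrow> is_add_subgroup H \<Longrightarrow> is_add_subgroup (G \<inter> H)"
  by (simp add: is_add_subgroup_def)

definition is_subring :: "'a::comm_ring_1 set \<Rightarrow> bool" where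
  "is_subring R \<longleftrightarrow> is_add_subgroup R \<and> 1 \<in> R \<and> (\<forall>x\<in>R. \<forall>y\<in>R. x * y \<in> R)"

context
  fixes R :: "'a::comm_ring_1 set"
  assumes R: "is_subring R"
begin

lemma subring_add_subgroup: "is_add_subgroup R"
  using R by (simp add: is_subring_def)

lemma subring_one: "1 \<in> R"
  using R by (simp add: is_subring_def)

lemma subring_mult: "x \<in> R \<Longrightarrow> y \<in> R \<Longrightarrow> x * y \<in> R"
  using R by (simp add: is_subring_def)

lemma subring_power: "x \<in> R \<Longrightarrow> x ^ k \<in> R"
  by (induction k) (auto simp: subring_one subring_mult)

lemma subring_prod: "(\<And>x. x \<in> X \<Longrightarrow> g x \<in> R) \<Longrightarrow> prod g X \<in> R"
  by (induction X rule: infinite_finite_induct) (auto simp: subring_one subring_mult)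

lemma subring_of_nat: "of_nat k \<in> R"
  by (induction k)
    (auto simp: subring_one add_subgroup_zero[OF subring_add_subgroup]
        add_subgroup_add[OF subring_add_subgroup])

lemma subring_of_int: "of_int k \<in> R"
  by (cases k)
    (auto simp: subring_of_nat add_subgroup_uminus[OF subring_add_subgroup] simp del: of_nat_Suc)

lemma subring_image:
  assumes "comm_ring_hom h"
  shows "is_subring (h ` R)"
proof -
  interpret comm_ring_hom h by fact
  have "additive h" by unfold_locales (rule hom_add)
  then show ?thesis
    using add_subgroup_image[OF subring_add_subgroup] imageI[OF subring_one, of h]
    by (auto simp: is_subring_def subring_mult simp flip: hom_mult)
qed

end

text \<open>Submodules need not be contained in the subring: ideals of \<open>k[X\<^sub>0, \<dots>, X\<^sub>m\<^sub>-\<^sub>1]\<close> live inside the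
  polynomial ring in infinitely many variables.\<close>
definition is_submodule :: "'a::comm_ring_1 set \<Rightarrow> 'a set \<Rightarrow> bool" where
  "is_submodule R U \<longleftrightarrow> is_subring R \<and> is_add_subgroup U \<and> (\<forall>c\<in>R. \<forall>x\<in>U. c * x \<in> U)"

lemma is_submoduleI:
  assumes R: "is_subring R" and "0 \<in> U" "\<And>x y. x \<in> U \<Longrightarrow> y \<in> U \<Longrightarrow> x + y \<in> U"
    and mult: "\<And>c x. c \<in> R \<Longrightarrow> x \<in> U \<Longrightarrow> c * x \<in> U"
  shows "is_submodule R U"
proof -
  have "- 1 \<in> R"
    by (rule add_subgroup_uminus[OF subring_add_subgroup[OF R] subring_one[OF R]])
  then have "- x \<in> U" if "x \<in> U" for x using mult[OF _ that, of "- 1"] by simp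
  then have "x - y \<in> U" if "x \<in> U" "y \<in> U" for x y using assms(3)[of x "- y"] that by simp
  then show ?thesis using assms by (simp add: is_submodule_def is_add_subgroup_def)
qed

context
  fixes R U :: "'a::comm_ring_1 set"
  assumes U: "is_submodule R U"
begin

lemma submodule_subring: "is_subring R"
  and submodule_add_subgroup: "is_add_subgroup U"
  using U by (auto simp: is_submodule_def)

lemmas submodule_zero = add_subgroup_zero[OF submodule_add_subgroup]
  and submodule_add = add_subgroup_add[OF submodule_add_subgroup]
  and submodule_diff = add_subgroup_diff[OF submodule_add_subgroup]
  and submodule_sum = add_subgroup_sum[OF submodule_add_subgroup]

lemma submodule_mult: "c \<in> R \<Longrightarrow> x \<in> U \<Longrightarrow> c * x \<in> U"
  using U by (simp add: is_submodule_def)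

lemma submodule_mult_right: "c \<in> R \<Longrightarrow> x \<in> U \<Longrightarrow> x * c \<in> U"
  using submodule_mult[of c x] by (simp add: mult.commute)

lemma submodule_colon:
  assumes "q \<in> R"
  shows "is_submodule R {p \<in> R. p * q \<in> U}"
  using submodule_zero submodule_add submodule_mult submodule_subring
  by (intro is_submoduleI)
    (auto simp: distrib_right mult.assoc add_subgroup_zero add_subgroup_add subring_add_subgroup
        subring_mult)

lemma submodule_prod_diff:
  assumes "finite X" "\<And>i. i \<in> X \<Longrightarrow> x i \<in> R \<and> x' i \<in> R \<and> x i - x' i \<in> U"
  shows "prod x X - prod x' X \<in> U"
  using assms
proof (induction X)
  case empty then show ?case using submodule_zero by simp
next
  case (insert i X)
  have "prod x (insert i X) - prod x' (insert i X)
      = x i * (prod x X - prod x' X) + (x i - x' i) * prod x' X"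
    using insert.hyps by (simp add: algebra_simps)
  also have "\<dots> \<in> U"
    using insert
    by (intro submodule_add submodule_mult submodule_mult_right
            subring_prod[OF submodule_subring]) auto
  finally show ?case .
qed

text \<open>Every term of the binomial expansion of \<open>(p + q) ^ (s + t)\<close> contains \<open>p ^ s\<close> or \<open>q ^ t\<close>.\<close>
lemma submodule_power_add:
  assumes p: "p \<in> R" "p ^ s \<in> U" and q: "q \<in> R" "q ^ t \<in> U"
  shows "(p + q) ^ (s + t) \<in> U"
  unfolding binomial_ring
proof (rule submodule_sum)
  fix k assume "k \<in> {..s + t}"
  note closed = subring_mult[OF submodule_subring] subring_of_nat[OF submodule_subring]
    subring_power[OF submodule_subring] p(1) q(1)
  let ?b = "of_nat ((s + t) choose k) :: 'a"
  show "?b * p ^ k * q ^ (s + t - k) \<in> U"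
  proof (cases "k \<ge> s")
    case True
    then have "p ^ k = p ^ s * p ^ (k - s)" by (simp flip: power_add)
    then have "?b * p ^ k * q ^ (s + t - k) = (?b * p ^ (k - s) * q ^ (s + t - k)) * p ^ s"
      by (simp add: mult_ac)
    then show ?thesis using submodule_mult[OF _ p(2)] by (simp add: closed)
  next
    case False
    then have "q ^ (s + t - k) = q ^ (s - k) * q ^ t" by (simp flip: power_add)
    then have "?b * p ^ k * q ^ (s + t - k) = (?b * p ^ k * q ^ (s - k)) * q ^ t"
      by (simp add: mult_ac)
    then show ?thesis using submodule_mult[OF _ q(2)] by (simp add: closed)
  qed
qed

end

section \<open>Polynomials, homogeneous components and evaluation\<close>

abbreviation lookup where "lookup \<equiv> Poly_Mapping.lookup"
abbreviation keys where "keys \<equiv> Poly_Mapping.keys"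
abbreviation single where "single \<equiv> Poly_Mapping.single"

lemma sum_single_lookup: "(\<Sum>m\<in>keys p. single m (lookup p m)) = p"
  by (rule poly_mapping_eqI)
    (auto simp: lookup_sum lookup_single when_def sum.delta' in_keys_iff)

lemma keys_add_nat: "keys (m + m') = keys m \<union> keys (m' :: 'a \<Rightarrow>\<^sub>0 nat)"
  by (auto simp: in_keys_iff lookup_add)

lemma single_add_diff:
  assumes "lookup m i \<ge> k"
  shows "single i k + (m - single i k) = (m :: 'a \<Rightarrow>\<^sub>0 nat)"
  by (rule poly_mapping_eqI)
    (use assms in \<open>auto simp: lookup_add lookup_minus lookup_single when_def\<close>)

lemma tdeg_superset: "finite X \<Longrightarrow> keys m \<subseteq> X \<Longrightarrow> tdeg m = (\<Sum>i\<in>X. lookup m i)"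
  unfolding tdeg_def by (rule sum.mono_neutral_left) (auto simp: in_keys_iff)

lemma tdeg_add: "tdeg (m + m') = tdeg m + tdeg m'"
proof -
  let ?X = "keys m \<union> keys m'"
  have "tdeg (m + m') = (\<Sum>i\<in>?X. lookup (m + m') i)" by (simp add: tdeg_def keys_add_nat)
  also have "\<dots> = (\<Sum>i\<in>?X. lookup m i) + (\<Sum>i\<in>?X. lookup m' i)"
    by (simp add: lookup_add sum.distrib)
  also have "\<dots> = tdeg m + tdeg m'" by (subst (1 2) tdeg_superset[of ?X]) auto
  finally show ?thesis .
qed

lemma tdeg_zero [simp]: "tdeg 0 = 0"
  by (simp add: tdeg_def)

lemma tdeg_single [simp]: "tdeg (single i k) = k"
  by (simp add: tdeg_def)

lemma tdeg_eq_0_iff: "tdeg m = 0 \<longleftrightarrow> m = 0"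
  by (auto simp: tdeg_def in_keys_iff intro: poly_mapping_eqI)

lemma tdeg_eq_1_iff: "tdeg m = 1 \<longleftrightarrow> (\<exists>l. m = single l 1)"
proof
  assume m: "tdeg m = 1"
  then have "m \<noteq> 0" by auto
  then obtain l where l: "l \<in> keys m" by fastforce
  then have "lookup m l \<ge> 1" by (simp add: in_keys_iff)
  note split = single_add_diff[OF this]
  then have "tdeg (m - single l 1) = 0"
    using m tdeg_add[of "single l 1" "m - single l 1"] by simp
  then have "m - single l 1 = 0" by (simp only: tdeg_eq_0_iff)
  then show "\<exists>l. m = single l 1" using split by auto
qed auto

lemma inj_single_one: "inj (\<lambda>l. single l (1::nat))"
  by (rule injI) (metis lookup_single_eq lookup_single_not_eq zero_neq_one)

lemma finite_monomials: "finite {m. keys m \<subseteq> {..<r} \<and> tdeg m = e}"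
proof (rule finite_imageD)
  let ?X = "{m. keys m \<subseteq> {..<r} \<and> tdeg m = e}"
  have "(\<lambda>m. restrict (lookup m) {..<r}) ` ?X \<subseteq> PiE {..<r} (\<lambda>_. {..e})"
  proof (intro image_subsetI PiE_I)
    fix m i assume m: "m \<in> ?X" and i: "i \<in> {..<r}"
    have "lookup m i \<le> (\<Sum>i<r. lookup m i)" by (rule member_le_sum) (use i in auto)
    then show "restrict (lookup m) {..<r} i \<in> {..e}" using tdeg_superset[of "{..<r}" m] m i by simp
  qed auto
  then show "finite ((\<lambda>m. restrict (lookup m) {..<r}) ` ?X)"
    by (rule finite_subset) (auto intro: finite_PiE)
  show "inj_on (\<lambda>m. restrict (lookup m) {..<r}) ?X"
  proof (rule inj_onI, rule poly_mapping_eqI)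
    fix m m' i
    assume m: "m \<in> ?X" "m' \<in> ?X" and eq: "restrict (lookup m) {..<r} = restrict (lookup m') {..<r}"
    show "lookup m i = lookup m' i"
    proof (cases "i < r")
      case True then show ?thesis using fun_cong[OF eq, of i] by simp
    next
      case False
      then have "i \<notin> keys m" "i \<notin> keys m'" using m by auto
      then show ?thesis by (simp add: in_keys_iff)
    qed
  qed
qed

interpretation Const: comm_ring_hom Const
  by unfold_locales (simp_all add: Const_def single_add mult_single)

lemma lookup_Const_mult: "lookup (Const c * p) m = c * lookup p m"
  by (simp add: Const_def mult_map_scale_conv_mult[symmetric] Poly_Mapping.map.rep_eq when_def)

lemma Const_mult_single: "Const c * single m x = single m (c * x)"
  by (simp add: Const_def mult_single)

lemma Var_power: "Var i ^ k = single (single i k) 1"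
  by (induction k) (auto simp: Var_def mult_single simp flip: single_add)

lemma Var_neq_0 [simp]: "Var i \<noteq> (0 :: 'a::comm_ring_1 mpoly)"
proof
  assume "Var i = (0 :: 'a mpoly)"
  then have "lookup (Var i :: 'a mpoly) (single i 1) = 0" by simp
  then show False by (simp add: Var_def)
qed

lemma lookup_single_mult:
  fixes a :: "'b \<Rightarrow>\<^sub>0 nat" and p :: "('b \<Rightarrow>\<^sub>0 nat) \<Rightarrow>\<^sub>0 'a::comm_ring_1"
  shows "lookup (single a c * p) (a + m) = c * lookup p m"
proof -
  have "single a c * p = (\<Sum>m'\<in>keys p. single (a + m') (c * lookup p m'))"
    by (subst sum_single_lookup[of p, symmetric]) (simp add: sum_distrib_left mult_single)
  then have "lookup (single a c * p) (a + m) = (\<Sum>m'\<in>keys p. if m' = m then c * lookup p m' else 0)"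
    by (simp add: lookup_sum lookup_single when_def)
  then show ?thesis by (simp add: in_keys_iff)
qed

abbreviation poly_ring :: "nat \<Rightarrow> 'a::comm_ring_1 mpoly set" where
  "poly_ring m \<equiv> {p. in_ring m p}"

lemma is_subring_poly_ring: "is_subring (poly_ring m)"
proof -
  have "in_ring m (p * q)" if pq: "in_ring m p" "in_ring m q" for p q :: "'a mpoly"
    unfolding in_ring_def
  proof (intro ballI)
    fix mon i assume "mon \<in> keys (p * q)" "i \<in> keys mon"
    then obtain a b where "mon = a + b" "a \<in> keys p" "b \<in> keys q" using keys_mult[of p q] by blast
    with \<open>i \<in> keys mon\<close> pq show "i < m" by (auto simp: keys_add_nat in_ring_def)
  qed
  moreover have "in_ring m (p - q)" if "in_ring m p" "in_ring m q" for p q :: "'a mpoly"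
    using that by (auto simp: in_ring_def in_keys_iff lookup_minus)
  moreover have "in_ring m (0 :: 'a mpoly)" "in_ring m (1 :: 'a mpoly)"
    by (simp_all add: in_ring_def)
  ultimately show ?thesis by (simp add: is_subring_def is_add_subgroup_def)
qed

lemmas is_add_subgroup_poly_ring = subring_add_subgroup[OF is_subring_poly_ring]

lemma in_ring_0 [simp]: "in_ring m 0"
  and in_ring_1 [simp]: "in_ring m 1"
  and in_ring_Const [simp]: "in_ring m (Const c)"
  and in_ring_of_int [simp]: "in_ring m (of_int k)"
  using subring_of_int[OF is_subring_poly_ring, of k m] by (auto simp: in_ring_def Const_def)

lemma in_ring_Var [simp]: "i < m \<Longrightarrow> in_ring m (Var i)"
  by (auto simp: in_ring_def Var_def split: if_splits)

lemmas in_ring_add [simp] = add_subgroup_add[OF is_add_subgroup_poly_ring, simplified]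
  and in_ring_diff [simp] = add_subgroup_diff[OF is_add_subgroup_poly_ring, simplified]
  and in_ring_mult [simp] = subring_mult[OF is_subring_poly_ring, simplified]
  and in_ring_power [simp] = subring_power[OF is_subring_poly_ring, simplified]
  and in_ring_sum [simp] = add_subgroup_sum[OF is_add_subgroup_poly_ring, simplified]
  and in_ring_prod [simp] = subring_prod[OF is_subring_poly_ring, simplified]

lemma homog_mult:
  assumes "homog a p" "homog b q" shows "homog (a + b) (p * q)"
  unfolding homog_def
proof
  fix mon assume "mon \<in> keys (p * q)"
  then obtain m m' where "mon = m + m'" "m \<in> keys p" "m' \<in> keys q" using keys_mult[of p q] by blast
  with assms show "tdeg mon = a + b" by (auto simp: tdeg_add homog_def)
qed

lemma homog_0 [simp]: "homog e 0"
  and homog_1 [simp]: "homog 0 1"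
  and homog_Const [simp]: "homog 0 (Const c)"
  and homog_Var [simp]: "homog (Suc 0) (Var i)"
  by (simp_all add: homog_def Const_def Var_def)

lemma is_add_subgroup_homog: "is_add_subgroup {p. homog e p}"
proof (rule is_add_subgroupI)
  show "p - q \<in> {p. homog e p}" if "p \<in> {p. homog e p}" "q \<in> {p. homog e p}" for p q :: "'a mpoly"
    using that keys_add[of p "- q"] by (auto simp: homog_def in_keys_iff)
qed simp

lemma homog_sum: "(\<And>x. x \<in> X \<Longrightarrow> homog e (g x)) \<Longrightarrow> homog e (sum g X)"
  using add_subgroup_sum[OF is_add_subgroup_homog, of X g e] by simp

lemma homog_power: "homog e p \<Longrightarrow> homog (e * k) (p ^ k)"
proof (induction k)
  case (Suc k)
  then show ?case using homog_mult[of e p "e * k" "p ^ k"] by simp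
qed simp

lemma homog_prod: "(\<And>x. x \<in> X \<Longrightarrow> homog (e x) (g x)) \<Longrightarrow> homog (sum e X) (prod g X)"
  by (induction X rule: infinite_finite_induct) (auto intro: homog_mult)

lemma homog_0_eq_Const: "homog 0 p \<Longrightarrow> p = Const (lookup p 0)"
  by (rule poly_mapping_eqI)
    (auto simp: Const_def lookup_single when_def homog_def tdeg_eq_0_iff in_keys_iff)

definition forms :: "nat \<Rightarrow> nat \<Rightarrow> 'a::comm_ring_1 mpoly set" where
  "forms n e = {p. in_ring n p \<and> homog e p}"

lemma is_add_subgroup_forms: "is_add_subgroup (forms n e)"
proof -
  have "forms n e = poly_ring n \<inter> {p :: 'a mpoly. homog e p}" by (auto simp: forms_def)
  then show ?thesis
    by (simp only: is_add_subgroup_Int is_add_subgroup_poly_ring is_add_subgroup_homog)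
qed

lemmas forms_zero [simp] = add_subgroup_zero[OF is_add_subgroup_forms]
  and forms_diff = add_subgroup_diff[OF is_add_subgroup_forms]
  and forms_sum = add_subgroup_sum[OF is_add_subgroup_forms]

lemma forms_mult: "p \<in> forms n a \<Longrightarrow> q \<in> forms n b \<Longrightarrow> p * q \<in> forms n (a + b)"
  by (simp add: forms_def homog_mult)

lemma forms_Const: "Const c \<in> forms n 0"
  by (simp add: forms_def)

lemma forms_Var: "i < n \<Longrightarrow> Var i \<in> forms n (Suc 0)"
  by (simp add: forms_def)

lemma forms_Var_mult: "i < n \<Longrightarrow> p \<in> forms n e \<Longrightarrow> Var i * p \<in> forms n (Suc e)"
  using forms_mult[OF forms_Var] by fastforce

lemma linear_form_expand:
  assumes p: "p \<in> forms n 1"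
  shows "p = (\<Sum>l<n. Const (lookup p (single l 1)) * Var l)"
proof (rule poly_mapping_eqI)
  fix m
  have "lookup (\<Sum>l<n. Const (lookup p (single l 1)) * Var l) m
      = (\<Sum>l<n. if single l 1 = m then lookup p m else 0)"
    by (auto simp: lookup_sum lookup_Const_mult Var_def lookup_single when_def intro!: sum.cong)
  also have "\<dots> = lookup p m"
  proof (cases "m \<in> keys p")
    case False
    then show ?thesis by (simp add: in_keys_iff cong: if_cong)
  next
    case True
    with p have m: "tdeg m = 1" "keys m \<subseteq> {..<n}" by (auto simp: forms_def homog_def in_ring_def)
    then obtain l where l: "m = single l 1" unfolding tdeg_eq_1_iff by blast
    then show ?thesis using m(2) by (simp add: inj_eq[OF inj_single_one, unfolded One_nat_def])
  qed
  finally show "lookup p m = lookup (\<Sum>l<n. Const (lookup p (single l 1)) * Var l) m" ..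
qed

definition hom_comp :: "nat \<Rightarrow> 'a::comm_ring_1 mpoly \<Rightarrow> 'a mpoly" where
  "hom_comp e p = Poly_Mapping.mapp (\<lambda>m c. if tdeg m = e then c else 0) p"

lemma lookup_hom_comp: "lookup (hom_comp e p) m = (if tdeg m = e then lookup p m else 0)"
  by (auto simp: hom_comp_def lookup_mapp when_def in_keys_iff)

lemma keys_hom_comp: "keys (hom_comp e p) = {m \<in> keys p. tdeg m = e}"
  by (auto simp: in_keys_iff lookup_hom_comp split: if_splits)

interpretation hom_comp: additive "hom_comp e"
  by unfold_locales (auto intro: poly_mapping_eqI simp: lookup_hom_comp lookup_add)

lemma in_ring_hom_comp: "in_ring m p \<Longrightarrow> in_ring m (hom_comp e p)"
  by (auto simp: in_ring_def keys_hom_comp)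

lemma homog_hom_comp [simp]: "homog e (hom_comp e p)"
  by (auto simp: homog_def keys_hom_comp)

lemma forms_hom_comp: "in_ring n p \<Longrightarrow> hom_comp e p \<in> forms n e"
  by (simp add: forms_def in_ring_hom_comp)

lemma hom_comp_homog: "homog e p \<Longrightarrow> hom_comp e' p = (if e' = e then p else 0)"
  by (rule poly_mapping_eqI) (auto simp: lookup_hom_comp homog_def in_keys_iff)

lemma hom_comp_0: "hom_comp 0 p = Const (lookup p 0)"
  using homog_0_eq_Const[of "hom_comp 0 p"] by (simp add: lookup_hom_comp)

lemma sum_hom_comp: "finite E \<Longrightarrow> tdeg ` keys p \<subseteq> E \<Longrightarrow> (\<Sum>e\<in>E. hom_comp e p) = p"
  by (rule poly_mapping_eqI)
    (auto simp: lookup_sum lookup_hom_comp simp flip: not_in_keys_iff_lookup_eq_zero)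

lemma hom_comp_graded_map:
  assumes "additive h" "inj \<sigma>" and h: "\<And>e. homog (\<sigma> e) (h (hom_comp e p))"
  shows "hom_comp (\<sigma> e) (h p) = h (hom_comp e p)"
proof -
  interpret additive h by fact
  let ?E = "insert e (tdeg ` keys p)"
  have "hom_comp (\<sigma> e) (h p) = hom_comp (\<sigma> e) (h (\<Sum>e'\<in>?E. hom_comp e' p))"
    by (subst sum_hom_comp[of ?E p]) auto
  also have "\<dots> = (\<Sum>e'\<in>?E. hom_comp (\<sigma> e) (h (hom_comp e' p)))" by (simp only: sum hom_comp.sum)
  also have "\<dots> = (\<Sum>e'\<in>?E. if e' = e then h (hom_comp e' p) else 0)"
    using inj_eq[OF \<open>inj \<sigma>\<close>] by (intro sum.cong refl) (auto simp: hom_comp_homog[OF h])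
  also have "\<dots> = h (hom_comp e p)" by (subst sum.delta) auto
  finally show ?thesis .
qed

lemma hom_comp_mult_homog:
  assumes "homog D q"
  shows "hom_comp (e + D) (p * q) = hom_comp e p * q"
  by (rule hom_comp_graded_map[where h="\<lambda>p. p * q" and \<sigma>="\<lambda>e. e + D"])
    (auto simp: additive_def distrib_right inj_def intro: homog_mult assms)

lemma homog_combination:
  assumes "p \<in> forms n (e + D)" "\<And>j. j \<in> X \<Longrightarrow> homog D (g j)" "p = (\<Sum>j\<in>X. v j * g j)"
  shows "p = (\<Sum>j\<in>X. hom_comp e (v j) * g j)"
proof -
  have "p = hom_comp (e + D) (\<Sum>j\<in>X. v j * g j)"
    using assms(1) hom_comp_homog[of "e + D" p] by (simp add: forms_def flip: assms(3))
  also have "\<dots> = (\<Sum>j\<in>X. hom_comp e (v j) * g j)"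
    unfolding hom_comp.sum by (intro sum.cong refl hom_comp_mult_homog assms(2))
  finally show ?thesis .
qed

definition eval_monom :: "(nat \<Rightarrow> 'r::comm_ring_1) \<Rightarrow> (nat \<Rightarrow>\<^sub>0 nat) \<Rightarrow> 'r" where
  "eval_monom y m = (\<Prod>i\<in>keys m. y i ^ lookup m i)"

definition eval_mpoly :: "('k::comm_ring_1 \<Rightarrow> 'r::comm_ring_1) \<Rightarrow> (nat \<Rightarrow> 'r) \<Rightarrow> 'k mpoly \<Rightarrow> 'r" where
  "eval_mpoly h y p = (\<Sum>m\<in>keys p. h (lookup p m) * eval_monom y m)"

lemma eval_monom_superset:
  "finite X \<Longrightarrow> keys m \<subseteq> X \<Longrightarrow> eval_monom y m = (\<Prod>i\<in>X. y i ^ lookup m i)"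
  unfolding eval_monom_def by (rule prod.mono_neutral_left) (auto simp: in_keys_iff)

lemma eval_monom_add: "eval_monom y (m + m') = eval_monom y m * eval_monom y m'"
proof -
  let ?X = "keys m \<union> keys m'"
  have "eval_monom y (m + m') = (\<Prod>i\<in>?X. y i ^ lookup (m + m') i)"
    by (simp add: eval_monom_def keys_add_nat)
  also have "\<dots> = (\<Prod>i\<in>?X. y i ^ lookup m i) * (\<Prod>i\<in>?X. y i ^ lookup m' i)"
    by (simp add: lookup_add power_add prod.distrib)
  also have "\<dots> = eval_monom y m * eval_monom y m'"
    by (subst (1 2) eval_monom_superset[of ?X]) auto
  finally show ?thesis .
qed

lemma eval_monom_0 [simp]: "eval_monom y 0 = 1"
  by (simp add: eval_monom_def)

lemma eval_monom_single [simp]: "eval_monom y (single i k) = y i ^ k"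
  by (simp add: eval_monom_def)

lemma eval_monom_scale: "eval_monom (\<lambda>i. c * y i) m = c ^ tdeg m * eval_monom y m"
  by (simp add: eval_monom_def tdeg_def power_mult_distrib prod.distrib power_sum)

lemma eval_monom_Var: "eval_monom Var m = single m 1"
proof -
  have "(\<Prod>i\<in>X. single (g i) (1::'a)) = single (sum g X) 1"
    if "finite X" for X :: "nat set" and g :: "nat \<Rightarrow> (nat \<Rightarrow>\<^sub>0 nat)"
    using that by (induction X) (auto simp: mult_single)
  then show ?thesis by (simp add: eval_monom_def Var_power sum_single_lookup)
qed

lemma homog_eval_monom:
  assumes "\<And>i. i \<in> keys m \<Longrightarrow> homog d (y i)"
  shows "homog (d * tdeg m) (eval_monom y m)"
  unfolding eval_monom_def tdeg_def sum_distrib_left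
  by (rule homog_prod) (simp add: assms homog_power)

context comm_ring_hom
begin

lemma eval_mpoly_superset:
  "finite X \<Longrightarrow> keys p \<subseteq> X \<Longrightarrow> eval_mpoly hom y p = (\<Sum>m\<in>X. hom (lookup p m) * eval_monom y m)"
  unfolding eval_mpoly_def by (rule sum.mono_neutral_left) (auto simp: in_keys_iff)

lemma eval_mpoly_single: "eval_mpoly hom y (single m c) = hom c * eval_monom y m"
  by (cases "c = 0") (simp_all add: eval_mpoly_def)

lemma eval_mpoly_Const [simp]: "eval_mpoly hom y (Const c) = hom c"
  by (simp add: Const_def eval_mpoly_single)

lemma eval_mpoly_Var [simp]: "eval_mpoly hom y (Var i) = y i"
  by (simp add: Var_def eval_mpoly_single)

lemma eval_mpoly_add: "eval_mpoly hom y (p + q) = eval_mpoly hom y p + eval_mpoly hom y q"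
proof -
  let ?X = "keys p \<union> keys q"
  have "eval_mpoly hom y (p + q) = (\<Sum>m\<in>?X. hom (lookup (p + q) m) * eval_monom y m)"
    by (rule eval_mpoly_superset) (use keys_add[of p q] in auto)
  also have "\<dots>
      = (\<Sum>m\<in>?X. hom (lookup p m) * eval_monom y m) + (\<Sum>m\<in>?X. hom (lookup q m) * eval_monom y m)"
    by (simp add: lookup_add hom_distribs sum.distrib distrib_right)
  also have "\<dots> = eval_mpoly hom y p + eval_mpoly hom y q"
    by (subst (1 2) eval_mpoly_superset[of ?X]) auto
  finally show ?thesis .
qed

lemma additive_eval_mpoly: "additive (eval_mpoly hom y)"
  by unfold_locales (rule eval_mpoly_add)

lemma eval_mpoly_mult: "eval_mpoly hom y (p * q) = eval_mpoly hom y p * eval_mpoly hom y q"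
proof -
  have "p * q = (\<Sum>m\<in>keys p. single m (lookup p m)) * (\<Sum>m\<in>keys q. single m (lookup q m))"
    by (simp add: sum_single_lookup)
  also have "\<dots> = (\<Sum>m\<in>keys p. \<Sum>m'\<in>keys q. single (m + m') (lookup p m * lookup q m'))"
    by (simp add: sum_product mult_single)
  finally have "eval_mpoly hom y (p * q) = (\<Sum>m\<in>keys p. \<Sum>m'\<in>keys q.
      (hom (lookup p m) * eval_monom y m) * (hom (lookup q m') * eval_monom y m'))"
    by (simp add: additive.sum[OF additive_eval_mpoly] eval_mpoly_single eval_monom_add hom_distribs
        algebra_simps)
  then show ?thesis by (simp add: eval_mpoly_def sum_product)
qed

lemma comm_ring_hom_eval_mpoly: "comm_ring_hom (eval_mpoly hom y)"
  by unfold_locales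
    (use eval_mpoly_Const[of y 1] in \<open>simp_all add: eval_mpoly_add eval_mpoly_mult
        eval_mpoly_def[of _ _ 0]\<close>)

lemma eval_mpoly_scale: "homog e p \<Longrightarrow> eval_mpoly hom (\<lambda>i. c * y i) p = c ^ e * eval_mpoly hom y p"
  by (auto simp: eval_mpoly_def eval_monom_scale homog_def sum_distrib_left mult_ac
      intro!: sum.cong)

lemma eval_mpoly_cong:
  "in_ring n p \<Longrightarrow> (\<And>i. i < n \<Longrightarrow> y i = y' i) \<Longrightarrow> eval_mpoly hom y p = eval_mpoly hom y' p"
  unfolding eval_mpoly_def eval_monom_def in_ring_def
  by (auto intro!: sum.cong prod.cong arg_cong2[where f="(*)"])

lemma eval_mpoly_closed:
  assumes C: "is_subring C" "\<And>c. hom c \<in> C" and p: "in_ring n p" and y: "\<And>i. i < n \<Longrightarrow> y i \<in> C"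
  shows "eval_mpoly hom y p \<in> C"
  unfolding eval_mpoly_def eval_monom_def using p
  by (intro add_subgroup_sum[OF subring_add_subgroup[OF C(1)]] subring_mult[OF C(1)] C(2)
      subring_prod[OF C(1)] subring_power[OF C(1)] y) (auto simp: in_ring_def)

end

lemma degree_eval_mpoly_le:
  assumes "\<And>c. degree (h c) = 0" "\<And>l. degree (y l) \<le> 1" "homog e q"
  shows "degree (eval_mpoly h y q) \<le> e"
  unfolding eval_mpoly_def
proof (rule degree_sum_le)
  fix m assume m: "m \<in> keys q"
  have "degree (eval_monom y m) \<le> (\<Sum>i\<in>keys m. degree (y i ^ lookup m i))"
    unfolding eval_monom_def using degree_prod_sum_le[of "keys m" "\<lambda>i. y i ^ lookup m i"]
    by (simp add: o_def)
  also have "\<dots> \<le> (\<Sum>i\<in>keys m. lookup m i)"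
  proof (rule sum_mono)
    fix i
    have "degree (y i ^ lookup m i) \<le> degree (y i) * lookup m i" by (rule degree_power_le)
    also have "\<dots> \<le> lookup m i" using assms(2)[of i] by (cases "degree (y i)") auto
    finally show "degree (y i ^ lookup m i) \<le> lookup m i" .
  qed
  also have "\<dots> = e" using assms(3) m by (auto simp: homog_def tdeg_def)
  finally show "degree (h (lookup q m) * eval_monom y m) \<le> e"
    using degree_mult_le[of "h (lookup q m)" "eval_monom y m"] assms(1) by simp
qed simp

lemma subst_eq_eval_mpoly: "subst y = eval_mpoly Const y"
  by (rule ext) (simp add: subst_def eval_mpoly_def eval_monom_def)

interpretation subst: comm_ring_hom "subst y"
  unfolding subst_eq_eval_mpoly by (rule Const.comm_ring_hom_eval_mpoly)

lemma additive_subst: "additive (subst y)"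
  by unfold_locales (rule subst.hom_add)

lemmas subst_Const [simp] = Const.eval_mpoly_Const[folded subst_eq_eval_mpoly]
  and subst_Var [simp] = Const.eval_mpoly_Var[folded subst_eq_eval_mpoly]
  and subst_scale = Const.eval_mpoly_scale[folded subst_eq_eval_mpoly]
  and subst_cong = Const.eval_mpoly_cong[folded subst_eq_eval_mpoly]

lemma (in comm_ring_hom) hom_eval_mpoly:
  "hom (eval_mpoly h y p) = eval_mpoly (\<lambda>c. hom (h c)) (\<lambda>i. hom (y i)) p"
  by (simp add: eval_mpoly_def eval_monom_def hom_distribs)

lemma (in comm_ring_hom) eval_mpoly_subst:
  "eval_mpoly hom y (subst g p) = eval_mpoly hom (\<lambda>i. eval_mpoly hom y (g i)) p"
  using comm_ring_hom.hom_eval_mpoly[OF comm_ring_hom_eval_mpoly, of y Const g p]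
  by (simp add: subst_eq_eval_mpoly)

lemmas subst_subst = Const.eval_mpoly_subst[folded subst_eq_eval_mpoly]

lemma subst_Var_id: "subst Var p = p"
  by (simp add: subst_eq_eval_mpoly eval_mpoly_def eval_monom_Var Const_mult_single
      sum_single_lookup)

lemma in_ring_subst:
  assumes "in_ring r p" "\<And>i. i < r \<Longrightarrow> in_ring n (y i)"
  shows "in_ring n (subst y p)"
  using Const.eval_mpoly_closed[OF is_subring_poly_ring, of n r p y] assms
  by (simp add: subst_eq_eval_mpoly)

lemma homog_subst:
  assumes p: "in_ring r p" "homog e p" and y: "\<And>i. i < r \<Longrightarrow> homog d (y i)"
  shows "homog (d * e) (subst y p)"
  unfolding subst_eq_eval_mpoly eval_mpoly_def
proof (rule homog_sum)
  fix m assume m: "m \<in> keys p"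
  have "homog (d * tdeg m) (eval_monom y m)"
    by (rule homog_eval_monom) (use p y m in \<open>auto simp: in_ring_def\<close>)
  then show "homog (d * e) (Const (lookup p m) * eval_monom y m)"
    using homog_mult[OF homog_Const] p m by (fastforce simp: homog_def)
qed

lemma hom_comp_subst:
  assumes p: "in_ring r p" and y: "\<And>i. i < r \<Longrightarrow> homog d (y i)" and d: "d \<ge> 1"
  shows "hom_comp (d * e) (subst y p) = subst y (hom_comp e p)"
  by (rule hom_comp_graded_map[OF additive_subst, of "(*) d"])
    (use d in \<open>auto simp: inj_def intro: homog_subst[OF in_ring_hom_comp[OF p]] y\<close>)

lemma subst_diff_in_submodule:
  assumes U: "is_submodule (poly_ring r) U" and p: "in_ring m p"
    and y: "\<And>i. i < m \<Longrightarrow> in_ring r (y i) \<and> in_ring r (y' i) \<and> y i - y' i \<in> U"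
  shows "subst y p - subst y' p \<in> U"
proof -
  have "subst y p - subst y' p
      = (\<Sum>mon\<in>keys p. Const (lookup p mon) * (eval_monom y mon - eval_monom y' mon))"
    by (simp add: subst_eq_eval_mpoly eval_mpoly_def right_diff_distrib sum_subtractf)
  also have "\<dots> \<in> U"
  proof (intro submodule_sum[OF U] submodule_mult[OF U])
    fix mon assume "mon \<in> keys p"
    then have lt: "i < m" if "i \<in> keys mon" for i using p that by (auto simp: in_ring_def)
    have power: "y i ^ k - y' i ^ k \<in> U" if "i < m" for i k
      using submodule_prod_diff[OF U, of "{..<k}" "\<lambda>_. y i" "\<lambda>_. y' i"] y[OF that] by simp
    show "eval_monom y mon - eval_monom y' mon \<in> U"
      unfolding eval_monom_def by (rule submodule_prod_diff[OF U]) (use lt power y in auto)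
  qed simp
  finally show ?thesis .
qed

section \<open>The Koszul complex of commuting operators\<close>

definition koszul_sign :: "nat \<Rightarrow> nat set \<Rightarrow> 'b::ab_group_add \<Rightarrow> 'b" where
  "koszul_sign l A x = (if even (card {a \<in> A. a < l}) then x else - x)"

definition koszul_diff :: "nat \<Rightarrow> (nat \<Rightarrow> 'b \<Rightarrow> 'b) \<Rightarrow>
    (nat set \<Rightarrow> 'b) \<Rightarrow> nat set \<Rightarrow> 'b::ab_group_add" where
  "koszul_diff r \<phi> c A = (\<Sum>l\<in>{..<r} - A. koszul_sign l A (\<phi> l (c (insert l A))))"

definition koszul_wedge :: "nat \<Rightarrow> (nat set \<Rightarrow> 'b) \<Rightarrow> nat set \<Rightarrow> 'b::ab_group_add" where
  "koszul_wedge l c A = (if l \<in> A then koszul_sign l A (c (A - {l})) else 0)"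

definition koszul_chain :: "nat \<Rightarrow> nat \<Rightarrow> 'b::zero set \<Rightarrow> (nat set \<Rightarrow> 'b) \<Rightarrow> bool" where
  "koszul_chain r i Z c \<longleftrightarrow> (\<forall>A. if A \<subseteq> {..<r} \<and> card A = i then c A \<in> Z else c A = 0)"

text \<open>Exactness at a graded piece: \<open>X\<close> and \<open>Y\<close> are the pieces of a graded module from which the
  coefficients of the \<open>(i + 1)\<close>-chains and of the \<open>i\<close>-chains are taken.\<close>
definition koszul_exact ::
    "nat \<Rightarrow> (nat \<Rightarrow> 'b \<Rightarrow> 'b) \<Rightarrow> nat \<Rightarrow> 'b set \<Rightarrow> 'b::ab_group_add set \<Rightarrow> bool" where
  "koszul_exact r \<phi> i X Y \<longleftrightarrow> (\<forall>z. koszul_chain r i Y z \<longrightarrow> (\<forall>A. koszul_diff r \<phi> z A = 0) \<longrightarrow>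
     (\<exists>w. koszul_chain r (Suc i) X w \<and> (\<forall>A. koszul_diff r \<phi> w A = z A)))"

lemma koszul_exactI:
  assumes "\<And>z. koszul_chain r i Y z \<Longrightarrow> (\<And>A. koszul_diff r \<phi> z A = 0) \<Longrightarrow>
    \<exists>w. koszul_chain r (Suc i) X w \<and> (\<forall>A. koszul_diff r \<phi> w A = z A)"
  shows "koszul_exact r \<phi> i X Y"
  using assms by (simp add: koszul_exact_def)

lemma koszul_exactE:
  assumes "koszul_exact r \<phi> i X Y" "koszul_chain r i Y z" "\<And>A. koszul_diff r \<phi> z A = 0"
  obtains w where "koszul_chain r (Suc i) X w" "\<And>A. koszul_diff r \<phi> w A = z A"
  using assms unfolding koszul_exact_def by blast

interpretation koszul_sign: additive "koszul_sign l A"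
  by unfold_locales (simp add: koszul_sign_def)

lemma koszul_sign_involution [simp]: "koszul_sign l A (koszul_sign l A x) = x"
  by (simp add: koszul_sign_def)

lemma koszul_sign_left_commute:
  "koszul_sign l A (koszul_sign m B x) = koszul_sign m B (koszul_sign l A x)"
  by (simp add: koszul_sign_def)

lemma koszul_sign_empty [simp]: "koszul_sign l {} x = x"
  by (simp add: koszul_sign_def)

lemma koszul_sign_insert:
  assumes "l \<notin> A"
  shows "koszul_sign m (insert l A) x = (if l < m then - koszul_sign m A x else koszul_sign m A x)"
proof -
  have "finite {a \<in> A. a < m}" by (rule finite_subset[of _ "{..<m}"]) auto
  moreover have "{a \<in> insert l A. a < m}
      = (if l < m then insert l {a \<in> A. a < m} else {a \<in> A. a < m})"
    by auto
  ultimately show ?thesis using assms by (simp add: koszul_sign_def)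
qed

lemma koszul_sign_swap:
  assumes "l \<notin> A" "m \<notin> A" "l \<noteq> m"
  shows "koszul_sign l A (koszul_sign m (insert l A) x)
      = - koszul_sign m A (koszul_sign l (insert m A) x)"
  using assms by (simp add: koszul_sign_insert koszul_sign.minus koszul_sign_left_commute[of l])

lemma koszul_sign_in_subgroup: "is_add_subgroup G \<Longrightarrow> x \<in> G \<Longrightarrow> koszul_sign l A x \<in> G"
  by (simp add: koszul_sign_def add_subgroup_uminus)

lemma additive_koszul_sign: "additive h \<Longrightarrow> h (koszul_sign l A x) = koszul_sign l A (h x)"
  by (simp add: koszul_sign_def additive.minus)

lemma sum_antisymmetric:
  fixes g :: "'b \<Rightarrow> 'b \<Rightarrow> 'a::ab_group_add"
  assumes "finite X" "\<And>l m. l \<in> X \<Longrightarrow> m \<in> X \<Longrightarrow> l \<noteq> m \<Longrightarrow> g l m = - g m l"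
  shows "(\<Sum>l\<in>X. \<Sum>m\<in>X - {l}. g l m) = 0"
  using assms
proof (induction X)
  case (insert x X)
  have "(\<Sum>l\<in>insert x X. \<Sum>m\<in>insert x X - {l}. g l m)
      = (\<Sum>m\<in>X. g x m) + (\<Sum>l\<in>X. \<Sum>m\<in>insert x X - {l}. g l m)"
    using insert.hyps by (simp add: insert_Diff_if)
  also have "(\<Sum>l\<in>X. \<Sum>m\<in>insert x X - {l}. g l m) = (\<Sum>l\<in>X. g l x + (\<Sum>m\<in>X - {l}. g l m))"
  proof (rule sum.cong[OF refl])
    fix l assume "l \<in> X"
    then have "insert x X - {l} = insert x (X - {l})" using insert.hyps by auto
    then show "(\<Sum>m\<in>insert x X - {l}. g l m) = g l x + (\<Sum>m\<in>X - {l}. g l m)"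
      using insert.hyps by simp
  qed
  also have "\<dots> = (\<Sum>l\<in>X. g l x)"
    using insert.IH[OF insert.prems] by (simp add: sum.distrib)
  also have "(\<Sum>m\<in>X. g x m) = (\<Sum>l\<in>X. - g l x)"
  proof (intro sum.cong refl)
    fix m assume "m \<in> X"
    then show "g x m = - g m x" using insert.hyps by (intro insert.prems) auto
  qed
  finally show ?case by (simp add: sum_negf)
qed simp

lemma koszul_chainD: "koszul_chain r i Z c \<Longrightarrow> A \<subseteq> {..<r} \<Longrightarrow> card A = i \<Longrightarrow> c A \<in> Z"
  and koszul_chain_outside: "koszul_chain r i Z c \<Longrightarrow> \<not> (A \<subseteq> {..<r} \<and> card A = i) \<Longrightarrow> c A = 0"
  by (auto simp: koszul_chain_def)

lemma koszul_chain_mem: "koszul_chain r i Z c \<Longrightarrow> 0 \<in> Z \<Longrightarrow> c A \<in> Z"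
  by (cases "A \<subseteq> {..<r} \<and> card A = i") (auto simp: koszul_chain_def)

lemma koszul_chain_zero: "0 \<in> Z \<Longrightarrow> koszul_chain r i Z (\<lambda>_. 0)"
  by (simp add: koszul_chain_def)

lemma koszul_chain_mono: "koszul_chain r i Z c \<Longrightarrow> Z \<subseteq> Z' \<Longrightarrow> koszul_chain r i Z' c"
  by (auto simp: koszul_chain_def)

lemma koszul_chain_minus:
  "is_add_subgroup Z \<Longrightarrow> koszul_chain r i Z c \<Longrightarrow> koszul_chain r i Z c' \<Longrightarrow>
    koszul_chain r i Z (\<lambda>A. c A - c' A)"
  by (auto simp: koszul_chain_def add_subgroup_diff)

lemma koszul_chain_map:
  "koszul_chain r i Z c \<Longrightarrow> h 0 = 0 \<Longrightarrow> h ` Z \<subseteq> Z' \<Longrightarrow> koszul_chain r i Z' (\<lambda>A. h (c A))"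
  by (auto simp: koszul_chain_def)

lemma koszul_chain_kernel:
  "koszul_chain r i Z c \<Longrightarrow> (\<And>A. h (c A) = 0) \<Longrightarrow> koszul_chain r i {x \<in> Z. h x = 0} c"
  by (simp add: koszul_chain_def)

lemma koszul_chain_choice:
  assumes "\<And>A. A \<subseteq> {..<r} \<Longrightarrow> card A = i \<Longrightarrow> \<exists>u\<in>Z. P A u"
  obtains c where "koszul_chain r i Z c" "\<And>A. A \<subseteq> {..<r} \<Longrightarrow> card A = i \<Longrightarrow> P A (c A)"
proof -
  have "\<forall>A. \<exists>u. if A \<subseteq> {..<r} \<and> card A = i then u \<in> Z \<and> P A u else u = 0"
    using assms by auto
  then obtain c where coeffs: "\<And>A. if A \<subseteq> {..<r} \<and> card A = i then c A \<in> Z \<and> P A (c A) else c A = 0"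
    by metis
  show ?thesis
    by (rule that[of c]) (use coeffs in \<open>auto simp: koszul_chain_def split: if_splits\<close>)
qed

lemma koszul_chain_lift:
  assumes chain: "koszul_chain r i (h ` Z) c" and "h 0 = 0"
  obtains u where "koszul_chain r i Z u" "\<And>A. h (u A) = c A"
proof -
  obtain u where u: "koszul_chain r i Z u" "\<And>A. A \<subseteq> {..<r} \<Longrightarrow> card A = i \<Longrightarrow> h (u A) = c A"
    using koszul_chain_choice[of r i Z "\<lambda>A u. h u = c A"] koszul_chainD[OF chain] by (metis imageE)
  have "h (u A) = c A" for A
    using u(2)[of A] koszul_chain_outside[OF u(1), of A] koszul_chain_outside[OF chain, of A] \<open>h 0 = 0\<close>
    by (cases "A \<subseteq> {..<r} \<and> card A = i") auto
  with u(1) show ?thesis by (rule that)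
qed

lemma koszul_chain_wedge:
  assumes chain: "koszul_chain r i Z c" and l: "l < r" and Z: "is_add_subgroup Z"
  shows "koszul_chain r (Suc i) Z (koszul_wedge l c)"
  unfolding koszul_chain_def
proof
  fix A
  have "A - {l} \<subseteq> {..<r} \<and> card (A - {l}) = i \<longleftrightarrow> A \<subseteq> {..<r} \<and> card A = Suc i" if "l \<in> A"
  proof -
    have "A - {l} \<subseteq> {..<r} \<longleftrightarrow> A \<subseteq> {..<r}" using l by auto
    moreover have "card A = Suc (card (A - {l}))" if "A \<subseteq> {..<r}"
      using finite_subset[OF that] \<open>l \<in> A\<close> by (metis card_Suc_Diff1 finite_lessThan)
    ultimately show ?thesis by auto
  qed
  then show "if A \<subseteq> {..<r} \<and> card A = Suc i then koszul_wedge l c A \<in> Z else koszul_wedge l c A = 0"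
    using koszul_chainD[OF chain, of "A - {l}"] koszul_chain_outside[OF chain, of "A - {l}"]
      koszul_sign_in_subgroup[OF Z] add_subgroup_zero[OF Z]
    by (cases "l \<in> A") (auto simp: koszul_wedge_def koszul_sign.zero)
qed

lemma koszul_diff_map:
  assumes h: "additive h" "\<And>l x. h (\<phi> l x) = \<psi> l (h x)"
  shows "koszul_diff r \<psi> (\<lambda>A. h (c A)) A = h (koszul_diff r \<phi> c A)"
  by (simp add: koszul_diff_def additive.sum[OF h(1)] additive_koszul_sign[OF h(1)] h(2))

definition top_chain :: "nat \<Rightarrow> 'b::zero \<Rightarrow> nat set \<Rightarrow> 'b" where
  "top_chain r x A = (if A = {..<r} then x else 0)"

lemma koszul_chain_top_chain: "x \<in> Z \<Longrightarrow> koszul_chain r r Z (top_chain r x)"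
  using card_subset_eq[of "{..<r}"] by (auto simp: koszul_chain_def top_chain_def)

lemma koszul_chain_eq_top_chain:
  assumes chain: "koszul_chain r r Z c" shows "c = top_chain r (c {..<r})"
proof
  fix A
  show "c A = top_chain r (c {..<r}) A"
    using koszul_chain_outside[OF chain, of A] card_subset_eq[of "{..<r}" A]
    by (auto simp: top_chain_def)
qed

locale commuting_operators =
  fixes \<phi> :: "nat \<Rightarrow> 'b::ab_group_add \<Rightarrow> 'b"
  assumes additive_op: "additive (\<phi> l)"
    and op_commute: "\<phi> l (\<phi> m x) = \<phi> m (\<phi> l x)"
begin

lemmas op_zero = additive.zero[OF additive_op]
  and op_sum = additive.sum[OF additive_op]
  and op_sign = additive_koszul_sign[OF additive_op]

lemma koszul_diff_zero [simp]: "koszul_diff r \<phi> (\<lambda>_. 0) A = 0"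
  by (simp add: koszul_diff_def op_zero koszul_sign.zero)

lemma koszul_diff_minus:
  "koszul_diff r \<phi> (\<lambda>A. c A - c' A) A = koszul_diff r \<phi> c A - koszul_diff r \<phi> c' A"
  by (simp add: koszul_diff_def additive.diff[OF additive_op] koszul_sign.diff sum_subtractf)

lemma koszul_diff_sum:
  "koszul_diff r \<phi> (\<lambda>A. \<Sum>x\<in>X. c x A) A = (\<Sum>x\<in>X. koszul_diff r \<phi> (c x) A)"
  unfolding koszul_diff_def op_sum koszul_sign.sum by (rule sum.swap)

lemma koszul_diff_diff: "koszul_diff r \<phi> (koszul_diff r \<phi> c) A = 0"
proof -
  let ?X = "{..<r} - A"
  have "koszul_diff r \<phi> (koszul_diff r \<phi> c) A = (\<Sum>l\<in>?X. \<Sum>m\<in>?X - {l}.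
      koszul_sign l A (koszul_sign m (insert l A) (\<phi> l (\<phi> m (c (insert m (insert l A)))))))"
    unfolding koszul_diff_def op_sum koszul_sign.sum by (intro sum.cong) (auto simp: op_sign)
  also have "\<dots> = 0"
  proof (rule sum_antisymmetric)
    fix l m assume lm: "l \<in> ?X" "m \<in> ?X" "l \<noteq> m"
    have "\<phi> l (\<phi> m (c (insert m (insert l A)))) = \<phi> m (\<phi> l (c (insert l (insert m A))))"
      by (simp add: op_commute[of l m] insert_commute)
    then show "koszul_sign l A (koszul_sign m (insert l A) (\<phi> l (\<phi> m (c (insert m (insert l A))))))
        = - koszul_sign m A (koszul_sign l (insert m A) (\<phi> m (\<phi> l (c (insert l (insert m A))))))"
      using lm by (simp add: koszul_sign_swap[of l A m])
  qed simp
  finally show ?thesis .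
qed

lemma koszul_homotopy_notin:
  assumes l: "l < r" "l \<notin> A"
  shows "koszul_diff r \<phi> (koszul_wedge l c) A = \<phi> l (c A)"
proof -
  have "koszul_diff r \<phi> (koszul_wedge l c) A = (\<Sum>m\<in>{..<r} - A. if m = l then \<phi> l (c A) else 0)"
    unfolding koszul_diff_def
  proof (intro sum.cong refl)
    fix m assume m: "m \<in> {..<r} - A"
    have "koszul_wedge l c (insert m A) = (if m = l then koszul_sign l A (c A) else 0)"
      using l(2) m by (auto simp: koszul_wedge_def koszul_sign_insert)
    then show "koszul_sign m A (\<phi> m (koszul_wedge l c (insert m A)))
        = (if m = l then \<phi> l (c A) else 0)"
      by (simp add: op_sign op_zero koszul_sign.zero)
  qed
  then show ?thesis using l by simp
qed

lemma koszul_homotopy_insert: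
  assumes l: "l < r" "l \<notin> B"
  shows "koszul_diff r \<phi> (koszul_wedge l c) (insert l B)
      + koszul_wedge l (koszul_diff r \<phi> c) (insert l B)
    = \<phi> l (c (insert l B))"
proof -
  let ?X = "{..<r} - insert l B"
    and ?t = "\<lambda>m. koszul_sign l B (koszul_sign m B (\<phi> m (c (insert m B))))"
  have X: "{..<r} - B = insert l ?X" using l by auto
  have "koszul_wedge l (koszul_diff r \<phi> c) (insert l B) = koszul_sign l B (koszul_diff r \<phi> c B)"
    using l(2) by (simp add: koszul_wedge_def koszul_sign_insert)
  also have "koszul_diff r \<phi> c B = koszul_sign l B (\<phi> l (c (insert l B)))
      + (\<Sum>m\<in>?X. koszul_sign m B (\<phi> m (c (insert m B))))"
    unfolding koszul_diff_def X by (subst sum.insert) auto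
  finally have "koszul_wedge l (koszul_diff r \<phi> c) (insert l B) = \<phi> l (c (insert l B)) + sum ?t ?X"
    by (simp add: koszul_sign.add koszul_sign.sum)
  moreover have "koszul_diff r \<phi> (koszul_wedge l c) (insert l B) = (\<Sum>m\<in>?X. - ?t m)"
    unfolding koszul_diff_def
  proof (intro sum.cong refl)
    fix m assume m: "m \<in> ?X"
    let ?x = "\<phi> m (c (insert m B))"
    have "insert m (insert l B) - {l} = insert m B" using m l by auto
    then have "koszul_sign m (insert l B) (\<phi> m (koszul_wedge l c (insert m (insert l B))))
        = koszul_sign m (insert l B) (koszul_sign l (insert l (insert m B)) ?x)"
      by (simp add: koszul_wedge_def op_sign insert_commute)
    also have "koszul_sign l (insert l (insert m B)) ?x = koszul_sign l (insert m B) ?x"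
      using l(2) m by (subst koszul_sign_insert) auto
    also have "koszul_sign m (insert l B) (koszul_sign l (insert m B) ?x) = - ?t m"
      using l(2) m
      by (auto simp: koszul_sign_insert koszul_sign.minus koszul_sign_left_commute[of l])
    finally show "koszul_sign m (insert l B) (\<phi> m (koszul_wedge l c (insert m (insert l B))))
        = - ?t m" .
  qed
  ultimately show ?thesis by (simp add: sum_negf)
qed

lemma koszul_homotopy:
  assumes "l < r"
  shows "koszul_diff r \<phi> (koszul_wedge l c) A + koszul_wedge l (koszul_diff r \<phi> c) A = \<phi> l (c A)"
proof (cases "l \<in> A")
  case True
  then have "A = insert l (A - {l})" by auto
  then show ?thesis using koszul_homotopy_insert[OF assms, of "A - {l}" c] by simp
next
  case False
  then show ?thesis
    using koszul_homotopy_notin[OF assms False, of c] by (simp add: koszul_wedge_def)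
qed

lemma koszul_diff_outside:
  assumes chain: "koszul_chain r i Z c" and A: "\<not> (A \<subseteq> {..<r} \<and> Suc (card A) = i)"
  shows "koszul_diff r \<phi> c A = 0"
  unfolding koszul_diff_def
proof (rule sum.neutral, rule)
  fix l assume l: "l \<in> {..<r} - A"
  have "\<not> (insert l A \<subseteq> {..<r} \<and> card (insert l A) = i)"
    using A l by (auto simp: finite_subset[of A "{..<r}"])
  then show "koszul_sign l A (\<phi> l (c (insert l A))) = 0"
    using koszul_chain_outside[OF chain] by (simp add: op_zero koszul_sign.zero)
qed

lemma koszul_diff_0_chain: "koszul_chain r 0 Z c \<Longrightarrow> koszul_diff r \<phi> c A = 0"
  by (simp add: koszul_diff_outside)

lemma koszul_chain_diff:
  assumes chain: "koszul_chain r (Suc i) Z c" and Z': "is_add_subgroup Z'"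
    and op: "\<And>l x. l < r \<Longrightarrow> x \<in> Z \<Longrightarrow> \<phi> l x \<in> Z'"
  shows "koszul_chain r i Z' (koszul_diff r \<phi> c)"
  unfolding koszul_chain_def
proof (intro allI, split if_split, intro conjI impI)
  fix A
  assume A: "A \<subseteq> {..<r} \<and> card A = i"
  have "c (insert l A) \<in> Z" if "l \<in> {..<r} - A" for l
    using koszul_chainD[OF chain, of "insert l A"] A that by (simp add: finite_subset[of A "{..<r}"])
  then show "koszul_diff r \<phi> c A \<in> Z'"
    unfolding koszul_diff_def
    by (intro add_subgroup_sum[OF Z'] koszul_sign_in_subgroup[OF Z'] op) auto
qed (simp add: koszul_diff_outside[OF chain])

lemma koszul_exact_zero: "koszul_exact r \<phi> i {0} {0}"
proof (rule koszul_exactI)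
  fix z :: "nat set \<Rightarrow> 'b"
  assume z: "koszul_chain r i {0} z"
  have "z A = 0" for A using koszul_chain_mem[OF z] by simp
  then show "\<exists>w. koszul_chain r (Suc i) {0} w \<and> (\<forall>A. koszul_diff r \<phi> w A = z A)"
    by (intro exI[of _ "\<lambda>_. 0"]) (simp add: koszul_chain_zero)
qed

lemma koszul_exact_0_generates:
  assumes "koszul_exact r \<phi> 0 X Y" "y \<in> Y"
  obtains w where "\<And>l. l < r \<Longrightarrow> w l \<in> X" "y = (\<Sum>l<r. \<phi> l (w l))"
proof -
  define z where "z A = (if A = {} then y else 0)" for A :: "nat set"
  have z: "koszul_chain r 0 Y z"
    using assms(2) by (auto simp: koszul_chain_def z_def dest: finite_subset)
  obtain w where w: "koszul_chain r (Suc 0) X w" "\<And>A. koszul_diff r \<phi> w A = z A"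
    using koszul_exactE[OF assms(1) z koszul_diff_0_chain[OF z]] by blast
  have "y = koszul_diff r \<phi> w {}" by (simp add: w(2) z_def)
  then have "y = (\<Sum>l<r. \<phi> l (w {l}))" by (simp add: koszul_diff_def)
  then show ?thesis using that[of "\<lambda>l. w {l}"] koszul_chainD[OF w(1)] by simp
qed

text \<open>A socle element \<open>q\<close> of \<open>M / X\<close> gives a chain of top degree with boundary in \<open>Y\<close>; if this
  boundary is the boundary of a chain in \<open>X\<close>, injectivity of one operator identifies the two chains.\<close>
lemma koszul_exact_socle:
  assumes exact: "koszul_exact (Suc s) \<phi> s X Y" and Y: "is_add_subgroup Y"
    and socle: "\<And>b. b < Suc s \<Longrightarrow> \<phi> b q \<in> Y" and b: "b < Suc s" "inj (\<phi> b)"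
  shows "q \<in> X"
proof -
  let ?r = "Suc s" and ?A = "{..<Suc s} - {b}"
  have "koszul_chain ?r s Y (koszul_diff ?r \<phi> (top_chain ?r q))"
    by (rule koszul_chain_diff[OF koszul_chain_top_chain[of q "{q}"] Y]) (use socle in auto)
  then obtain w where w: "koszul_chain ?r ?r X w"
      "\<And>A. koszul_diff ?r \<phi> w A = koszul_diff ?r \<phi> (top_chain ?r q) A"
    using koszul_exactE[OF exact _ koszul_diff_diff] by blast
  have "{..<?r} - ?A = {b}" "insert b ?A = {..<?r}" using b(1) by auto
  then have diff_top: "koszul_diff ?r \<phi> (top_chain ?r x) ?A = koszul_sign b ?A (\<phi> b x)" for x
    by (simp add: koszul_diff_def top_chain_def)
  have "koszul_sign b ?A (\<phi> b (w {..<?r})) = koszul_sign b ?A (\<phi> b q)"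
    using w(2)[of ?A] koszul_chain_eq_top_chain[OF w(1)] diff_top by metis
  then have "w {..<?r} = q" using injD[OF b(2)] koszul_sign_involution by metis
  then show ?thesis using koszul_chainD[OF w(1), of "{..<?r}"] by simp
qed

end

lemma commuting_operators_pointwise:
  assumes "commuting_operators \<phi>"
  shows "commuting_operators (\<lambda>l v (j :: 'c). \<phi> l (v j))"
proof -
  interpret commuting_operators \<phi> by fact
  show ?thesis by unfold_locales (auto simp: fun_eq_iff additive.add[OF additive_op] op_commute)
qed

text \<open>The two diagram chases in the long exact sequence of Koszul homology of
  \<open>0 \<rightarrow> ker h \<rightarrow> M \<rightarrow> h(M) \<rightarrow> 0\<close>.\<close>
locale operator_map =
  src: commuting_operators \<phi> + tgt: commuting_operators \<psi>
  for \<phi> :: "nat \<Rightarrow> 'b::ab_group_add \<Rightarrow> 'b" and \<psi> :: "nat \<Rightarrow> 'c::ab_group_add \<Rightarrow> 'c" +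
  fixes h :: "'b \<Rightarrow> 'c"
  assumes additive_map: "additive h"
    and map_op: "h (\<phi> l x) = \<psi> l (h x)"
begin

lemmas map_zero [simp] = additive.zero[OF additive_map]
  and map_diff = additive.diff[OF additive_map]
  and koszul_diff_map = koszul_diff_map[where h=h and \<phi>=\<phi> and \<psi>=\<psi>, OF additive_map map_op]

lemma koszul_exact_image:
  assumes XY: "koszul_exact r \<phi> i X Y" and Y: "is_add_subgroup Y" and W: "is_add_subgroup W"
    and op: "\<And>l x. l < r \<Longrightarrow> x \<in> Y \<Longrightarrow> \<phi> l x \<in> W"
    and ker: "\<And>j. i = Suc j \<Longrightarrow> koszul_exact r \<phi> j {x \<in> Y. h x = 0} {x \<in> W. h x = 0}"
  shows "koszul_exact r \<psi> i (h ` X) (h ` Y)"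
proof (rule koszul_exactI)
  fix z assume z: "koszul_chain r i (h ` Y) z" "\<And>A. koszul_diff r \<psi> z A = 0"
  obtain u where u: "koszul_chain r i Y u" "\<And>A. h (u A) = z A"
    using koszul_chain_lift[OF z(1)] by auto
  have du: "h (koszul_diff r \<phi> u A) = 0" for A by (simp add: u(2) z(2) flip: koszul_diff_map)
  obtain w where w: "koszul_chain r i {x \<in> Y. h x = 0} w"
      "\<And>A. koszul_diff r \<phi> w A = koszul_diff r \<phi> u A"
  proof (cases i)
    case 0
    show ?thesis
      by (rule that[of "\<lambda>_. 0"])
        (use u(1) in \<open>auto simp: 0 koszul_chain_def add_subgroup_zero[OF Y]
            src.koszul_diff_0_chain\<close>)
  next
    case (Suc j)
    have "koszul_chain r j {x \<in> W. h x = 0} (koszul_diff r \<phi> u)"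
      using src.koszul_chain_diff[OF u(1)[unfolded Suc] W op] du by (rule koszul_chain_kernel)
    from koszul_exactE[OF ker[OF Suc] this src.koszul_diff_diff] show ?thesis
      using that Suc by blast
  qed
  have "koszul_chain r i Y w" by (rule koszul_chain_mono[OF w(1)]) auto
  from koszul_exactE[OF XY koszul_chain_minus[OF Y u(1) this]] obtain v
    where v: "koszul_chain r (Suc i) X v" "\<And>A. koszul_diff r \<phi> v A = u A - w A"
    using w(2) by (auto simp: src.koszul_diff_minus)
  have "h (w A) = 0" for A using koszul_chain_mem[OF w(1)] add_subgroup_zero[OF Y] by auto
  then have "koszul_diff r \<psi> (\<lambda>A. h (v A)) A = z A" for A
    by (simp add: koszul_diff_map v(2) map_diff u(2))
  moreover have "koszul_chain r (Suc i) (h ` X) (\<lambda>A. h (v A))"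
    by (rule koszul_chain_map[OF v(1)]) auto
  ultimately show "\<exists>w. koszul_chain r (Suc i) (h ` X) w \<and> (\<forall>A. koszul_diff r \<psi> w A = z A)"
    by blast
qed

lemma koszul_exact_kernel:
  assumes XY: "koszul_exact r \<phi> i X Y" and VX: "koszul_exact r \<psi> (Suc i) (h ` V) (h ` X)"
    and X: "is_add_subgroup X" and op: "\<And>l x. l < r \<Longrightarrow> x \<in> V \<Longrightarrow> \<phi> l x \<in> X"
  shows "koszul_exact r \<phi> i {x \<in> X. h x = 0} {y \<in> Y. h y = 0}"
proof (rule koszul_exactI)
  fix z assume z: "koszul_chain r i {y \<in> Y. h y = 0} z" "\<And>A. koszul_diff r \<phi> z A = 0"
  have "koszul_chain r i Y z" by (rule koszul_chain_mono[OF z(1)]) auto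
  then obtain w where w: "koszul_chain r (Suc i) X w" "\<And>A. koszul_diff r \<phi> w A = z A"
    using koszul_exactE[OF XY _ z(2)] by blast
  have "h (z A) = 0" for A
    using koszul_chainD[OF z(1), of A] koszul_chain_outside[OF z(1), of A] by force
  then have "koszul_diff r \<psi> (\<lambda>A. h (w A)) A = 0" for A by (simp add: koszul_diff_map w(2))
  moreover have "koszul_chain r (Suc i) (h ` X) (\<lambda>A. h (w A))"
    by (rule koszul_chain_map[OF w(1)]) auto
  ultimately obtain y where y: "koszul_chain r (Suc (Suc i)) (h ` V) y"
      "\<And>A. koszul_diff r \<psi> y A = h (w A)"
    using koszul_exactE[OF VX] by blast
  obtain u where u: "koszul_chain r (Suc (Suc i)) V u" "\<And>A. h (u A) = y A"
    using koszul_chain_lift[OF y(1)] by auto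
  let ?w = "\<lambda>A. w A - koszul_diff r \<phi> u A"
  have "h (?w A) = 0" for A by (simp add: map_diff u(2) y(2) flip: koszul_diff_map)
  then have "koszul_chain r (Suc i) {x \<in> X. h x = 0} ?w"
    by (intro koszul_chain_kernel koszul_chain_minus[OF X w(1)] src.koszul_chain_diff[OF u(1) X op])
  moreover have "koszul_diff r \<phi> ?w A = z A" for A
    by (simp add: src.koszul_diff_minus src.koszul_diff_diff w(2))
  ultimately show "\<exists>w. koszul_chain r (Suc i) {x \<in> X. h x = 0} w \<and> (\<forall>A. koszul_diff r \<phi> w A = z A)"
    by blast
qed

end

definition tuples :: "nat \<Rightarrow> 'b::zero set \<Rightarrow> (nat \<Rightarrow> 'b) set" where
  "tuples b X = {v. (\<forall>j<b. v j \<in> X) \<and> (\<forall>j\<ge>b. v j = 0)}"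

lemma is_add_subgroup_tuples: "is_add_subgroup X \<Longrightarrow> is_add_subgroup (tuples b X)"
  by (simp add: is_add_subgroup_def tuples_def)

lemma koszul_chain_component:
  assumes "koszul_chain r i (tuples b X) c" "j < b"
  shows "koszul_chain r i X (\<lambda>A. c A j)"
  using koszul_chainD[OF assms(1)] koszul_chain_outside[OF assms(1)] assms(2)
  by (auto simp: koszul_chain_def tuples_def)

lemma koszul_diff_component:
  fixes \<phi> :: "nat \<Rightarrow> 'b \<Rightarrow> 'b::ab_group_add"
  shows "koszul_diff r (\<lambda>l v j. \<phi> l (v j)) c A j = koszul_diff r \<phi> (\<lambda>A. c A j) A"
proof -
  have "additive (\<lambda>v :: _ \<Rightarrow> 'b. v j)" by unfold_locales simp
  from koszul_diff_map[OF this, of "\<lambda>l v j. \<phi> l (v j)" \<phi>] show ?thesis by simp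
qed

lemma koszul_exact_tuples:
  assumes exact: "koszul_exact r \<phi> i X Y" and \<phi>: "commuting_operators \<phi>"
  shows "koszul_exact r (\<lambda>l v j. \<phi> l (v j)) i (tuples b X) (tuples b Y)"
proof (rule koszul_exactI)
  interpret commuting_operators \<phi> by fact
  let ?d = "koszul_diff r (\<lambda>l v j. \<phi> l (v j))"
  fix z :: "nat set \<Rightarrow> nat \<Rightarrow> 'a"
  assume z: "koszul_chain r i (tuples b Y) z" "\<And>A. ?d z A = 0"
  have "\<exists>w. koszul_chain r (Suc i) X w \<and> (\<forall>A. koszul_diff r \<phi> w A = z A j)" if "j < b" for j
    using koszul_exactE[OF exact koszul_chain_component[OF z(1) that]] z(2)
    by (metis koszul_diff_component zero_fun_apply)
  then obtain w where w: "\<And>j. j < b \<Longrightarrow> koszul_chain r (Suc i) X (w j)"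
      "\<And>j A. j < b \<Longrightarrow> koszul_diff r \<phi> (w j) A = z A j" by metis
  define w' where "w' A j = (if j < b then w j A else 0)" for A j
  have "koszul_chain r (Suc i) (tuples b X) w'"
    using koszul_chainD[OF w(1)] koszul_chain_outside[OF w(1)]
    by (auto simp: koszul_chain_def tuples_def w'_def fun_eq_iff)
  moreover have "?d w' A = z A" for A
  proof
    fix j
    have "z A j = 0" if "j \<ge> b"
      using that koszul_chainD[OF z(1), of A] koszul_chain_outside[OF z(1), of A]
      by (cases "A \<subseteq> {..<r} \<and> card A = i") (auto simp: tuples_def)
    then show "?d w' A j = z A j"
      unfolding koszul_diff_component using w(2)[of j A] by (cases "j < b") (auto simp: w'_def)
  qed
  ultimately show "\<exists>w. koszul_chain r (Suc i) (tuples b X) w \<and> (\<forall>A. ?d w A = z A)" by blast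
qed

section \<open>Exactness of the Koszul complex of forms in high degrees\<close>

abbreviation (input) mult_ops :: "(nat \<Rightarrow> 'a::comm_ring_1) \<Rightarrow> nat \<Rightarrow> 'a \<Rightarrow> 'a" where
  "mult_ops f \<equiv> \<lambda>l. (*) (f l)"

interpretation mult_ops: commuting_operators "mult_ops f"
  by unfold_locales (auto simp: distrib_left mult.left_commute)

lemma koszul_diff_mult_scale:
  "koszul_diff r (mult_ops f) (\<lambda>A. x * c A) A = x * koszul_diff r (mult_ops f) c A"
  by (rule koszul_diff_map) (auto simp: additive_def distrib_left mult.left_commute)

lemma koszul_diff_mult_combination:
  "koszul_diff r (mult_ops f) (\<lambda>A. \<Sum>l<r. g l * koszul_wedge l z A) A
    = (\<Sum>l<r. g l * f l) * z A - (\<Sum>l<r. g l * koszul_wedge l (koszul_diff r (mult_ops f) z) A)"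
proof -
  let ?d = "koszul_diff r (mult_ops f)"
  have "?d (\<lambda>A. \<Sum>l<r. g l * koszul_wedge l z A) A = (\<Sum>l<r. g l * ?d (koszul_wedge l z) A)"
    by (simp add: mult_ops.koszul_diff_sum koszul_diff_mult_scale)
  also have "\<dots> = (\<Sum>l<r. g l * (f l * z A - koszul_wedge l (?d z) A))"
    by (intro sum.cong refl arg_cong2[where f="(*)"])
      (simp add: eq_diff_eq mult_ops.koszul_homotopy)
  finally show ?thesis by (simp add: right_diff_distrib sum_subtractf sum_distrib_right mult.assoc)
qed

definition power_ideal :: "nat \<Rightarrow> nat \<Rightarrow> 'a::comm_ring_1 mpoly set" where
  "power_ideal N j = {p. \<forall>m\<in>keys p. \<exists>i<j. lookup m i \<ge> N}"

lemma power_ideal_0: "power_ideal N 0 = {0}"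
  by (auto simp: power_ideal_def)

lemma is_submodule_power_ideal: "is_submodule UNIV (power_ideal N j)"
proof (rule is_submoduleI)
  show "is_subring (UNIV :: 'a mpoly set)" by (simp add: is_subring_def is_add_subgroup_def)
  show "p + q \<in> power_ideal N j"
      if "p \<in> power_ideal N j" "q \<in> power_ideal N j" for p q :: "'a mpoly"
    using that keys_add[of p q] unfolding power_ideal_def by blast
  show "c * p \<in> power_ideal N j" if p: "p \<in> power_ideal N j" for c p :: "'a mpoly"
    unfolding power_ideal_def
  proof safe
    fix m assume "m \<in> keys (c * p)"
    then obtain m1 m2 where m: "m = m1 + m2" "m2 \<in> keys p" using keys_mult[of c p] by blast
    with p obtain i where "i < j" "lookup m2 i \<ge> N" by (auto simp: power_ideal_def)
    then show "\<exists>i<j. lookup m i \<ge> N" unfolding m by (intro exI[of _ i]) (simp add: lookup_add)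
  qed
qed (simp add: power_ideal_def)

lemmas power_ideal_add = submodule_add[OF is_submodule_power_ideal]
  and power_ideal_diff = submodule_diff[OF is_submodule_power_ideal]
  and power_ideal_sum = submodule_sum[OF is_submodule_power_ideal]
  and power_ideal_mult = submodule_mult[OF is_submodule_power_ideal UNIV_I]

lemma power_ideal_mono: "j \<le> j' \<Longrightarrow> power_ideal N j \<subseteq> power_ideal N j'"
  unfolding power_ideal_def using less_le_trans by blast

lemma Var_power_mult_in_power_ideal: "Var j ^ N * p \<in> power_ideal N (Suc j)"
proof -
  have "Var j ^ N \<in> power_ideal N (Suc j)"
    by (auto simp: power_ideal_def Var_power split: if_splits)
  then show ?thesis by (subst mult.commute) (rule power_ideal_mult)
qed

lemma power_ideal_cancel_Var_power:
  assumes "Var j ^ N * p \<in> power_ideal N j" shows "p \<in> power_ideal N j"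
  unfolding power_ideal_def
proof safe
  fix m assume m: "m \<in> keys p"
  have "single j N + m \<in> keys (Var j ^ N * p)"
    using m by (simp add: Var_power in_keys_iff lookup_single_mult)
  with assms obtain i where "i < j" "lookup (single j N + m) i \<ge> N" by (auto simp: power_ideal_def)
  then show "\<exists>i<j. lookup m i \<ge> N" by (intro exI[of _ i]) (simp add: lookup_add lookup_single)
qed

lemma power_ideal_Suc_decompose:
  assumes p: "p \<in> power_ideal N (Suc j)" "p \<in> forms n (a + N)"
  obtains v where "v \<in> forms n a" "p - Var j ^ N * v \<in> power_ideal N j"
proof
  let ?X = "{m \<in> keys p. lookup m j \<ge> N}"
  define v where "v = (\<Sum>m\<in>?X. single (m - single j N) (lookup p m))"
  show "v \<in> forms n a"
    unfolding v_def
  proof (rule forms_sum)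
    fix m assume m: "m \<in> ?X"
    have "tdeg m = a + N" using m p by (auto simp: forms_def homog_def)
    then have "tdeg (m - single j N) = a"
      using tdeg_add[of "single j N" "m - single j N"] single_add_diff[of N m j] m by auto
    moreover have "keys (m - single j N) \<subseteq> keys m" by (auto simp: in_keys_iff lookup_minus)
    ultimately show "single (m - single j N) (lookup p m) \<in> forms n a"
      using m p by (auto simp: forms_def in_ring_def homog_def)
  qed
  have "Var j ^ N * v = (\<Sum>m\<in>?X. single m (lookup p m))"
    unfolding v_def Var_power sum_distrib_left mult_single
    by (intro sum.cong) (auto simp: single_add_diff)
  then have "p - Var j ^ N * v
      = (\<Sum>m\<in>keys p. single m (lookup p m)) - (\<Sum>m\<in>?X. single m (lookup p m))"
    by (simp add: sum_single_lookup)
  also have "\<dots> = (\<Sum>m\<in>keys p - ?X. single m (lookup p m))"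
    by (subst sum_diff) auto
  also have "\<dots> \<in> power_ideal N j"
  proof (rule power_ideal_sum)
    fix m assume "m \<in> keys p - ?X"
    with p(1) obtain i where "i < Suc j" "lookup m i \<ge> N" "\<not> lookup m j \<ge> N"
      by (auto simp: power_ideal_def)
    then show "single m (lookup p m) \<in> power_ideal N j"
      by (auto simp: power_ideal_def less_Suc_eq intro!: exI[of _ i])
  qed
  finally show "p - Var j ^ N * v \<in> power_ideal N j" .
qed

lemma forms_subset_power_ideal:
  assumes e: "e > n * (N - 1)" shows "forms n e \<subseteq> power_ideal N n"
proof
  fix p :: "'a mpoly" assume p: "p \<in> forms n e"
  have "\<exists>i<n. lookup m i \<ge> N" if m: "m \<in> keys p" for m
  proof (rule ccontr)
    assume "\<not> ?thesis"
    then have small: "lookup m i \<le> N - 1" if "i < n" for i using that by fastforce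
    have "tdeg m = (\<Sum>i<n. lookup m i)"
      by (rule tdeg_superset) (use p m in \<open>auto simp: forms_def in_ring_def\<close>)
    also have "\<dots> \<le> (\<Sum>i<n. N - 1)" by (rule sum_mono) (use small in auto)
    finally show False using p m e by (auto simp: forms_def homog_def)
  qed
  then show "p \<in> power_ideal N n" by (simp add: power_ideal_def)
qed

definition koszul_exact_mod :: "'b set \<Rightarrow> nat \<Rightarrow>
    (nat \<Rightarrow> 'b \<Rightarrow> 'b) \<Rightarrow> nat \<Rightarrow> 'b set \<Rightarrow> 'b::ab_group_add set \<Rightarrow> bool"
  where "koszul_exact_mod U r \<phi> i X Y \<longleftrightarrow>
    (\<forall>z. koszul_chain r i Y z \<longrightarrow> (\<forall>A. koszul_diff r \<phi> z A \<in> U) \<longrightarrow>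
      (\<exists>w. koszul_chain r (Suc i) X w \<and> (\<forall>A. koszul_diff r \<phi> w A - z A \<in> U)))"

lemma koszul_exact_mod_zero: "koszul_exact_mod {0} r \<phi> i X Y \<longleftrightarrow> koszul_exact r \<phi> i X Y"
  by (simp add: koszul_exact_mod_def koszul_exact_def)

locale variable_powers =
  fixes n r d N :: nat and f :: "nat \<Rightarrow> 'a::comm_ring_1 mpoly" and g :: "nat \<Rightarrow> nat \<Rightarrow> 'a mpoly"
  assumes f_forms: "l < r \<Longrightarrow> f l \<in> forms n d"
    and g_forms: "j < n \<Longrightarrow> l < r \<Longrightarrow> g j l \<in> forms n (N - d)"
    and Var_power_eq: "j < n \<Longrightarrow> Var j ^ N = (\<Sum>l<r. g j l * f l)"
    and d_le_N: "d \<le> N"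
begin

abbreviation boundary :: "(nat set \<Rightarrow> 'a mpoly) \<Rightarrow> nat set \<Rightarrow> 'a mpoly" where
  "boundary \<equiv> koszul_diff r (mult_ops f)"

lemma koszul_diff_f_forms:
  assumes "koszul_chain r i (forms n a) c"
  shows "boundary c A \<in> forms n (a + d)"
proof (cases i)
  case 0
  then show ?thesis using mult_ops.koszul_diff_0_chain[OF assms[unfolded 0]] by simp
next
  case (Suc j)
  have "koszul_chain r j (forms n (a + d)) (boundary c)"
    using assms f_forms unfolding Suc
    by (intro mult_ops.koszul_chain_diff[OF _ is_add_subgroup_forms])
      (auto simp: add.commute[of a] intro: forms_mult)
  then show ?thesis by (rule koszul_chain_mem) simp
qed

lemma koszul_diff_f_power_ideal:
  "(\<And>B. c B \<in> power_ideal N j) \<Longrightarrow> boundary c A \<in> power_ideal N j"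
  unfolding koszul_diff_def
  by (intro power_ideal_sum koszul_sign_in_subgroup
      submodule_add_subgroup[OF is_submodule_power_ideal]
      power_ideal_mult)

lemma Var_power_annihilates_cycle:
  assumes j: "j < n"
    and z: "koszul_chain r q (forms n (a + d)) z" "\<And>A. boundary z A \<in> power_ideal N j"
  obtains w where "koszul_chain r (Suc q) (forms n (a + N)) w"
    "\<And>A. boundary w A - Var j ^ N * z A \<in> power_ideal N j"
proof
  define w where "w A = (\<Sum>l<r. g j l * koszul_wedge l z A)" for A
  have "koszul_chain r (Suc q) (forms n (a + d)) (koszul_wedge l z)" if "l < r" for l
    by (rule koszul_chain_wedge[OF z(1) that is_add_subgroup_forms])
  note wedge = koszul_chainD[OF this] koszul_chain_outside[OF this]
  have "w A \<in> forms n ((N - d) + (a + d))" if "A \<subseteq> {..<r}" "card A = Suc q" for A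
    unfolding w_def using wedge(1)[OF _ that] g_forms[OF j] by (auto intro!: forms_sum forms_mult)
  moreover have "(N - d) + (a + d) = a + N" using d_le_N by simp
  ultimately show "koszul_chain r (Suc q) (forms n (a + N)) w"
    using wedge(2) by (auto simp: koszul_chain_def w_def intro!: sum.neutral)
  fix A
  have "boundary w A - Var j ^ N * z A = 0 - (\<Sum>l<r. g j l * koszul_wedge l (boundary z) A)"
    unfolding w_def koszul_diff_mult_combination Var_power_eq[OF j] by simp
  moreover have "koszul_wedge l (boundary z) A \<in> power_ideal N j" for l
    unfolding koszul_wedge_def
    by (auto intro!: koszul_sign_in_subgroup submodule_add_subgroup[OF is_submodule_power_ideal]
        z(2)
        submodule_zero[OF is_submodule_power_ideal])
  ultimately show "boundary w A - Var j ^ N * z A \<in> power_ideal N j"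
    by (auto intro!: power_ideal_diff power_ideal_sum power_ideal_mult
        simp: submodule_zero[OF is_submodule_power_ideal] simp del: diff_0)
qed

lemma koszul_exact_mod_power_ideal_step:
  assumes j: "j < n"
    and IH: "koszul_exact_mod (power_ideal N (Suc j)) r (mult_ops f) (Suc q) (forms n (a + N - d))
        (forms n (a + N))"
  shows "koszul_exact_mod (power_ideal N j) r (mult_ops f) q (forms n a) (forms n (a + d))"
  unfolding koszul_exact_mod_def
proof (intro allI impI)
  fix z assume z: "koszul_chain r q (forms n (a + d)) z" "\<forall>A. boundary z A \<in> power_ideal N j"
  then obtain w where w: "koszul_chain r (Suc q) (forms n (a + N)) w"
      "\<And>A. boundary w A - Var j ^ N * z A \<in> power_ideal N j"
    using Var_power_annihilates_cycle[OF j z(1)] by blast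
  have "boundary w A \<in> power_ideal N (Suc j)" for A
    using power_ideal_add[OF subsetD[OF power_ideal_mono w(2)[of A], of "Suc j"]
        Var_power_mult_in_power_ideal[of j N "z A"]] by simp
  then obtain u where u: "koszul_chain r (Suc (Suc q)) (forms n (a + N - d)) u"
      "\<And>A. boundary u A - w A \<in> power_ideal N (Suc j)"
    using IH w(1) unfolding koszul_exact_mod_def by blast
  have wu: "w A - boundary u A \<in> power_ideal N (Suc j)" for A
    using add_subgroup_uminus[OF submodule_add_subgroup[OF is_submodule_power_ideal] u(2)[of A]]
    by simp
  have form: "w A - boundary u A \<in> forms n (a + N)" for A
    using koszul_chain_mem[OF w(1)] koszul_diff_f_forms[OF u(1)] d_le_N by (simp add: forms_diff)
  then have "\<exists>v\<in>forms n a. w A - boundary u A - Var j ^ N * v \<in> power_ideal N j" for A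
    using power_ideal_Suc_decompose[OF wu form] by metis
  then obtain v where v: "koszul_chain r (Suc q) (forms n a) v"
      "\<And>A. A \<subseteq> {..<r} \<Longrightarrow> card A = Suc q \<Longrightarrow> w A - boundary u A - Var j ^ N * v A \<in> power_ideal N j"
    using koszul_chain_choice[of r "Suc q" "forms n a"
        "\<lambda>A v. w A - boundary u A - Var j ^ N * v \<in> power_ideal N j"] by blast
  have "w A - boundary u A - Var j ^ N * v A \<in> power_ideal N j" for A
    using v(2)[of A] koszul_chain_outside[OF w(1), of A] koszul_chain_outside[OF v(1), of A]
      mult_ops.koszul_diff_outside[OF u(1), of A f] submodule_zero[OF is_submodule_power_ideal]
    by (cases "A \<subseteq> {..<r} \<and> card A = Suc q") auto
  then have "boundary (\<lambda>A. w A - boundary u A - Var j ^ N * v A) A \<in> power_ideal N j" for A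
    by (rule koszul_diff_f_power_ideal)
  then have wv: "boundary w A - Var j ^ N * boundary v A \<in> power_ideal N j" for A
    by (simp add: mult_ops.koszul_diff_minus mult_ops.koszul_diff_diff koszul_diff_mult_scale)
  have "Var j ^ N * (boundary v A - z A) \<in> power_ideal N j" for A
    using power_ideal_diff[OF w(2)[of A] wv[of A]] by (simp add: right_diff_distrib)
  then have "boundary v A - z A \<in> power_ideal N j" for A by (rule power_ideal_cancel_Var_power)
  with v(1) show "\<exists>w. koszul_chain r (Suc q) (forms n a) w \<and>
      (\<forall>A. boundary w A - z A \<in> power_ideal N j)"
    by blast
qed

text \<open>Descending induction on \<open>j\<close>: since \<open>X\<^sub>j\<^sup>N\<close> lies in the ideal of the \<open>f l\<close>, it annihilates the
  Koszul homology, so a cycle lifts to one of higher homological degree modulo one more power. Once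
  the powers of all variables are included, the forms of the relevant degree vanish.\<close>
lemma koszul_exact_mod_power_ideal:
  assumes "j \<le> n" "a + d + (n - j) * N > n * (N - 1) + (n - j) * d"
  shows "koszul_exact_mod (power_ideal N j) r (mult_ops f) q (forms n a) (forms n (a + d))"
  using assms
proof (induction j arbitrary: q a rule: inc_induct)
  case base
  have "0 - z A \<in> power_ideal N n" if "koszul_chain r q (forms n (a + d)) z" for z A
    using koszul_chain_mem[OF that] forms_subset_power_ideal[of n N "a + d"] base
    by (intro power_ideal_diff submodule_zero[OF is_submodule_power_ideal]) auto
  then show ?case
    unfolding koszul_exact_mod_def
    by (intro allI impI exI[of _ "\<lambda>_. 0"] conjI) (simp_all add: koszul_chain_zero)
next
  case (step j)
  have "(n - j) * N = (n - Suc j) * N + N" "(n - j) * d = (n - Suc j) * d + d"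
    using step.hyps(2) by (metis Suc_diff_Suc add.commute mult_Suc)+
  then have "a + N - d + d + (n - Suc j) * N > n * (N - 1) + (n - Suc j) * d"
    using step.prems d_le_N by linarith
  from step.IH[OF this, of "Suc q"] show ?case
    using step.hyps(2) d_le_N by (intro koszul_exact_mod_power_ideal_step) auto
qed

lemma koszul_exact_forms:
  assumes "N \<ge> 1" "n * d < a + d + n"
  shows "koszul_exact r (mult_ops f) q (forms n a) (forms n (a + d))"
proof -
  have "n * N = n * (N - 1) + n" using assms(1) by (cases N) auto
  then show ?thesis
    using koszul_exact_mod_power_ideal[of 0 a q] assms(2)
    by (simp add: power_ideal_0 koszul_exact_mod_zero)
qed

end

lemma koszul_exact_Var: "koszul_exact r (mult_ops Var) q (forms r a) (forms r (Suc a))"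
proof -
  have "variable_powers r r 1 1 Var (\<lambda>j l. if l = j then 1 else 0 :: 'a mpoly)"
    by unfold_locales (auto simp: forms_def if_distrib[of "\<lambda>x. x * _"] cong: if_cong)
  from variable_powers.koszul_exact_forms[OF this, of a q] show ?thesis by simp
qed

lemma forms_Suc_generated:
  assumes "p \<in> forms r (Suc e)"
  obtains w where "\<And>l. l < r \<Longrightarrow> w l \<in> forms r e" "p = (\<Sum>l<r. Var l * w l)"
  using mult_ops.koszul_exact_0_generates[OF koszul_exact_Var assms] by blast

section \<open>Generated ideals and radicals\<close>

lemma is_submodule_gen_ideal: "is_submodule (poly_ring m) (gen_ideal m G)"
proof (rule is_submoduleI[OF is_subring_poly_ring])
  show "0 \<in> gen_ideal m G" by (auto simp: gen_ideal_def intro!: exI[of _ "{}"])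
next
  fix a b assume "a \<in> gen_ideal m G" "b \<in> gen_ideal m G"
  then obtain F c F' c' where
    F: "finite F" "F \<subseteq> G" "\<forall>g\<in>F. in_ring m (c g)" "a = (\<Sum>g\<in>F. c g * g)" and
    F': "finite F'" "F' \<subseteq> G" "\<forall>g\<in>F'. in_ring m (c' g)" "b = (\<Sum>g\<in>F'. c' g * g)"
    unfolding gen_ideal_def by blast
  let ?c = "\<lambda>g. (if g \<in> F then c g else 0) + (if g \<in> F' then c' g else 0)"
  have "(\<Sum>g\<in>F \<union> F'. ?c g * g) = (\<Sum>g\<in>F \<union> F'. (if g \<in> F then c g else 0) * g)
      + (\<Sum>g\<in>F \<union> F'. (if g \<in> F' then c' g else 0) * g)" by (simp add: distrib_right sum.distrib)
  also have "(\<Sum>g\<in>F \<union> F'. (if g \<in> F then c g else 0) * g) = a"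
    unfolding F(4) by (rule sum.mono_neutral_cong_right) (use F F' in auto)
  also have "(\<Sum>g\<in>F \<union> F'. (if g \<in> F' then c' g else 0) * g) = b"
    unfolding F'(4) by (rule sum.mono_neutral_cong_right) (use F F' in auto)
  finally have "a + b = (\<Sum>g\<in>F \<union> F'. ?c g * g)" by simp
  moreover have "\<forall>g\<in>F \<union> F'. in_ring m (?c g)" using F F' by auto
  ultimately show "a + b \<in> gen_ideal m G"
    unfolding gen_ideal_def using F F' by (intro CollectI exI[of _ "F \<union> F'"] exI[of _ ?c]) simp
next
  fix p a :: "'a mpoly" assume "p \<in> poly_ring m" and "a \<in> gen_ideal m G"
  then obtain F c where "finite F" "F \<subseteq> G" "\<forall>g\<in>F. in_ring m (c g)" "a = (\<Sum>g\<in>F. c g * g)"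
      "in_ring m p"
    unfolding gen_ideal_def by blast
  then show "p * a \<in> gen_ideal m G"
    unfolding gen_ideal_def
    by (intro CollectI exI[of _ F] exI[of _ "\<lambda>g. p * c g"]) (auto simp: sum_distrib_left mult.assoc)
qed

lemma gen_ideal_base: "g \<in> G \<Longrightarrow> g \<in> gen_ideal m G"
  unfolding gen_ideal_def by (intro CollectI exI[of _ "{g}"] exI[of _ "\<lambda>_. 1"]) simp

lemma gen_ideal_least: "is_submodule (poly_ring m) U \<Longrightarrow> G \<subseteq> U \<Longrightarrow> gen_ideal m G \<subseteq> U"
  unfolding gen_ideal_def by (auto intro!: submodule_sum submodule_mult)

lemma gen_ideal_mono: "G \<subseteq> H \<Longrightarrow> gen_ideal m G \<subseteq> gen_ideal m H"
  by (intro gen_ideal_least is_submodule_gen_ideal) (auto intro: gen_ideal_base)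

lemma ideal_prod_gen_ideal:
  "ideal_prod m (gen_ideal m G) (gen_ideal m H) = gen_ideal m {g * h | g h. g \<in> G \<and> h \<in> H}"
  (is "_ = gen_ideal m ?GH")
proof
  note gen = is_submodule_gen_ideal[of m ?GH]
  have base: "x * h \<in> gen_ideal m ?GH" if "x \<in> gen_ideal m G" "h \<in> H" for x h
  proof -
    have "is_submodule (poly_ring m) {x. x * h \<in> gen_ideal m ?GH}"
      using submodule_zero[OF gen] submodule_add[OF gen] submodule_mult[OF gen]
      by (intro is_submoduleI is_subring_poly_ring) (auto simp: distrib_right mult.assoc)
    then have "gen_ideal m G \<subseteq> {x. x * h \<in> gen_ideal m ?GH}"
      by (rule gen_ideal_least) (use that in \<open>auto intro: gen_ideal_base\<close>)
    then show ?thesis using that by blast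
  qed
  have "x * y \<in> gen_ideal m ?GH" if "x \<in> gen_ideal m G" "y \<in> gen_ideal m H" for x y
  proof -
    have "is_submodule (poly_ring m) {y. x * y \<in> gen_ideal m ?GH}"
      using submodule_zero[OF gen] submodule_add[OF gen] submodule_mult[OF gen]
      by (intro is_submoduleI is_subring_poly_ring) (auto simp: distrib_left mult.left_commute)
    then have "gen_ideal m H \<subseteq> {y. x * y \<in> gen_ideal m ?GH}"
      by (rule gen_ideal_least) (use that base in auto)
    then show ?thesis using that by blast
  qed
  then show "ideal_prod m (gen_ideal m G) (gen_ideal m H) \<subseteq> gen_ideal m ?GH"
    unfolding ideal_prod_def by (intro gen_ideal_least gen) auto
  show "gen_ideal m ?GH \<subseteq> ideal_prod m (gen_ideal m G) (gen_ideal m H)"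
    unfolding ideal_prod_def
    by (intro gen_ideal_least is_submodule_gen_ideal) (auto intro!: gen_ideal_base)
qed

lemma is_submodule_radical:
  assumes U: "is_submodule (poly_ring m) U" shows "is_submodule (poly_ring m) (radical m U)"
proof (rule is_submoduleI[OF is_subring_poly_ring])
  show "0 \<in> radical m U" using submodule_zero[OF U] by (auto simp: radical_def intro: exI[of _ 1])
next
  fix p q assume "p \<in> radical m U" "q \<in> radical m U"
  then show "p + q \<in> radical m U"
    using submodule_power_add[OF U] by (fastforce simp: radical_def)
next
  fix c p :: "'a mpoly" assume c: "c \<in> poly_ring m" and "p \<in> radical m U"
  then obtain s where p: "in_ring m p" "p ^ s \<in> U" by (auto simp: radical_def)
  then have "(c * p) ^ s \<in> U" unfolding power_mult_distrib
    using c by (intro submodule_mult[OF U]) auto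
  then show "c * p \<in> radical m U" using p c by (auto simp: radical_def)
qed

lemma radical_powerD: "p ^ k \<in> radical m U \<Longrightarrow> in_ring m p \<Longrightarrow> p \<in> radical m U"
  unfolding radical_def by (auto simp flip: power_mult)

definition koszul_vanishing :: "nat \<Rightarrow> nat \<Rightarrow> 'a::comm_ring_1 mpoly set \<Rightarrow> bool" where
  "koszul_vanishing r D J \<longleftrightarrow>
    (\<forall>i. \<forall>e\<ge>D. koszul_exact r (mult_ops Var) i (J \<inter> forms r e) (J \<inter> forms r (Suc e)))"

definition homogeneous_ideal :: "nat \<Rightarrow> 'a::comm_ring_1 mpoly set \<Rightarrow> bool" where
  "homogeneous_ideal r J \<longleftrightarrow>
    is_submodule (poly_ring r) J \<and> J \<subseteq> poly_ring r \<and> (\<forall>p\<in>J. \<forall>e. hom_comp e p \<in> J)"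

section \<open>Graded submodules of free modules\<close>

lemma vecs_eq_tuples: "vecs r b = tuples b (poly_ring r)"
  by (auto simp: vecs_def tuples_def)

lemma is_add_subgroup_vecs: "is_add_subgroup (vecs r b)"
  unfolding vecs_eq_tuples by (rule is_add_subgroup_tuples[OF is_add_subgroup_poly_ring])

lemma vecs_scale: "in_ring r p \<Longrightarrow> v \<in> vecs r b \<Longrightarrow> (\<lambda>j. p * v j) \<in> vecs r b"
  by (simp add: vecs_def)

lemma gen_ideal_image_lessThan:
  "gen_ideal m (g ` {..<b::nat}) = (\<lambda>v. \<Sum>j<b. v j * g j) ` vecs m b" (is "_ = ?h ` _")
proof
  have h: "additive ?h" by unfold_locales (simp add: distrib_right sum.distrib)
  have "is_submodule (poly_ring m) (?h ` vecs m b)"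
  proof (rule is_submoduleI[OF is_subring_poly_ring])
    note image = add_subgroup_image[OF is_add_subgroup_vecs h]
    show "0 \<in> ?h ` vecs m b" by (rule add_subgroup_zero[OF image])
    show "x + y \<in> ?h ` vecs m b" if "x \<in> ?h ` vecs m b" "y \<in> ?h ` vecs m b" for x y
      using that by (rule add_subgroup_add[OF image])
    fix c x :: "'a mpoly" assume c: "c \<in> poly_ring m" and "x \<in> ?h ` vecs m b"
    then obtain v where "v \<in> vecs m b" "x = ?h v" by blast
    then show "c * x \<in> ?h ` vecs m b"
      using c by (intro image_eqI[of _ _ "\<lambda>j. c * v j"])
      (auto simp: sum_distrib_left mult.assoc vecs_scale)
  qed
  moreover have "g ` {..<b} \<subseteq> ?h ` vecs m b"
  proof (rule image_subsetI)
    fix j assume "j \<in> {..<b}"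
    then show "g j \<in> ?h ` vecs m b"
      by (intro image_eqI[of _ _ "\<lambda>i. if i = j then 1 else 0"])
        (auto simp: vecs_def if_distrib[of "\<lambda>x. x * _"] cong: if_cong)
  qed
  ultimately show "gen_ideal m (g ` {..<b}) \<subseteq> ?h ` vecs m b" by (rule gen_ideal_least)
  show "?h ` vecs m b \<subseteq> gen_ideal m (g ` {..<b})"
    by (auto simp: vecs_def intro!: submodule_sum[OF is_submodule_gen_ideal]
        submodule_mult[OF is_submodule_gen_ideal] intro: gen_ideal_base)
qed

definition graded_submodule :: "nat \<Rightarrow> nat \<Rightarrow> (nat \<Rightarrow> 'a::comm_ring_1 mpoly) set \<Rightarrow> bool" where
  "graded_submodule r b Z \<longleftrightarrow> Z \<subseteq> vecs r b \<and> is_add_subgroup Z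
     \<and> (\<forall>p v. in_ring r p \<longrightarrow> v \<in> Z \<longrightarrow> (\<lambda>j. p * v j) \<in> Z) \<and> (\<forall>e. \<forall>v\<in>Z. (\<lambda>j. hom_comp e (v j)) \<in> Z)"

definition graded_part :: "(nat \<Rightarrow> 'a::comm_ring_1 mpoly) set \<Rightarrow> nat \<Rightarrow> (nat \<Rightarrow> 'a mpoly) set" where
  "graded_part Z e = {v \<in> Z. \<forall>j. homog e (v j)}"

lemma graded_submoduleD:
  assumes "graded_submodule r b Z"
  shows "Z \<subseteq> vecs r b" "is_add_subgroup Z" "\<And>p v. in_ring r p \<Longrightarrow> v \<in> Z \<Longrightarrow> (\<lambda>j. p * v j) \<in> Z"
    "\<And>v e. v \<in> Z \<Longrightarrow> (\<lambda>j. hom_comp e (v j)) \<in> Z"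
  using assms by (auto simp: graded_submodule_def)

lemma graded_part_Collect: "graded_part {v \<in> Z. P v} e = {v \<in> graded_part Z e. P v}"
  by (auto simp: graded_part_def)

lemma graded_part_vecs: "graded_part (vecs r b) e = tuples b (forms r e)"
  by (auto simp: graded_part_def vecs_def tuples_def forms_def) (metis homog_0 le_less_linear)

lemma tuples_forms_subset_vecs: "tuples b (forms r e) \<subseteq> vecs r b"
  by (auto simp: tuples_def vecs_def forms_def)

lemma is_add_subgroup_tuples_forms: "is_add_subgroup (tuples b (forms r e))"
  by (rule is_add_subgroup_tuples[OF is_add_subgroup_forms])

lemma hom_comp_in_graded_part:
  "graded_submodule r b Z \<Longrightarrow> v \<in> Z \<Longrightarrow> (\<lambda>j. hom_comp e (v j)) \<in> graded_part Z e"
  by (simp add: graded_part_def graded_submoduleD)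

lemma sum_fun_apply: "sum g X j = (\<Sum>x\<in>X. g x j)" for g :: "'b \<Rightarrow> 'c \<Rightarrow> 'a::ab_group_add"
proof -
  have "additive (\<lambda>v :: 'c \<Rightarrow> 'a. v j)" by unfold_locales simp
  then show ?thesis by (rule additive.sum)
qed

lemma graded_submodule_subset:
  assumes Z: "graded_submodule r b Z" and parts: "\<And>e. graded_part Z e \<subseteq> V"
    and V: "is_add_subgroup V"
  shows "Z \<subseteq> V"
proof
  fix v assume v: "v \<in> Z"
  let ?E = "\<Union>j<b. tdeg ` keys (v j)"
  have "v = (\<Sum>e\<in>?E. (\<lambda>j. hom_comp e (v j)))"
  proof
    fix j
    have "v j = 0 \<or> j < b" using graded_submoduleD(1)[OF Z] v by (auto simp: vecs_def)
    then show "v j = (\<Sum>e\<in>?E. (\<lambda>j. hom_comp e (v j))) j"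
      unfolding sum_fun_apply by (subst sum_hom_comp) (auto simp: hom_comp.zero)
  qed
  also have "\<dots> \<in> V"
    using parts hom_comp_in_graded_part[OF Z v] by (intro add_subgroup_sum[OF V]) blast
  finally show "v \<in> V" .
qed

abbreviation (input) var_ops :: "nat \<Rightarrow> (nat \<Rightarrow> 'a::comm_ring_1 mpoly) \<Rightarrow> nat \<Rightarrow> 'a mpoly" where
  "var_ops \<equiv> \<lambda>l v j. Var l * v j"

interpretation var_ops: commuting_operators var_ops
  by (rule commuting_operators_pointwise) (rule mult_ops.commuting_operators_axioms)

lemma var_ops_tuples_forms:
  "l < r \<Longrightarrow> v \<in> tuples b (forms r e) \<Longrightarrow> (\<lambda>j. Var l * v j) \<in> tuples b (forms r (Suc e))"
  by (simp add: tuples_def forms_Var_mult)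

lemma koszul_exact_tuples_forms:
  "koszul_exact r var_ops i (tuples b (forms r e)) (tuples b (forms r (Suc e)))"
  by (rule koszul_exact_tuples[OF koszul_exact_Var mult_ops.commuting_operators_axioms])

definition form_matrix :: "nat \<Rightarrow> nat \<Rightarrow> nat \<Rightarrow> nat \<Rightarrow> (nat \<Rightarrow> nat \<Rightarrow> 'a::comm_ring_1 mpoly) \<Rightarrow> bool" where
  "form_matrix r \<delta> b c M \<longleftrightarrow> (\<forall>j<c. \<forall>k<b. M j k \<in> forms r \<delta>)"

lemma additive_mat_app: "additive (mat_app M b c)"
  by unfold_locales (auto simp: fun_eq_iff mat_app_def distrib_left sum.distrib)

lemma mat_app_scale: "mat_app M b c (\<lambda>k. p * v k) = (\<lambda>j. p * mat_app M b c v j)"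
  by (rule ext) (simp add: mat_app_def sum_distrib_left mult.left_commute)

lemma operator_map_mat_app: "operator_map var_ops var_ops (mat_app M b c)"
  by (intro operator_map.intro var_ops.commuting_operators_axioms operator_map_axioms.intro
      additive_mat_app mat_app_scale)

lemma mat_app_hom_comp:
  assumes "form_matrix r \<delta> b c M"
  shows "mat_app M b c (\<lambda>k. hom_comp e (v k)) = (\<lambda>j. hom_comp (e + \<delta>) (mat_app M b c v j))"
proof
  fix j
  have "hom_comp (e + \<delta>) (M j k * v k) = M j k * hom_comp e (v k)" if "j < c" "k < b" for k
    using assms that hom_comp_mult_homog[of \<delta> "M j k" e "v k"]
    by (simp add: form_matrix_def forms_def mult.commute)
  then show "mat_app M b c (\<lambda>k. hom_comp e (v k)) j = hom_comp (e + \<delta>) (mat_app M b c v j)"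
    by (simp add: mat_app_def hom_comp.sum hom_comp.zero)
qed

lemma graded_part_image_mat_app:
  assumes M: "form_matrix r \<delta> b c M"
  shows "graded_part (mat_app M b c ` vecs r b) (e + \<delta>) = mat_app M b c ` tuples b (forms r e)"
proof
  show "graded_part (mat_app M b c ` vecs r b) (e + \<delta>) \<subseteq> mat_app M b c ` tuples b (forms r e)"
  proof
    fix v assume "v \<in> graded_part (mat_app M b c ` vecs r b) (e + \<delta>)"
    then obtain u where u: "u \<in> vecs r b" "v = mat_app M b c u" "\<And>j. homog (e + \<delta>) (v j)"
      by (auto simp: graded_part_def)
    have "v = mat_app M b c (\<lambda>k. hom_comp e (u k))"
      by (rule ext) (simp add: mat_app_hom_comp[OF M] hom_comp_homog[OF u(3)] flip: u(2))
    moreover have "(\<lambda>k. hom_comp e (u k)) \<in> tuples b (forms r e)"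
      using u(1) by (simp add: vecs_def tuples_def forms_hom_comp hom_comp.zero)
    ultimately show "v \<in> mat_app M b c ` tuples b (forms r e)" by (rule image_eqI)
  qed
  have "mat_app M b c v \<in> tuples c (forms r (e + \<delta>))" if "v \<in> tuples b (forms r e)" for v
    using that M
    by (auto simp: tuples_def mat_app_def form_matrix_def add.commute[of e]
        intro!: forms_sum forms_mult)
  then show "mat_app M b c ` tuples b (forms r e) \<subseteq> graded_part (mat_app M b c ` vecs r b) (e + \<delta>)"
    using tuples_forms_subset_vecs graded_part_vecs[of r c "e + \<delta>"]
    by (fastforce simp: graded_part_def)
qed

lemma graded_submodule_kernel:
  assumes M: "form_matrix r \<delta> b c M"
  shows "graded_submodule r b {v \<in> vecs r b. mat_app M b c v = 0}"
proof -
  interpret h: operator_map var_ops var_ops "mat_app M b c" by (rule operator_map_mat_app)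
  have "is_add_subgroup {v \<in> vecs r b. mat_app M b c v = 0}"
    using is_add_subgroup_vecs[of r b] by (auto simp: is_add_subgroup_def h.map_diff)
  then show ?thesis
    using mat_app_hom_comp[OF M]
    by (auto simp: graded_submodule_def vecs_scale mat_app_scale zero_fun_def hom_comp.zero)
      (auto simp: vecs_def in_ring_hom_comp hom_comp.zero)
qed

section \<open>Linear resolutions and vanishing Koszul homology\<close>

lemma koszul_exact_image_linear_map:
  fixes M :: "nat \<Rightarrow> nat \<Rightarrow> nat \<Rightarrow> 'a::comm_ring_1 mpoly"
  assumes M: "\<And>t. form_matrix r 1 (b (Suc t)) (b t) (M t)"
    and kernel: "\<And>t. {v \<in> vecs r (b (Suc t)). mat_app (M t) (b (Suc t)) (b t) v = 0}
        = mat_app (M (Suc t)) (b (Suc (Suc t))) (b (Suc t)) ` vecs r (b (Suc (Suc t)))"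
  defines "Z \<equiv> \<lambda>t. mat_app (M t) (b (Suc t)) (b t) ` vecs r (b (Suc t))"
  shows "koszul_exact r var_ops i (graded_part (Z t) (Suc e)) (graded_part (Z t) (Suc (Suc e)))"
proof (induction i arbitrary: t e)
  have from_next_image: "koszul_exact r var_ops i (graded_part (Z t) (Suc e))
      (graded_part (Z t) (Suc (Suc e)))"
    if "\<And>j. i = Suc j \<Longrightarrow>
      koszul_exact r var_ops j (graded_part (Z (Suc t)) (Suc e))
          (graded_part (Z (Suc t)) (Suc (Suc e)))"
    for i t e
  proof -
    let ?m = "mat_app (M t) (b (Suc t)) (b t)" and ?F = "\<lambda>e. tuples (b (Suc t)) (forms r e)"
    interpret operator_map var_ops var_ops ?m by (rule operator_map_mat_app)
    have "graded_part (Z (Suc t)) e = {v \<in> ?F e. ?m v = 0}" for e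
      unfolding Z_def kernel[symmetric] graded_part_Collect graded_part_vecs ..
    then have "koszul_exact r var_ops i (?m ` ?F e) (?m ` ?F (Suc e))"
      using that
      by (intro koszul_exact_image[where W="?F (Suc (Suc e))"] koszul_exact_tuples_forms
          is_add_subgroup_tuples_forms var_ops_tuples_forms) auto
    then show ?thesis
      using graded_part_image_mat_app[OF M[of t], of e]
          graded_part_image_mat_app[OF M[of t], of "Suc e"]
      by (simp add: Z_def)
  qed
  {
    case 0 show ?case by (rule from_next_image) simp
  next
    case (Suc i) show ?case by (rule from_next_image) (simp add: Suc.IH)
  }
qed

lemma operator_map_combination:
  "operator_map var_ops (mult_ops Var) (\<lambda>v. \<Sum>j<b. v j * g j)"
  by (intro operator_map.intro var_ops.commuting_operators_axioms
      mult_ops.commuting_operators_axioms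
      operator_map_axioms.intro additive.intro)
    (simp_all add: distrib_right sum.distrib sum_distrib_left mult.assoc)

lemma gen_ideal_Int_forms:
  assumes g: "\<And>j. j < b \<Longrightarrow> g j \<in> forms r D"
  shows "gen_ideal r (g ` {..<b::nat}) \<inter> forms r (e + D)
      = (\<lambda>v. \<Sum>j<b. v j * g j) ` tuples b (forms r e)"
    (is "?L = ?h ` ?F")
proof
  show "?L \<subseteq> ?h ` ?F"
  proof
    fix p assume "p \<in> ?L"
    then obtain v where v: "v \<in> vecs r b" "p = ?h v" and p: "p \<in> forms r (e + D)"
      unfolding gen_ideal_image_lessThan by blast
    have "p = ?h (\<lambda>j. hom_comp e (v j))"
      by (rule homog_combination[OF p _ v(2)]) (use g in \<open>auto simp: forms_def\<close>)
    moreover have "(\<lambda>j. hom_comp e (v j)) \<in> ?F"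
      using v(1) by (simp add: vecs_def tuples_def forms_hom_comp hom_comp.zero)
    ultimately show "p \<in> ?h ` ?F" by (rule image_eqI)
  qed
  have "?h v \<in> forms r (e + D)" if "v \<in> ?F" for v
    using that g by (auto simp: tuples_def intro!: forms_sum forms_mult)
  then show "?h ` ?F \<subseteq> ?L"
    unfolding gen_ideal_image_lessThan using tuples_forms_subset_vecs by blast
qed

theorem linear_resolution_imp_koszul_vanishing:
  assumes "linear_resolution r D J"
  shows "koszul_vanishing r D J"
  unfolding koszul_vanishing_def
proof (intro allI impI)
  fix i e assume e: "e \<ge> D"
  obtain b :: "nat \<Rightarrow> nat" and g M where
    generators: "\<forall>j<b 0. in_ring r (g j) \<and> homog D (g j)" and
    J: "J = gen_ideal r (g ` {..<b 0})" and
    linear: "\<forall>t\<ge>1. \<forall>j<b (t - 1). \<forall>k<b t. in_ring r (M t j k) \<and> homog 1 (M t j k)" and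
    relations: "{v \<in> vecs r (b 0). (\<Sum>j<b 0. v j * g j) = 0}
        = mat_app (M 1) (b 1) (b 0) ` vecs r (b 1)" and
    exact: "\<forall>t\<ge>1. {v \<in> vecs r (b t). mat_app (M t) (b t) (b (t - 1)) v = (\<lambda>_. 0)}
      = mat_app (M (t + 1)) (b (t + 1)) (b t) ` vecs r (b (t + 1))"
    using assms unfolding linear_resolution_def by (elim exE conjE) (rule that)
  let ?h = "\<lambda>v. \<Sum>j<b 0. v j * g j" and ?F = "\<lambda>e. tuples (b 0) (forms r e)"
  interpret operator_map var_ops "mult_ops Var" ?h by (rule operator_map_combination)
  have "form_matrix r 1 (b (Suc t)) (b t) (M (Suc t))" for t
    using linear by (auto simp: form_matrix_def forms_def)
  then have "koszul_exact r var_ops j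
      (graded_part (mat_app (M (Suc 0)) (b (Suc 0)) (b 0) ` vecs r (b (Suc 0))) (Suc e))
      (graded_part (mat_app (M (Suc 0)) (b (Suc 0)) (b 0) ` vecs r (b (Suc 0))) (Suc (Suc e)))"
          for j e
    by (rule koszul_exact_image_linear_map[where M="\<lambda>t. M (Suc t)" and b=b])
      (use exact in \<open>auto simp: zero_fun_def dest!: spec[of _ "Suc _"]\<close>)
  then have "koszul_exact r var_ops j {v \<in> ?F (Suc e). ?h v = 0} {v \<in> ?F (Suc (Suc e)). ?h v = 0}"
      for j e
    unfolding relations[unfolded One_nat_def, symmetric] graded_part_Collect graded_part_vecs .
  then have "koszul_exact r (mult_ops Var) i (?h ` ?F (e - D)) (?h ` ?F (Suc (e - D)))"
    by (intro koszul_exact_image[where W="?F (Suc (Suc (e - D)))"] koszul_exact_tuples_forms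
        is_add_subgroup_tuples_forms var_ops_tuples_forms)
  then show "koszul_exact r (mult_ops Var) i (J \<inter> forms r e) (J \<inter> forms r (Suc e))"
    using e generators gen_ideal_Int_forms[of "b 0" g r D "e - D"]
      gen_ideal_Int_forms[of "b 0" g r D "Suc (e - D)"]
    by (simp add: J forms_def)
qed

lemma (in vector_space) finite_span_basis_enumeration:
  assumes T: "finite T" "V \<subseteq> span T"
  obtains b :: nat and u where "\<And>k. k < b \<Longrightarrow> u k \<in> V"
    "\<And>v. v \<in> V \<Longrightarrow> \<exists>x. v = (\<Sum>k<b. scale (x k) (u k))"
    "\<And>x k. (\<Sum>k<b. scale (x k) (u k)) = 0 \<Longrightarrow> k < b \<Longrightarrow> x k = 0"
proof -
  obtain U where U: "U \<subseteq> V" "independent U" "V \<subseteq> span U"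
    by (rule maximal_independent_subset)
  have "finite U" using independent_span_bound[OF T(1) U(2)] U(1) T(2) by blast
  then obtain u where u: "bij_betw u {..<card U} U"
    using ex_bij_betw_nat_finite[of U] by (auto simp: atLeast0LessThan)
  have reindex: "(\<Sum>w\<in>U. scale (y w) w) = (\<Sum>k<card U. scale (y (u k)) (u k))" for y
    by (rule sum.reindex_bij_betw[OF u, symmetric])
  show ?thesis
  proof (rule that[of "card U" u])
    show "u k \<in> V" if "k < card U" for k using u U(1) that by (auto simp: bij_betw_def)
    show "\<exists>x. v = (\<Sum>k<card U. scale (x k) (u k))" if "v \<in> V" for v
    proof -
      have "v \<in> span U" using that U(3) by blast
      then obtain y where "v = (\<Sum>w\<in>U. scale (y w) w)" using span_finite[OF \<open>finite U\<close>] by auto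
      then show ?thesis using reindex[of y] by (intro exI[of _ "\<lambda>k. y (u k)"]) simp
    qed
    show "x k = 0" if x: "(\<Sum>k<card U. scale (x k) (u k)) = 0" and k: "k < card U" for x k
    proof -
      define y where "y w = x (the_inv_into {..<card U} u w)" for w
      have yu: "y (u k) = x k" if "k < card U" for k
        using u that unfolding y_def bij_betw_def by (simp add: the_inv_into_f_f)
      have "(\<Sum>w\<in>U. scale (y w) w) = 0" unfolding reindex using x by (simp add: yu)
      then have "y (u k) = 0"
        using independentD[OF U(2) \<open>finite U\<close> order_refl] u k by (auto simp: bij_betw_def)
      then show ?thesis using yu[OF k] by simp
    qed
  qed
qed

interpretation mpoly_vec: vector_space "\<lambda>(x::'a::field) (v::nat \<Rightarrow> 'a mpoly) j. Const x * v j"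
  by unfold_locales (auto simp: fun_eq_iff hom_distribs algebra_simps)

lemma tuples_forms_subset_span:
  "tuples c (forms r e) \<subseteq> mpoly_vec.span
    ((\<lambda>(j0, m) j. if j = j0 then single m 1 else 0) ` ({..<c} \<times> {m. keys m \<subseteq> {..<r} \<and> tdeg m = e}))"
  (is "_ \<subseteq> mpoly_vec.span (?unit ` ?T)")
proof
  fix v :: "nat \<Rightarrow> 'a mpoly" assume v: "v \<in> tuples c (forms r e)"
  have "v = (\<Sum>j0<c. \<Sum>m\<in>keys (v j0). (\<lambda>j. Const (lookup (v j0) m) * ?unit (j0, m) j))"
  proof
    fix j
    have "(\<Sum>j0<c. \<Sum>m\<in>keys (v j0). (\<lambda>j. Const (lookup (v j0) m) * ?unit (j0, m) j)) j
        = (\<Sum>j0<c. if j0 = j then \<Sum>m\<in>keys (v j0). single m (lookup (v j0) m) else 0)"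
      unfolding sum_fun_apply by (rule sum.cong[OF refl]) (auto simp: Const_mult_single)
    also have "\<dots> = v j" using v by (simp add: sum_single_lookup tuples_def)
    finally show "v j
        = (\<Sum>j0<c. \<Sum>m\<in>keys (v j0). (\<lambda>j. Const (lookup (v j0) m) * ?unit (j0, m) j)) j" ..
  qed
  also have "\<dots> \<in> mpoly_vec.span (?unit ` ?T)"
  proof (intro mpoly_vec.span_sum mpoly_vec.span_scale mpoly_vec.span_base imageI)
    fix j0 m assume "j0 \<in> {..<c}" "m \<in> keys (v j0)"
    then show "(j0, m) \<in> ?T" using v by (auto simp: tuples_def forms_def in_ring_def homog_def)
  qed
  finally show "v \<in> mpoly_vec.span (?unit ` ?T)" .
qed

lemma graded_part_basis:
  fixes Z :: "(nat \<Rightarrow> 'a::field mpoly) set"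
  assumes Z: "graded_submodule r c Z"
  obtains b :: nat and u where "\<And>k. k < b \<Longrightarrow> u k \<in> graded_part Z e"
    "\<And>v. v \<in> graded_part Z e \<Longrightarrow> \<exists>x. v = (\<Sum>k<b. (\<lambda>j. Const (x k) * u k j))"
    "\<And>x k. (\<Sum>k<b. (\<lambda>j. Const (x k) * u k j)) = 0 \<Longrightarrow> k < b \<Longrightarrow> x k = 0"
proof (rule mpoly_vec.finite_span_basis_enumeration)
  have "graded_part Z e \<subseteq> tuples c (forms r e)"
    using graded_submoduleD(1)[OF Z] graded_part_vecs[of r c e] by (auto simp: graded_part_def)
  then show "graded_part Z e \<subseteq> mpoly_vec.span
      ((\<lambda>(j0, m) j. if j = j0 then single m 1 else 0) `
          ({..<c} \<times> {m. keys m \<subseteq> {..<r} \<and> tdeg m = e}))"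
    using tuples_forms_subset_span by (rule order_trans)
qed (use finite_monomials that in auto)

definition koszul_linear :: "nat \<Rightarrow> nat \<Rightarrow> nat \<Rightarrow> (nat \<Rightarrow> 'a::comm_ring_1 mpoly) set \<Rightarrow> bool" where
  "koszul_linear r \<delta> b Z \<longleftrightarrow> graded_submodule r b Z \<and> (\<forall>e<\<delta>. graded_part Z e \<subseteq> {0})
     \<and> (\<forall>i. \<forall>e\<ge>\<delta>. koszul_exact r var_ops i (graded_part Z e) (graded_part Z (Suc e)))"

lemma mat_app_columns:
  assumes "\<And>k. k < b \<Longrightarrow> u k \<in> vecs r c"
  shows "mat_app (\<lambda>j k. u k j) b c v = (\<Sum>k<b. (\<lambda>j. v k * u k j))"
  using assms by (auto simp: mat_app_def fun_eq_iff sum_fun_apply vecs_def mult.commute)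

lemma koszul_linear_generated:
  assumes Z: "koszul_linear r \<delta> c Z"
    and V: "is_add_subgroup V" "\<And>l v. l < r \<Longrightarrow> v \<in> V \<Longrightarrow> (\<lambda>j. Var l * v j) \<in> V"
    and gens: "graded_part Z \<delta> \<subseteq> V"
  shows "Z \<subseteq> V"
proof (rule graded_submodule_subset[OF _ _ V(1)])
  show "graded_submodule r c Z" using Z by (simp add: koszul_linear_def)
  have above: "graded_part Z (\<delta> + e) \<subseteq> V" for e
  proof (induction e)
    case 0 then show ?case using gens by simp
  next
    case (Suc e)
    show ?case
    proof
      fix v assume "v \<in> graded_part Z (\<delta> + Suc e)"
      moreover have "koszul_exact r var_ops 0 (graded_part Z (\<delta> + e)) (graded_part Z (\<delta> + Suc e))"
        using Z by (simp add: koszul_linear_def)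
      ultimately obtain w where "\<And>l. l < r \<Longrightarrow> w l \<in> graded_part Z (\<delta> + e)"
          "v = (\<Sum>l<r. (\<lambda>j. Var l * w l j))"
        using var_ops.koszul_exact_0_generates by blast
      then show "v \<in> V" using Suc V by (auto intro!: add_subgroup_sum[OF V(1)])
    qed
  qed
  show "graded_part Z e \<subseteq> V" for e
  proof (cases "e < \<delta>")
    case True
    then show ?thesis using Z add_subgroup_zero[OF V(1)] by (auto simp: koszul_linear_def)
  next
    case False
    then show ?thesis using above[of "e - \<delta>"] by simp
  qed
qed

lemma koszul_linear_kernel:
  assumes Z: "koszul_linear r \<delta> c (mat_app M b c ` vecs r b)" and M: "form_matrix r \<delta> b c M"
    and inj: "\<And>x. mat_app M b c (\<lambda>k. if k < b then Const (x k) else 0) = 0 \<Longrightarrow> \<forall>k<b. x k = 0"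
  shows "koszul_linear r 1 b {v \<in> vecs r b. mat_app M b c v = 0}"
proof -
  let ?m = "mat_app M b c" and ?F = "\<lambda>e. tuples b (forms r e)"
  interpret operator_map var_ops var_ops ?m by (rule operator_map_mat_app)
  have "v = 0" if v: "v \<in> ?F 0" "?m v = 0" for v
  proof -
    have v_eq: "v = (\<lambda>k. if k < b then Const (lookup (v k) 0) else 0)"
      using v(1) by (auto simp: fun_eq_iff tuples_def forms_def intro: homog_0_eq_Const)
    then have "\<forall>k<b. lookup (v k) 0 = 0" using inj[of "\<lambda>k. lookup (v k) 0"] v(2) by simp
    then have "v k = 0" for k by (subst v_eq) simp
    then show "v = 0" by (simp add: fun_eq_iff)
  qed
  moreover have "koszul_exact r var_ops i {v \<in> ?F (Suc e). ?m v = 0}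
      {v \<in> ?F (Suc (Suc e)). ?m v = 0}"
    for i e
  proof (rule koszul_exact_kernel[where V="?F e"])
    show "koszul_exact r var_ops (Suc i) (?m ` ?F e) (?m ` ?F (Suc e))"
      using Z graded_part_image_mat_app[OF M, of e] graded_part_image_mat_app[OF M, of "Suc e"]
      unfolding koszul_linear_def by (metis add_Suc le_add2)
  qed (auto intro: koszul_exact_tuples_forms is_add_subgroup_tuples_forms var_ops_tuples_forms)
  then have "koszul_exact r var_ops i {v \<in> ?F e. ?m v = 0} {v \<in> ?F (Suc e). ?m v = 0}"
      if "e \<ge> 1" for i e
    using that by (cases e) auto
  ultimately show ?thesis
    using graded_submodule_kernel[OF M]
    by (auto simp: koszul_linear_def graded_part_Collect graded_part_vecs)
qed

lemma koszul_linear_image_columns: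
  assumes Z: "koszul_linear r \<delta> c Z"
    and u: "\<And>k. k < b \<Longrightarrow> u k \<in> graded_part Z \<delta>"
    and spanning: "\<And>v. v \<in> graded_part Z \<delta> \<Longrightarrow> \<exists>x. v = (\<Sum>k<b. (\<lambda>j. Const (x k) * u k j))"
  shows "Z = mat_app (\<lambda>j k. u k j) b c ` vecs r b"
proof
  let ?m = "mat_app (\<lambda>j k. u k j) b c"
  have graded: "graded_submodule r c Z" using Z by (simp add: koszul_linear_def)
  have u_Z: "u k \<in> Z" if "k < b" for k using u[OF that] by (simp add: graded_part_def)
  have columns: "?m v = (\<Sum>k<b. (\<lambda>j. v k * u k j))" for v
    by (rule mat_app_columns) (use u_Z graded_submoduleD(1)[OF graded] in blast)
  show "Z \<subseteq> ?m ` vecs r b"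
  proof (rule
      koszul_linear_generated[OF Z add_subgroup_image[OF is_add_subgroup_vecs additive_mat_app]])
    show "(\<lambda>j. Var l * v j) \<in> ?m ` vecs r b" if "l < r" "v \<in> ?m ` vecs r b" for l v
      using that vecs_scale[OF in_ring_Var[OF that(1)]] mat_app_scale[of _ b c "Var l", symmetric]
      by blast
    show "graded_part Z \<delta> \<subseteq> ?m ` vecs r b"
    proof
      fix v assume "v \<in> graded_part Z \<delta>"
      then obtain x where "v = (\<Sum>k<b. (\<lambda>j. Const (x k) * u k j))" using spanning by blast
      then have "v = ?m (\<lambda>k. if k < b then Const (x k) else 0)" by (simp add: columns)
      then show "v \<in> ?m ` vecs r b" by (rule image_eqI[where f="?m"]) (simp add: vecs_def)
    qed
  qed
  show "?m ` vecs r b \<subseteq> Z"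
    unfolding columns using u_Z
    by (auto intro!: add_subgroup_sum[OF graded_submoduleD(2)[OF graded]]
        graded_submoduleD(3)[OF graded] simp: vecs_def)
qed

lemma koszul_linear_presentation:
  fixes Z :: "(nat \<Rightarrow> 'a::field mpoly) set"
  assumes Z: "koszul_linear r \<delta> c Z"
  obtains b M where "form_matrix r \<delta> b c M" "Z = mat_app M b c ` vecs r b"
    "koszul_linear r 1 b {v \<in> vecs r b. mat_app M b c v = 0}"
proof -
  have graded: "graded_submodule r c Z" using Z by (simp add: koszul_linear_def)
  obtain b :: nat and u where
    u: "\<And>k. k < b \<Longrightarrow> u k \<in> graded_part Z \<delta>" and
    spanning: "\<And>v. v \<in> graded_part Z \<delta> \<Longrightarrow> \<exists>x. v = (\<Sum>k<b. (\<lambda>j. Const (x k) * u k j))" and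
    independent: "\<And>x k. (\<Sum>k<b. (\<lambda>j. Const (x k) * u k j)) = 0 \<Longrightarrow> k < b \<Longrightarrow> x k = 0"
    by (rule graded_part_basis[OF graded, of \<delta>]) (rule that)
  let ?M = "\<lambda>j k. u k j"
  have "graded_part Z \<delta> \<subseteq> tuples c (forms r \<delta>)"
    using graded_submoduleD(1)[OF graded]
    by (auto simp: graded_part_def simp flip: graded_part_vecs)
  then have u_forms: "u k \<in> tuples c (forms r \<delta>)" if "k < b" for k using u[OF that] by blast
  then have M: "form_matrix r \<delta> b c ?M" by (simp add: form_matrix_def tuples_def)
  have image: "Z = mat_app ?M b c ` vecs r b" by (rule koszul_linear_image_columns[OF Z u spanning])
  have "mat_app ?M b c (\<lambda>k. if k < b then Const (x k) else 0) = (\<Sum>k<b. (\<lambda>j. Const (x k) * u k j))"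
      for x
    by (subst mat_app_columns[of b u r c])
      (use subsetD[OF tuples_forms_subset_vecs u_forms] in auto)
  then have "koszul_linear r 1 b {v \<in> vecs r b. mat_app ?M b c v = 0}"
    by (intro koszul_linear_kernel[OF Z[unfolded image] M]) (use independent in simp)
  with M image show ?thesis by (rule that)
qed

lemma koszul_linear_resolution:
  fixes Z :: "(nat \<Rightarrow> 'a::field mpoly) set"
  assumes "koszul_linear r 1 c Z"
  obtains b M where "b 0 = c" "\<And>t. form_matrix r 1 (b (Suc t)) (b t) (M (Suc t))"
    "Z = mat_app (M 1) (b 1) (b 0) ` vecs r (b 1)"
    "\<And>t. {v \<in> vecs r (b (Suc t)). mat_app (M (Suc t)) (b (Suc t)) (b t) v = 0}
      = mat_app (M (Suc (Suc t))) (b (Suc (Suc t))) (b (Suc t)) ` vecs r (b (Suc (Suc t)))"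
proof -
  define presents where "presents \<equiv> \<lambda>(c, Z) (b, K) M. form_matrix r 1 b c M
    \<and> Z = mat_app M b c ` vecs r b \<and> K = {v \<in> vecs r b. mat_app M b c v = (0 :: nat \<Rightarrow> 'a mpoly)}"
  let ?P = "\<lambda>t x. case_prod (koszul_linear r 1) x \<and> (t = 0 \<longrightarrow> x = (c, Z))"
  have "\<exists>X. \<forall>t. ?P t (X t) \<and> (\<exists>M. presents (X t) (X (Suc t)) M)"
  proof (rule dependent_nat_choice)
    show "\<exists>x. ?P 0 x" using assms by auto
    fix x and t :: nat assume "?P t x"
    obtain c Z where x: "x = (c, Z)" by fastforce
    with \<open>?P t x\<close> have "koszul_linear r 1 c Z" by simp
    then obtain b M where "form_matrix r 1 b c M" "Z = mat_app M b c ` vecs r b"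
        "koszul_linear r 1 b {v \<in> vecs r b. mat_app M b c v = 0}"
      by (rule koszul_linear_presentation)
    then show "\<exists>y. ?P (Suc t) y \<and> (\<exists>M. presents x y M)"
      by (intro exI[of _ "(b, {v \<in> vecs r b. mat_app M b c v = 0})"]) (auto simp: x presents_def)
  qed
  then obtain X where X: "\<forall>t. ?P t (X t) \<and> (\<exists>M. presents (X t) (X (Suc t)) M)"
    by (elim exE) (rule that)
  then have "\<forall>t. \<exists>M. presents (X t) (X (Suc t)) M" by simp
  then obtain M where M: "\<And>t. presents (X t) (X (Suc t)) (M t)" by metis
  define b where "b t = fst (X t)" for t
  define K where "K t = snd (X t)" for t
  have K_0: "K 0 = Z" "b 0 = c" using X by (simp_all add: K_def b_def)
  have presentation: "form_matrix r 1 (b (Suc t)) (b t) (M t)"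
      "K t = mat_app (M t) (b (Suc t)) (b t) ` vecs r (b (Suc t))"
      "K (Suc t) = {v \<in> vecs r (b (Suc t)). mat_app (M t) (b (Suc t)) (b t) v = 0}" for t
    using M[of t] by (simp_all add: presents_def b_def K_def split_beta)
  show ?thesis
  proof (rule that[of b "\<lambda>t. M (t - 1)"])
    show "Z = mat_app (M (1 - 1)) (b 1) (b 0) ` vecs r (b 1)"
      using presentation(2)[of 0] K_0 by simp
    show "{v \<in> vecs r (b (Suc t)). mat_app (M (Suc t - 1)) (b (Suc t)) (b t) v = 0}
        = mat_app (M (Suc (Suc t) - 1)) (b (Suc (Suc t))) (b (Suc t))
          ` vecs r (b (Suc (Suc t)))" for t
      using presentation(2)[of "Suc t"] presentation(3)[of t] by simp
    show "form_matrix r 1 (b (Suc t)) (b t) (M (Suc t - 1))" for t using presentation(1)[of t] by simp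
  qed (rule K_0)
qed

definition scalar_vec :: "'a::zero \<Rightarrow> nat \<Rightarrow> 'a" where
  "scalar_vec p = (\<lambda>j. if j = 0 then p else 0)"

lemma scalar_vec_eq_0_iff: "scalar_vec p = 0 \<longleftrightarrow> p = 0"
  by (auto simp: scalar_vec_def fun_eq_iff)

lemma graded_part_scalar_vec:
  assumes "J \<subseteq> poly_ring r"
  shows "graded_part (scalar_vec ` J) e = scalar_vec ` (J \<inter> forms r e)"
proof -
  have "(\<forall>j. homog e (scalar_vec p j)) \<longleftrightarrow> homog e p" for p :: "'a mpoly"
    by (auto simp: scalar_vec_def)
  then show ?thesis using assms by (auto simp: graded_part_def forms_def)
qed

lemma operator_map_scalar_vec:
  "operator_map (mult_ops Var) var_ops (scalar_vec :: 'a::comm_ring_1 mpoly \<Rightarrow> nat \<Rightarrow> 'a mpoly)"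
  by (intro operator_map.intro var_ops.commuting_operators_axioms
      mult_ops.commuting_operators_axioms
      operator_map_axioms.intro additive.intro) (auto simp: scalar_vec_def fun_eq_iff)

lemma graded_submodule_scalar_vec:
  assumes "homogeneous_ideal r J"
  shows "graded_submodule r 1 (scalar_vec ` J)"
  unfolding graded_submodule_def
proof (intro conjI allI impI ballI)
  have J: "is_submodule (poly_ring r) J" "J \<subseteq> poly_ring r" "\<And>e p. p \<in> J \<Longrightarrow> hom_comp e p \<in> J"
    using assms by (auto simp: homogeneous_ideal_def)
  show "scalar_vec ` J \<subseteq> vecs r 1" using J(2) by (auto simp: scalar_vec_def vecs_def)
  show "is_add_subgroup (scalar_vec ` J)"
    by (intro add_subgroup_image[OF submodule_add_subgroup[OF J(1)]]
        operator_map.additive_map[OF operator_map_scalar_vec])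
  show "(\<lambda>j. p * v j) \<in> scalar_vec ` J" if "in_ring r p" "v \<in> scalar_vec ` J" for p v
  proof -
    from that obtain q where "q \<in> J" "v = scalar_vec q" by blast
    with that show ?thesis
      by (intro image_eqI[of _ _ "p * q"]) (auto simp: scalar_vec_def submodule_mult[OF J(1)])
  qed
  show "(\<lambda>j. hom_comp e (v j)) \<in> scalar_vec ` J" if "v \<in> scalar_vec ` J" for e v
  proof -
    from that obtain q where "q \<in> J" "v = scalar_vec q" by blast
    then show ?thesis
      by (intro image_eqI[of _ _ "hom_comp e q"]) (auto simp: scalar_vec_def J(3) hom_comp.zero)
  qed
qed

lemma koszul_linear_scalar_vec:
  assumes J: "homogeneous_ideal r J"
    and low: "\<And>e. e < D \<Longrightarrow> J \<inter> forms r e \<subseteq> {0}"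
    and exact: "koszul_vanishing r D J"
  shows "koszul_linear r D 1 (scalar_vec ` J)"
proof -
  have U: "is_submodule (poly_ring r) J" and J_ring: "J \<subseteq> poly_ring r"
    using J by (auto simp: homogeneous_ideal_def)
  interpret operator_map "mult_ops Var" var_ops "scalar_vec :: 'a mpoly \<Rightarrow> nat \<Rightarrow> 'a mpoly"
    by (rule operator_map_scalar_vec)
  have J_forms: "is_add_subgroup (J \<inter> forms r e)" for e
    by (intro is_add_subgroup_Int submodule_add_subgroup[OF U] is_add_subgroup_forms)
  have "koszul_exact r var_ops i (scalar_vec ` (J \<inter> forms r e))
      (scalar_vec ` (J \<inter> forms r (Suc e)))"
    if "e \<ge> D" for i e
  proof (rule koszul_exact_image[where W="J \<inter> forms r (Suc (Suc e))"])
    show "koszul_exact r (mult_ops Var) i (J \<inter> forms r e) (J \<inter> forms r (Suc e))"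
      using exact that by (simp add: koszul_vanishing_def)
    show "Var l * p \<in> J \<inter> forms r (Suc (Suc e))" if "l < r" "p \<in> J \<inter> forms r (Suc e)" for l p
      using that by (auto intro: submodule_mult[OF U] forms_Var_mult)
    have "{p \<in> J \<inter> forms r e. scalar_vec p = 0} = {0}" for e
      using submodule_zero[OF U] by (auto simp: scalar_vec_eq_0_iff)
    then show "koszul_exact r (mult_ops Var) j {p \<in> J \<inter> forms r (Suc e). scalar_vec p = 0}
        {p \<in> J \<inter> forms r (Suc (Suc e)). scalar_vec p = 0}" for j
      by (simp only: mult_ops.koszul_exact_zero)
  qed (rule J_forms)+
  then show ?thesis
    using low graded_submodule_scalar_vec[OF J]
    by (fastforce simp: koszul_linear_def graded_part_scalar_vec[OF J_ring])
qed

theorem linear_resolution_if_koszul_vanishing: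
  fixes J :: "'a::field mpoly set"
  assumes J: "homogeneous_ideal r J"
    and low: "\<And>e. e < D \<Longrightarrow> J \<inter> forms r e \<subseteq> {0}"
    and exact: "koszul_vanishing r D J"
  shows "linear_resolution r D J"
proof -
  obtain c G where G: "form_matrix r D c 1 G" "scalar_vec ` J = mat_app G c 1 ` vecs r c"
      "koszul_linear r 1 c {v \<in> vecs r c. mat_app G c 1 v = 0}"
    using koszul_linear_presentation[OF koszul_linear_scalar_vec[OF assms]] by blast
  obtain b M where "b 0 = c" and M: "\<And>t. form_matrix r 1 (b (Suc t)) (b t) (M (Suc t))"
    and relations: "{v \<in> vecs r c. mat_app G c 1 v = 0} = mat_app (M 1) (b 1) (b 0) ` vecs r (b 1)"
    and kernels: "\<And>t. {v \<in> vecs r (b (Suc t)). mat_app (M (Suc t)) (b (Suc t)) (b t) v = 0}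
      = mat_app (M (Suc (Suc t))) (b (Suc (Suc t))) (b (Suc t)) ` vecs r (b (Suc (Suc t)))"
    using koszul_linear_resolution[OF G(3)] by blast
  let ?h = "\<lambda>v. \<Sum>j<c. v j * G 0 j"
  have G_app: "mat_app G c 1 v = scalar_vec (?h v)" for v
    by (auto simp: mat_app_def scalar_vec_def fun_eq_iff mult.commute)
  have relations': "{v \<in> vecs r c. ?h v = 0} = mat_app (M 1) (b 1) (b 0) ` vecs r (b 1)"
    unfolding relations[symmetric] G_app scalar_vec_eq_0_iff ..
  have inj: "inj (scalar_vec :: 'a mpoly \<Rightarrow> _)"
    by (rule injI) (auto simp: scalar_vec_def dest: fun_cong[of _ _ 0])
  have "scalar_vec ` J = scalar_vec ` (?h ` vecs r c)" unfolding G(2) G_app image_image ..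
  then have "J = gen_ideal r (G 0 ` {..<c})"
    by (simp only: inj_image_eq_iff[OF inj] gen_ideal_image_lessThan)
  moreover have "{v \<in> vecs r (b t). mat_app (M t) (b t) (b (t - 1)) v = (\<lambda>_. 0)}
      = mat_app (M (t + 1)) (b (t + 1)) (b t) ` vecs r (b (t + 1))" if "t \<ge> 1" for t
    using kernels[of "t - 1"] that by (simp add: zero_fun_def)
  moreover have "in_ring r (M t j k) \<and> homog 1 (M t j k)"
      if "t \<ge> 1" "j < b (t - 1)" "k < b t" for t j k
    using M[of "t - 1"] that by (simp add: form_matrix_def forms_def)
  ultimately show ?thesis
    unfolding linear_resolution_def using G(1) relations' \<open>b 0 = c\<close>
    by (intro exI[of _ b] exI[of _ "G 0"] exI[of _ M]) (simp add: form_matrix_def forms_def)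
qed

section \<open>Determinants and ideals of minors\<close>

lemma permutes_lessThan: "p permutes {..<n} \<Longrightarrow> i < n \<Longrightarrow> p i < n"
  using permutes_in_image[of p "{..<n}" i] by simp

lemma det_n_eq_det: "det_n n M = det (mat n n (\<lambda>(i, j). M i j))"
  unfolding det_n_def det_def
  by (auto simp: atLeast0LessThan permutes_lessThan intro!: sum.cong prod.cong)

lemma det_n_cong: "(\<And>i k. i < n \<Longrightarrow> k < n \<Longrightarrow> M i k = M' i k) \<Longrightarrow> det_n n M = det_n n M'"
  unfolding det_n_eq_det by (intro arg_cong[of _ _ det] eq_matI) auto

lemma det_n_identical_rows:
  assumes "i < n" "j < n" "i \<noteq> j" "\<And>k. k < n \<Longrightarrow> M i k = M j k"
  shows "det_n n M = 0"
  unfolding det_n_eq_det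
  by (rule det_identical_rows[of _ n i j]) (use assms in auto)

lemma det_n_identical_columns:
  assumes "i < n" "j < n" "i \<noteq> j" "\<And>k. k < n \<Longrightarrow> M k i = M k j"
  shows "det_n n M = 0"
  unfolding det_n_eq_det
  by (rule det_identical_columns[of _ n i j]) (use assms in auto)

lemma det_n_singular:
  fixes M :: "nat \<Rightarrow> nat \<Rightarrow> 'a::idom"
  assumes "\<And>i. i < n \<Longrightarrow> (\<Sum>k<n. M i k * v k) = 0" "l < n" "v l \<noteq> 0"
  shows "det_n n M = 0"
proof -
  let ?A = "mat n n (\<lambda>(i, j). M i j)" and ?v = "vec n v"
  have "?v \<noteq> 0\<^sub>v n" using assms(2,3) by (metis index_vec index_zero_vec(1))
  moreover have "?A *\<^sub>v ?v = 0\<^sub>v n"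
    using assms(1) by (intro eq_vecI) (auto simp: scalar_prod_def atLeast0LessThan)
  ultimately show ?thesis unfolding det_n_eq_det
    by (subst det_0_iff_vec_prod_zero[of _ n]) (auto intro!: exI[of _ ?v])
qed

lemma det_n_permute_columns:
  assumes \<tau>: "\<tau> permutes {..<n}"
  shows "det_n n (\<lambda>i k. M i (\<tau> k)) = of_int (sign \<tau>) * det_n n M"
proof -
  let ?A = "mat n n (\<lambda>(i, j). M j i)"
  have "det_n n (\<lambda>i k. M i (\<tau> k)) = det (mat n n (\<lambda>(i, j). M i (\<tau> j)))" by (rule det_n_eq_det)
  also have "\<dots> = det (mat n n (\<lambda>(i, j). M i (\<tau> j)))\<^sup>T"
    by (rule det_transpose[of _ n, symmetric]) simp
  also have "(mat n n (\<lambda>(i, j). M i (\<tau> j)))\<^sup>T = mat n n (\<lambda>(i, j). ?A $$ (\<tau> i, j))"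
    by (rule eq_matI) (auto simp: permutes_lessThan[OF \<tau>])
  also have "det \<dots> = signof \<tau> * det ?A"
    by (rule det_permute_rows) (use \<tau> in \<open>auto simp: atLeast0LessThan\<close>)
  also have "?A = (mat n n (\<lambda>(i, j). M i j))\<^sup>T" by (rule eq_matI) auto
  also have "det \<dots> = det_n n M" unfolding det_n_eq_det by (rule det_transpose[of _ n]) simp
  finally show ?thesis .
qed

lemma subst_det_n: "subst y (det_n n M) = det_n n (\<lambda>i k. subst y (M i k))"
  by (simp add: det_n_def hom_distribs)

lemma in_ring_det_n: "(\<And>i k. i < n \<Longrightarrow> k < n \<Longrightarrow> in_ring r (M i k)) \<Longrightarrow> in_ring r (det_n n M)"
  unfolding det_n_def
  by (auto intro!: in_ring_sum in_ring_mult in_ring_prod simp: permutes_lessThan)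

lemma det_n_last_row:
  "det_n (Suc c) (\<lambda>i k. if i = c then w k else M i k)
    = (\<Sum>p | p permutes {..<Suc c}. of_int (sign p) * w (p c) * (\<Prod>i<c. M i (p i)))"
  unfolding det_n_def by (rule sum.cong) (auto simp: mult_ac)

lemma det_n_last_row_sum:
  "det_n (Suc c) (\<lambda>i k. if i = c then \<Sum>l\<in>X. x l * w l k else M i k)
    = (\<Sum>l\<in>X. x l * det_n (Suc c) (\<lambda>i k. if i = c then w l k else M i k))"
  unfolding det_n_last_row sum_distrib_left sum_distrib_right
  by (subst sum.swap) (simp add: mult_ac)

lemma det_n_last_row_unit:
  "det_n (Suc c) (\<lambda>i k. if i = c then (if k = c then 1 else 0) else M i k) = det_n c M"
proof -
  have "det_n (Suc c) (\<lambda>i k. if i = c then (if k = c then 1 else 0) else M i k)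
      = (\<Sum>p | p permutes {..<Suc c} \<and> p c = c. of_int (sign p) * (\<Prod>i<c. M i (p i)))"
    unfolding det_n_last_row
    by (rule sum.mono_neutral_cong_right) (auto simp: finite_permutations)
  also have "{p. p permutes {..<Suc c} \<and> p c = c} = {p. p permutes {..<c}}"
  proof (rule Collect_cong, rule iffI)
    fix p assume "p permutes {..<Suc c} \<and> p c = c"
    then show "p permutes {..<c}"
      using permutes_superset[of p "{..<Suc c}" "{..<c}"] by (auto simp: less_Suc_eq)
  next
    fix p assume "p permutes {..<c}"
    then show "p permutes {..<Suc c} \<and> p c = c"
      using permutes_subset[of p "{..<c}" "{..<Suc c}"] by (auto simp: permutes_not_in)
  qed
  finally show ?thesis by (simp add: det_n_def)
qed

definition all_minors_ideal ::
    "nat \<Rightarrow> nat \<Rightarrow> nat \<Rightarrow> nat \<Rightarrow> (nat \<Rightarrow> nat \<Rightarrow> 'a::comm_ring_1 mpoly) \<Rightarrow> 'a mpoly set" where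
  "all_minors_ideal r N n c \<Theta> = gen_ideal r
     {det_n c (\<lambda>i k. \<Theta> (\<rho> i) (\<sigma> k)) | \<rho> \<sigma>. (\<forall>i<c. \<rho> i < N) \<and> (\<forall>k<c. \<sigma> k < n)}"

lemma is_submodule_all_minors_ideal: "is_submodule (poly_ring r) (all_minors_ideal r N n c \<Theta>)"
  unfolding all_minors_ideal_def by (rule is_submodule_gen_ideal)

lemma minor_in_all_minors_ideal:
  "(\<And>i. i < c \<Longrightarrow> \<rho> i < N) \<Longrightarrow> (\<And>k. k < c \<Longrightarrow> \<sigma> k < n) \<Longrightarrow>
    det_n c (\<lambda>i k. \<Theta> (\<rho> i) (\<sigma> k)) \<in> all_minors_ideal r N n c \<Theta>"
  unfolding all_minors_ideal_def by (rule gen_ideal_base) blast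

lemma all_minors_ideal_subset:
  assumes "is_submodule (poly_ring r) U"
    and "\<And>\<rho> \<sigma>. (\<And>i. i < c \<Longrightarrow> \<rho> i < N) \<Longrightarrow> (\<And>k. k < c \<Longrightarrow> \<sigma> k < n) \<Longrightarrow> inj_on \<rho> {..<c} \<Longrightarrow>
      inj_on \<sigma> {..<c} \<Longrightarrow> det_n c (\<lambda>i k. \<Theta> (\<rho> i) (\<sigma> k)) \<in> U"
  shows "all_minors_ideal r N n c \<Theta> \<subseteq> U"
  unfolding all_minors_ideal_def
proof (rule gen_ideal_least[OF assms(1)], safe)
  fix \<rho> \<sigma> :: "nat \<Rightarrow> nat" assume ranges: "\<forall>i<c. \<rho> i < N" "\<forall>k<c. \<sigma> k < n"
  let ?m = "det_n c (\<lambda>i k. \<Theta> (\<rho> i) (\<sigma> k))"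
  consider "\<not> inj_on \<rho> {..<c}" | "\<not> inj_on \<sigma> {..<c}" | "inj_on \<rho> {..<c}" "inj_on \<sigma> {..<c}" by blast
  then show "?m \<in> U"
  proof cases
    case 1
    then obtain i j where "i < c" "j < c" "i \<noteq> j" "\<rho> i = \<rho> j" by (auto simp: inj_on_def)
    then have "?m = 0" by (intro det_n_identical_rows[of i _ j]) auto
    then show ?thesis using submodule_zero[OF assms(1)] by simp
  next
    case 2
    then obtain i j where "i < c" "j < c" "i \<noteq> j" "\<sigma> i = \<sigma> j" by (auto simp: inj_on_def)
    then have "?m = 0" by (intro det_n_identical_columns[of i _ j]) auto
    then show ?thesis using submodule_zero[OF assms(1)] by simp
  next
    case 3
    then show ?thesis using assms(2) ranges by blast
  qed
qed

lemma bij_betw_lessThan_if_inj_on: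
  fixes \<sigma> :: "nat \<Rightarrow> nat"
  assumes "inj_on \<sigma> {..<n}" "\<And>k. k < n \<Longrightarrow> \<sigma> k < n"
  shows "bij_betw \<sigma> {..<n} {..<n}"
  using assms endo_inj_surj[of "{..<n}" \<sigma>] by (auto simp: bij_betw_def)

lemma exists_bij_extension:
  assumes \<sigma>: "inj_on \<sigma> {..<c}" "\<And>k. k < c \<Longrightarrow> \<sigma> k < Suc c"
  obtains l where "l < Suc c" "l \<notin> \<sigma> ` {..<c}" "bij_betw (\<sigma>(c := l)) {..<Suc c} {..<Suc c}"
proof -
  have "card (\<sigma> ` {..<c}) < card {..<Suc c}" using card_image[OF \<sigma>(1)] by simp
  then have "\<not> {..<Suc c} \<subseteq> \<sigma> ` {..<c}" using card_mono[of "\<sigma> ` {..<c}" "{..<Suc c}"] by auto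
  then obtain l where l: "l < Suc c" "l \<notin> \<sigma> ` {..<c}" by auto
  have "inj_on (\<sigma>(c := l)) {..<Suc c}"
    using \<sigma>(1) l(2) by (auto simp: lessThan_Suc inj_on_def image_iff)
  then have "bij_betw (\<sigma>(c := l)) {..<Suc c} {..<Suc c}"
    by (rule bij_betw_lessThan_if_inj_on) (use \<sigma>(2) l(1) in auto)
  with l show ?thesis by (rule that)
qed

lemma all_minors_ideal_maximal: "all_minors_ideal r N n n \<Theta> = minors_ideal r N n \<Theta>"
proof
  show "all_minors_ideal r N n n \<Theta> \<subseteq> minors_ideal r N n \<Theta>"
  proof (rule all_minors_ideal_subset)
    show U: "is_submodule (poly_ring r) (minors_ideal r N n \<Theta>)"
      unfolding minors_ideal_def by (rule is_submodule_gen_ideal)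
    fix \<rho> \<sigma> :: "nat \<Rightarrow> nat"
    assume \<rho>: "\<And>i. i < n \<Longrightarrow> \<rho> i < N" "inj_on \<rho> {..<n}" and \<sigma>: "\<And>k. k < n \<Longrightarrow> \<sigma> k < n" "inj_on \<sigma> {..<n}"
    define \<tau> where "\<tau> k = (if k < n then \<sigma> k else k)" for k
    have "bij_betw \<tau> {..<n} {..<n}"
      using bij_betw_lessThan_if_inj_on[OF \<sigma>(2,1)] bij_betw_cong[of "{..<n}" \<tau> \<sigma>]
      by (simp add: \<tau>_def)
    then have \<tau>: "\<tau> permutes {..<n}" by (rule bij_imp_permutes) (simp add: \<tau>_def)
    have "det_n n (\<lambda>i k. \<Theta> (\<rho> i) (\<sigma> k)) = det_n n (\<lambda>i k. \<Theta> (\<rho> i) (\<tau> k))"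
      by (rule det_n_cong) (simp add: \<tau>_def)
    also have "\<dots> = of_int (sign \<tau>) * det_n n (\<lambda>i l. \<Theta> (\<rho> i) l)"
      by (rule det_n_permute_columns[OF \<tau>])
    also have "\<dots> \<in> minors_ideal r N n \<Theta>"
    proof (rule submodule_mult[OF U])
      show "det_n n (\<lambda>i l. \<Theta> (\<rho> i) l) \<in> minors_ideal r N n \<Theta>"
        unfolding minors_ideal_def by (rule gen_ideal_base) (use \<rho> in blast)
    qed simp
    finally show "det_n n (\<lambda>i k. \<Theta> (\<rho> i) (\<sigma> k)) \<in> minors_ideal r N n \<Theta>" .
  qed
  show "minors_ideal r N n \<Theta> \<subseteq> all_minors_ideal r N n n \<Theta>"
    unfolding minors_ideal_def all_minors_ideal_def
    by (rule gen_ideal_mono) (fastforce intro: exI[of _ "\<lambda>k. k"])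
qed

text \<open>The coordinates of the generalized cross product of the rows \<open>\<rho> 0, \<dots>, \<rho> (c - 1)\<close> of \<open>\<Theta>\<close>,
  restricted to the columns \<open>\<tau> 0, \<dots>, \<tau> c\<close>.\<close>
definition signed_minor ::
    "nat \<Rightarrow> (nat \<Rightarrow> nat \<Rightarrow> 'a::comm_ring_1) \<Rightarrow> (nat \<Rightarrow> nat) \<Rightarrow> (nat \<Rightarrow> nat) \<Rightarrow> nat \<Rightarrow> 'a" where
  "signed_minor c \<Theta> \<rho> \<tau> l
    = det_n (Suc c) (\<lambda>i k. if i = c then (if \<tau> k = l then 1 else 0) else \<Theta> (\<rho> i) (\<tau> k))"

lemma in_ring_signed_minor:
  assumes "\<And>j l. in_ring r (\<Theta> j l)"
  shows "in_ring r (signed_minor c \<Theta> \<rho> \<tau> l)"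
  unfolding signed_minor_def by (rule in_ring_det_n) (use assms in auto)

lemma subst_signed_minor:
  "subst y (signed_minor c \<Theta> \<rho> \<tau> l) = signed_minor c (\<lambda>j l. subst y (\<Theta> j l)) \<rho> \<tau> l"
  unfolding signed_minor_def subst_det_n by (rule det_n_cong) auto

lemma signed_minor_sum:
  assumes "\<And>k. k \<le> c \<Longrightarrow> \<tau> k < n"
  shows "(\<Sum>l<n. x l * signed_minor c \<Theta> \<rho> \<tau> l)
    = det_n (Suc c) (\<lambda>i k. if i = c then x (\<tau> k) else \<Theta> (\<rho> i) (\<tau> k))"
proof -
  have "(\<Sum>l<n. x l * signed_minor c \<Theta> \<rho> \<tau> l)
      = det_n (Suc c)
          (\<lambda>i k. if i = c then \<Sum>l<n. x l * (if \<tau> k = l then 1 else 0) else \<Theta> (\<rho> i) (\<tau> k))"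
    unfolding signed_minor_def by (rule det_n_last_row_sum[symmetric])
  also have "\<dots> = det_n (Suc c) (\<lambda>i k. if i = c then x (\<tau> k) else \<Theta> (\<rho> i) (\<tau> k))"
    by (rule det_n_cong) (use assms in \<open>auto simp: if_distrib[of "\<lambda>y. _ * y"] cong: if_cong\<close>)
  finally show ?thesis .
qed

lemma row_times_signed_minor:
  assumes "\<And>k. k \<le> c \<Longrightarrow> \<tau> k < n" "\<And>i. i < c \<Longrightarrow> \<rho> i < N" "j < N"
  shows "(\<Sum>l<n. \<Theta> j l * signed_minor c \<Theta> \<rho> \<tau> l) \<in> all_minors_ideal r N n (Suc c) \<Theta>"
proof -
  have "(\<Sum>l<n. \<Theta> j l * signed_minor c \<Theta> \<rho> \<tau> l) = det_n (Suc c) (\<lambda>i k. \<Theta> ((\<rho>(c := j)) i) (\<tau> k))"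
    by (subst signed_minor_sum[OF assms(1)]) (auto intro!: det_n_cong)
  then show ?thesis using minor_in_all_minors_ideal[of "Suc c" "\<rho>(c := j)" N \<tau> n \<Theta> r] assms by auto
qed

lemma signed_minor_upd_eq:
  assumes "l \<notin> \<sigma> ` {..<c}"
  shows "signed_minor c \<Theta> \<rho> (\<sigma>(c := l)) l = det_n c (\<lambda>i k. \<Theta> (\<rho> i) (\<sigma> k))"
proof -
  have "signed_minor c \<Theta> \<rho> (\<sigma>(c := l)) l
      = det_n (Suc c) (\<lambda>i k. if i = c then (if k = c then 1 else 0) else \<Theta> (\<rho> i) ((\<sigma>(c := l)) k))"
    unfolding signed_minor_def by (rule det_n_cong) (use assms in auto)
  also have "\<dots> = det_n c (\<lambda>i k. \<Theta> (\<rho> i) ((\<sigma>(c := l)) k))" by (rule det_n_last_row_unit)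
  also have "\<dots> = det_n c (\<lambda>i k. \<Theta> (\<rho> i) (\<sigma> k))" by (rule det_n_cong) auto
  finally show ?thesis .
qed

lemma signed_minor_eq_0:
  assumes "m \<notin> \<tau> ` {..c}"
  shows "signed_minor c \<Theta> \<rho> \<tau> m = 0"
  unfolding signed_minor_def det_n_last_row
proof (rule sum.neutral, rule)
  fix p assume "p \<in> {p. p permutes {..<Suc c}}"
  then have "p c \<in> {..c}" using permutes_in_image[of p "{..<Suc c}" c] by simp
  then have "\<tau> (p c) \<noteq> m" using assms by blast
  then show "of_int (sign p) * (if \<tau> (p c) = m then 1 else 0) * (\<Prod>i<c. \<Theta> (\<rho> i) (\<tau> (p i))) = 0"
    by simp
qed

section \<open>Polynomials in one variable over a submodule\<close>

definition polys_over :: "'a::zero set \<Rightarrow> 'a poly set" where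
  "polys_over U = {p. \<forall>k. coeff p k \<in> U}"

lemma is_add_subgroup_polys_over: "is_add_subgroup U \<Longrightarrow> is_add_subgroup (polys_over U)"
  by (simp add: is_add_subgroup_def polys_over_def)

lemma pCons_in_polys_over: "p \<in> polys_over U \<Longrightarrow> u \<in> U \<Longrightarrow> pCons u p \<in> polys_over U"
  by (auto simp: polys_over_def coeff_pCons split: nat.splits)

lemma const_poly_in_polys_over: "is_add_subgroup U \<Longrightarrow> u \<in> U \<Longrightarrow> [:u:] \<in> polys_over U"
  by (rule pCons_in_polys_over) (rule add_subgroup_zero[OF is_add_subgroup_polys_over])

lemma is_subring_polys_over:
  assumes R: "is_subring R"
  shows "is_subring (polys_over R)"
proof -
  note G = subring_add_subgroup[OF R]
  have "1 \<in> polys_over R"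
    using const_poly_in_polys_over[OF G subring_one[OF R]] by (simp add: one_pCons)
  moreover have "p * q \<in> polys_over R" if "p \<in> polys_over R" "q \<in> polys_over R" for p q
    using that
    by (auto simp: polys_over_def coeff_mult intro!: add_subgroup_sum[OF G] subring_mult[OF R])
  ultimately show ?thesis by (simp add: is_subring_def is_add_subgroup_polys_over[OF G])
qed

lemma is_submodule_polys_over:
  assumes U: "is_submodule R U"
  shows "is_submodule (polys_over R) (polys_over U)"
  using is_subring_polys_over[OF submodule_subring[OF U]]
    is_add_subgroup_polys_over[OF submodule_add_subgroup[OF U]]
  by (auto simp: is_submodule_def polys_over_def coeff_mult
      intro!: submodule_sum[OF U] submodule_mult[OF U])

text \<open>Modulo \<open>U\<close> we have \<open>u \<equiv> F G\<close> and \<open>u X\<^sup>P \<equiv> F G'\<close>, so \<open>u G' \<equiv> F G G' \<equiv> u X\<^sup>P G\<close>. As \<open>G'\<close> has degree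
  less than \<open>P\<close>, this forces \<open>u G' \<equiv> 0\<close>, and then \<open>u\<^sup>2 X\<^sup>P \<equiv> u F G' \<equiv> 0\<close>.\<close>
lemma square_in_submodule:
  fixes F G G' :: "'a::comm_ring_1 poly"
  assumes U: "is_submodule R U" and u: "u \<in> R"
    and closed: "F \<in> polys_over R" "G \<in> polys_over R" "G' \<in> polys_over R" and deg: "degree G' < P"
    and FG: "[:u:] - F * G \<in> polys_over U" and FG': "monom u P - F * G' \<in> polys_over U"
  shows "u * u \<in> U"
proof -
  note V = is_submodule_polys_over[OF U]
  have "G' * ([:u:] - F * G) - G * (monom u P - F * G') \<in> polys_over U"
    by (intro submodule_diff[OF V] submodule_mult[OF V] closed FG FG')
  then have diff: "smult u G' - monom u P * G \<in> polys_over U" by (simp add: algebra_simps)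
  have "coeff (smult u G') k \<in> U" for k
  proof (cases "k < P")
    case True
    then have "coeff (smult u G') k = coeff (smult u G' - monom u P * G) k"
      by (simp add: coeff_monom_mult)
    then show ?thesis using diff by (simp only: polys_over_def mem_Collect_eq)
  next
    case False
    then show ?thesis using deg submodule_zero[OF U] by (simp add: coeff_eq_0)
  qed
  then have "smult u G' \<in> polys_over U" by (simp add: polys_over_def)
  moreover have "[:u:] \<in> polys_over R"
    by (rule const_poly_in_polys_over[OF subring_add_subgroup[OF submodule_subring[OF U]] u])
  ultimately have "[:u:] * (monom u P - F * G') + F * smult u G' \<in> polys_over U"
    by (intro submodule_add[OF V] submodule_mult[OF V] closed FG')
  then have "monom (u * u) P \<in> polys_over U" by (simp add: algebra_simps smult_monom)
  then show ?thesis by (auto simp: polys_over_def dest: spec[of _ P])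
qed

section \<open>Linearly presented ideals and the minors of the Jacobian dual\<close>

lemma (in comm_ring_hom) eval_jac_dual:
  "eval_mpoly hom T (jac_dual r a j l) = (\<Sum>i<r. hom (lookup (a j i) (single l 1)) * T i)"
proof -
  interpret eval: comm_ring_hom "eval_mpoly hom T" by (rule comm_ring_hom_eval_mpoly)
  show ?thesis by (simp add: jac_dual_def hom_distribs)
qed

lemma (in comm_ring_hom) eval_jac_dual_row:
  assumes "\<And>i. i < r \<Longrightarrow> a j i \<in> forms n 1"
  shows "(\<Sum>l<n. eval_mpoly hom T (jac_dual r a j l) * y l) = (\<Sum>i<r. T i * eval_mpoly hom y (a j i))"
proof -
  interpret eval: comm_ring_hom "eval_mpoly hom y" by (rule comm_ring_hom_eval_mpoly)
  have "T i * eval_mpoly hom y (a j i) = (\<Sum>l<n. hom (lookup (a j i) (single l 1)) * T i * y l)"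
    if "i < r" for i
    by (subst linear_form_expand[OF assms[OF that]])
      (simp add: eval.hom_sum eval.hom_mult sum_distrib_left mult_ac)
  then have "(\<Sum>i<r. T i * eval_mpoly hom y (a j i))
      = (\<Sum>i<r. \<Sum>l<n. hom (lookup (a j i) (single l 1)) * T i * y l)" by simp
  also have "\<dots> = (\<Sum>l<n. eval_mpoly hom T (jac_dual r a j l) * y l)"
    by (subst sum.swap) (simp add: eval_jac_dual sum_distrib_right)
  finally show ?thesis ..
qed

lemma jac_dual_in_forms: "jac_dual r a j l \<in> forms r 1"
  unfolding jac_dual_def
proof (rule forms_sum)
  fix i assume "i \<in> {..<r}"
  then show "Const (lookup (a j i) (single l 1)) * Var i \<in> forms r 1"
    using forms_mult[OF forms_Const forms_Var, of i r] by simp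
qed

lemma in_ring_jac_dual: "in_ring r (jac_dual r a j l)"
  using jac_dual_in_forms[of r a j l] by (simp add: forms_def)

locale linearly_presented_ideal =
  fixes n r d N :: nat and f :: "nat \<Rightarrow> 'k::field mpoly" and a :: "nat \<Rightarrow> nat \<Rightarrow> 'k mpoly"
  assumes n_pos: "n \<ge> 1"
    and f_S: "\<forall>i<r. in_ring n (f i)"
    and f_deg: "\<forall>i<r. homog d (f i)"
    and lin_pres: "linearly_presented n r f"
    and m_primary: "primary_for n (max_ideal n) (gen_ideal n (f ` {..<r}))"
    and basis: "lin_syz_basis n r f N a"
begin

abbreviation I where "I \<equiv> gen_ideal n (f ` {..<r})"
abbreviation \<Theta> where "\<Theta> \<equiv> jac_dual r a"
abbreviation J where "J \<equiv> minors_ideal r N n \<Theta>"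

lemma one_notin_I: "1 \<notin> I"
  using m_primary by (simp add: primary_for_def)

lemma exists_Var_powers_in_I: "\<exists>P\<ge>d. \<forall>l<n. Var l ^ P \<in> I"
proof -
  have "\<exists>t. Var l ^ t \<in> I" if "l < n" for l
  proof -
    have "Var l \<in> max_ideal n" unfolding max_ideal_def by (rule gen_ideal_base) (use that in auto)
    then show ?thesis using m_primary by (auto simp: primary_for_def radical_def)
  qed
  then obtain t where t: "\<And>l. l < n \<Longrightarrow> Var l ^ t l \<in> I" by metis
  let ?P = "d + (\<Sum>l<n. t l)"
  have "Var l ^ ?P \<in> I" if l: "l < n" for l
  proof -
    have "t l \<le> (\<Sum>l<n. t l)" by (rule member_le_sum) (use l in auto)
    then have "Var l ^ ?P = Var l ^ (?P - t l) * (Var l ^ t l :: 'k mpoly)"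
      by (simp flip: power_add)
    also have "\<dots> \<in> I" by (rule submodule_mult[OF is_submodule_gen_ideal]) (use t l in auto)
    finally show ?thesis .
  qed
  then show ?thesis by (intro exI[of _ ?P]) auto
qed

lemma exists_variable_powers: "\<exists>P g. variable_powers n r d P f g"
proof -
  obtain P where P: "P \<ge> d" "\<And>l. l < n \<Longrightarrow> Var l ^ P \<in> I" using exists_Var_powers_in_I by blast
  have f: "f b \<in> forms n d" if "b < r" for b using f_S f_deg that by (simp add: forms_def)
  have "\<exists>v. v \<in> tuples r (forms n (P - d)) \<and> Var l ^ P = (\<Sum>b<r. v b * f b)" if "l < n" for l
  proof -
    have "Var l ^ P \<in> I \<inter> forms n (P - d + d)"
      using P that homog_power[OF homog_Var[of l], of P] by (simp add: forms_def)
    then show ?thesis using gen_ideal_Int_forms[of r f n d "P - d"] f by auto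
  qed
  then obtain g where "\<And>l. l < n \<Longrightarrow> g l \<in> tuples r (forms n (P - d))"
      "\<And>l. l < n \<Longrightarrow> Var l ^ P = (\<Sum>b<r. g l b * f b)" by metis
  then have "variable_powers n r d P f g" by unfold_locales (use f P in \<open>auto simp: tuples_def\<close>)
  then show ?thesis by blast
qed

lemma syzygy_expansion:
  assumes "s \<in> syz n r f"
  obtains e where "\<And>j. in_ring n (e j)" "\<And>i. s i = (\<Sum>j<N. e j * a j i)"
proof -
  obtain F c where F: "finite F" "F \<subseteq> lin_syz n r f" "\<forall>\<alpha>\<in>F. in_ring n (c \<alpha>)"
      and s: "s = (\<lambda>i. \<Sum>\<alpha>\<in>F. c \<alpha> * \<alpha> i)"
    using lin_pres[unfolded linearly_presented_def, THEN bspec, OF assms]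
    by (elim exE conjE) (rule that)
  have "\<forall>\<alpha>\<in>F. \<exists>x::nat \<Rightarrow> 'k. \<alpha> = (\<lambda>i. \<Sum>j<N. Const (x j) * a j i)"
    using basis[unfolded lin_syz_basis_def, THEN conjunct2, THEN conjunct2] F(2) by (meson subsetD)
  then have "\<exists>x. \<forall>\<alpha>\<in>F. \<alpha> = (\<lambda>i. \<Sum>j<N. Const (x \<alpha> j) * a j i)" by (rule bchoice)
  then obtain x where x: "\<forall>\<alpha>\<in>F. \<alpha> = (\<lambda>i. \<Sum>j<N. Const (x \<alpha> j) * a j i)" by (elim exE) (rule that)
  show ?thesis
  proof (rule that[of "\<lambda>j. \<Sum>\<alpha>\<in>F. c \<alpha> * Const (x \<alpha> j)"])
    fix i
    have "s i = (\<Sum>\<alpha>\<in>F. c \<alpha> * (\<Sum>j<N. Const (x \<alpha> j) * a j i))"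
      unfolding s by (rule sum.cong[OF refl], subst (2) bspec[OF x]) auto
    also have "\<dots> = (\<Sum>j<N. \<Sum>\<alpha>\<in>F. c \<alpha> * Const (x \<alpha> j) * a j i)"
      unfolding sum_distrib_left by (subst sum.swap) (simp add: mult.assoc)
    finally show "s i = (\<Sum>j<N. (\<Sum>\<alpha>\<in>F. c \<alpha> * Const (x \<alpha> j)) * a j i)"
      by (simp add: sum_distrib_right)
  qed (use F(3) in auto)
qed

lemma a_in_lin_syz: "j < N \<Longrightarrow> a j \<in> lin_syz n r f"
  using basis[unfolded lin_syz_basis_def, THEN conjunct1] by blast

lemma a_in_forms: "j < N \<Longrightarrow> i < r \<Longrightarrow> a j i \<in> forms n 1"
  using a_in_lin_syz[of j] by (simp add: lin_syz_def syz_def forms_def)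

lemma a_syzygy: "j < N \<Longrightarrow> (\<Sum>i<r. a j i * f i) = 0"
  using a_in_lin_syz[of j] by (simp add: lin_syz_def syz_def)

lemma jac_dual_row_subst_f:
  assumes "j < N"
  shows "(\<Sum>l<n. subst f (\<Theta> j l) * Var l) = 0"
proof -
  have "(\<Sum>l<n. subst f (\<Theta> j l) * Var l) = (\<Sum>i<r. f i * subst Var (a j i))"
    unfolding subst_eq_eval_mpoly by (rule Const.eval_jac_dual_row) (rule a_in_forms[OF assms])
  then show ?thesis using a_syzygy[OF assms] by (simp add: subst_Var_id mult.commute)
qed

text \<open>The Koszul syzygies are combinations of linear ones, so that \<open>\<Theta>(T) y \<equiv> 0\<close> forces the vector
  \<open>f(y)\<close> to be proportional to \<open>T\<close>.\<close>
lemma eval_f_proportional: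
  fixes h :: "'k \<Rightarrow> 'r::comm_ring_1"
  assumes h: "comm_ring_hom h" "\<And>c. h c \<in> R" and U: "is_submodule R U" and y: "\<And>l. l < n \<Longrightarrow> y l \<in> R"
    and rows: "\<And>j. j < N \<Longrightarrow> (\<Sum>l<n. eval_mpoly h T (\<Theta> j l) * y l) \<in> U" and b: "b < r" "b' < r"
  shows "T b * eval_mpoly h y (f b') - T b' * eval_mpoly h y (f b) \<in> U"
proof (cases "b = b'")
  case True
  then show ?thesis using submodule_zero[OF U] by simp
next
  case False
  interpret h: comm_ring_hom h by fact
  interpret eval: comm_ring_hom "eval_mpoly h y" by (rule h.comm_ring_hom_eval_mpoly)
  let ?s = "\<lambda>i. (if i = b then f b' else 0) - (if i = b' then f b else 0)"
  have "(\<Sum>i<r. ?s i * f i) = f b' * f b - f b * f b'"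
    using b by (simp add: left_diff_distrib sum_subtractf if_distrib[of "\<lambda>x. x * _"] cong: if_cong)
  then have "?s \<in> syz n r f" using b f_S by (auto simp: syz_def mult.commute)
  then obtain e where e: "\<And>j. in_ring n (e j)" "\<And>i. ?s i = (\<Sum>j<N. e j * a j i)"
    by (rule syzygy_expansion) (rule that)
  have "T b * eval_mpoly h y (f b') - T b' * eval_mpoly h y (f b)
      = (\<Sum>i<r. T i * eval_mpoly h y (?s i))"
    using b by (simp add: eval.hom_minus right_diff_distrib sum_subtractf
        if_distrib[of "\<lambda>x. _ * eval_mpoly h y x"] cong: if_cong)
  also have "\<dots> = (\<Sum>i<r. \<Sum>j<N. eval_mpoly h y (e j) * (T i * eval_mpoly h y (a j i)))"
    by (simp only: e(2)) (simp add: eval.hom_sum eval.hom_mult sum_distrib_left mult_ac)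
  also have "\<dots> = (\<Sum>j<N. eval_mpoly h y (e j) * (\<Sum>i<r. T i * eval_mpoly h y (a j i)))"
    by (subst sum.swap) (simp add: sum_distrib_left)
  also have "\<dots> = (\<Sum>j<N. eval_mpoly h y (e j) * (\<Sum>l<n. eval_mpoly h T (\<Theta> j l) * y l))"
    by (intro sum.cong refl arg_cong2[where f="(*)"] h.eval_jac_dual_row[symmetric] a_in_forms) auto
  also have "\<dots> \<in> U"
    by (intro submodule_sum[OF U] submodule_mult[OF U] rows
        h.eval_mpoly_closed[OF submodule_subring[OF U] h(2) e(1) y]) auto
  finally show ?thesis .
qed

end

locale linearly_presented_ideal_powers =
  linearly_presented_ideal n r d N f a + variable_powers n r d P f g
  for n r d N :: nat and f :: "nat \<Rightarrow> 'k::field mpoly" and a P g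
begin

lemma exists_f_nonzero: "\<exists>b<r. f b \<noteq> 0"
proof (rule ccontr)
  assume "\<not> (\<exists>b<r. f b \<noteq> 0)"
  then have "Var 0 ^ P = (0 :: 'k mpoly)" using Var_power_eq[of 0] n_pos by simp
  then show False by simp
qed

lemma d_pos: "d \<ge> 1"
proof (rule ccontr)
  assume "\<not> d \<ge> 1"
  then have "d = 0" by simp
  obtain b where b: "b < r" "f b \<noteq> 0" using exists_f_nonzero by blast
  let ?c = "lookup (f b) 0"
  have "f b = Const ?c" using f_deg b(1) \<open>d = 0\<close> by (intro homog_0_eq_Const) simp
  moreover from this have "?c \<noteq> 0" using b(2) by auto
  ultimately have "1 = Const (inverse ?c) * f b"
    by (metis Const.hom_mult Const.hom_one left_inverse)
  moreover have "Const (inverse ?c) * f b \<in> I"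
    by (intro submodule_mult[OF is_submodule_gen_ideal] gen_ideal_base) (use b in auto)
  ultimately show False using one_notin_I by simp
qed

lemma P_pos: "P \<ge> 1"
  using d_pos d_le_N by linarith

lemma Var_power_proportional:
  fixes h :: "'k \<Rightarrow> 'r::comm_ring_1"
  assumes h: "comm_ring_hom h" "\<And>c. h c \<in> R" and U: "is_submodule R U" and y: "\<And>l. l < n \<Longrightarrow> y l \<in> R"
    and rows: "\<And>j. j < N \<Longrightarrow> (\<Sum>l<n. eval_mpoly h T (\<Theta> j l) * y l) \<in> U" and m: "m < n" and b: "b < r"
  shows "T b * y m ^ P - eval_mpoly h y (f b) * (\<Sum>b'<r. eval_mpoly h y (g m b') * T b') \<in> U"
proof -
  interpret h: comm_ring_hom h by fact
  interpret eval: comm_ring_hom "eval_mpoly h y" by (rule h.comm_ring_hom_eval_mpoly)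
  have "y m ^ P = eval_mpoly h y (Var m ^ P)" by (simp add: eval.hom_power)
  also have "\<dots> = (\<Sum>b'<r. eval_mpoly h y (g m b') * eval_mpoly h y (f b'))"
    by (simp add: Var_power_eq[OF m] eval.hom_sum eval.hom_mult)
  finally have "T b * y m ^ P - eval_mpoly h y (f b) * (\<Sum>b'<r. eval_mpoly h y (g m b') * T b')
      = (\<Sum>b'<r. eval_mpoly h y (g m b') *
          (T b * eval_mpoly h y (f b') - T b' * eval_mpoly h y (f b)))"
    by (simp add: sum_distrib_left algebra_simps sum_subtractf)
  also have "\<dots> \<in> U"
  proof (intro submodule_sum[OF U] submodule_mult[OF U])
    fix b' assume b': "b' \<in> {..<r}"
    then have "in_ring n (g m b')" using g_forms[OF m] by (simp add: forms_def)
    then show "eval_mpoly h y (g m b') \<in> R"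
      by (rule h.eval_mpoly_closed[OF submodule_subring[OF U] h(2) _ y])
    show "T b * eval_mpoly h y (f b') - T b' * eval_mpoly h y (f b) \<in> U"
      by (rule eval_f_proportional[where h=h and R=R and y=y and T=T, OF h U y rows])
        (use b b' in auto)
  qed
  finally show ?thesis .
qed

lemma exists_two_missing_indices:
  assumes "Suc c < n"
  obtains l l' where "l < n" "l' < n" "l \<noteq> l'" "l \<notin> \<sigma> ` {..<c}" "l' \<notin> \<sigma> ` {..<c}"
proof -
  have "card (\<sigma> ` {..<c}) \<le> c" using card_image_le[of "{..<c}" \<sigma>] by simp
  then have "card ({..<n} - \<sigma> ` {..<c}) \<ge> 2"
    using diff_card_le_card_Diff[of "\<sigma> ` {..<c}" "{..<n}"] assms by simp
  then show ?thesis using that by (auto simp: card_le_Suc_iff numeral_2_eq_2)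
qed

context
  fixes U :: "'k mpoly set" and v w :: "nat \<Rightarrow> 'k mpoly"
  assumes U: "is_submodule (poly_ring r) U"
    and in_ring_vw: "\<And>m. in_ring r (v m)" "\<And>m. in_ring r (w m)"
    and \<Theta>_vw: "\<And>j. j < N \<Longrightarrow> (\<Sum>m<n. \<Theta> j m * v m) \<in> U" "\<And>j. j < N \<Longrightarrow> (\<Sum>m<n. \<Theta> j m * w m) \<in> U"
begin

abbreviation (input) const_poly :: "'k \<Rightarrow> 'k mpoly poly" where
  "const_poly \<equiv> \<lambda>c. [:Const c:]"

abbreviation (input) line :: "nat \<Rightarrow> 'k mpoly poly" where
  "line \<equiv> \<lambda>m. [:v m, w m:]"

abbreviation (input) Var_poly :: "nat \<Rightarrow> 'k mpoly poly" where
  "Var_poly \<equiv> \<lambda>i. [:Var i:]"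

abbreviation (input) power_factor :: "nat \<Rightarrow> 'k mpoly poly" where
  "power_factor \<equiv> \<lambda>m. \<Sum>b<r. eval_mpoly const_poly line (g m b) * Var_poly b"

interpretation const_poly: comm_ring_hom const_poly
  by unfold_locales (auto simp: Const.hom_add Const.hom_mult one_pCons)

lemmas is_subring_polys = is_subring_polys_over[OF is_subring_poly_ring]
  and const_poly_in_polys = const_poly_in_polys_over[OF is_add_subgroup_poly_ring]

lemma line_in_polys_over: "line m \<in> polys_over (poly_ring r)"
  by (intro pCons_in_polys_over const_poly_in_polys) (simp_all add: in_ring_vw)

lemma eval_line_in_polys_over: "in_ring n q \<Longrightarrow>
    eval_mpoly const_poly line q \<in> polys_over (poly_ring r)"
  by (rule const_poly.eval_mpoly_closed[OF is_subring_polys const_poly_in_polys _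
      line_in_polys_over]) simp

lemma power_factor_in_polys_over: "m < n \<Longrightarrow> power_factor m \<in> polys_over (poly_ring r)"
  using g_forms[of m]
  by (intro add_subgroup_sum[OF subring_add_subgroup[OF is_subring_polys]]
      subring_mult[OF is_subring_polys]
      eval_line_in_polys_over const_poly_in_polys) (auto simp: forms_def)

lemma degree_power_factor_less:
  assumes "m < n"
  shows "degree (power_factor m) < P"
proof -
  have "degree (power_factor m) \<le> P - d"
  proof (rule degree_sum_le)
    fix b assume "b \<in> {..<r}"
    then have "degree (eval_mpoly const_poly line (g m b)) \<le> P - d"
      by (intro degree_eval_mpoly_le) (use g_forms[OF assms] in \<open>auto simp: forms_def\<close>)
    then show "degree (eval_mpoly const_poly line (g m b) * Var_poly b) \<le> P - d"
      using degree_mult_le[of "eval_mpoly const_poly line (g m b)" "Var_poly b"] by simp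
  qed simp
  then show ?thesis using d_pos d_le_N by linarith
qed

lemma jac_dual_line:
  assumes "j < N"
  shows "(\<Sum>m<n. eval_mpoly const_poly Var_poly (\<Theta> j m) * line m) \<in> polys_over U"
proof -
  have "comm_ring_hom (\<lambda>q :: 'k mpoly. [:q:])" by unfold_locales (auto simp: one_pCons)
  then have "eval_mpoly const_poly Var_poly q = [:q:]" for q
    using comm_ring_hom.hom_eval_mpoly[of "\<lambda>q. [:q:]" Const Var q]
    by (simp add: subst_Var_id flip: subst_eq_eval_mpoly)
  then have "(\<Sum>m<n. eval_mpoly const_poly Var_poly (\<Theta> j m) * line m)
      = (\<Sum>m<n. [:\<Theta> j m * v m, \<Theta> j m * w m:])"
    by (simp add: mult.commute)
  also have "\<dots> = [:\<Sum>m<n. \<Theta> j m * v m, \<Sum>m<n. \<Theta> j m * w m:]"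
    by (rule poly_eqI) (auto simp: coeff_sum coeff_pCons split: nat.splits)
  also have "\<dots> \<in> polys_over U"
    by (intro pCons_in_polys_over const_poly_in_polys_over submodule_add_subgroup[OF U] \<Theta>_vw assms)
  finally show ?thesis .
qed

lemma line_power_proportional:
  assumes "m < n" "b < r"
  shows "Var_poly b * line m ^ P - eval_mpoly const_poly line (f b) * power_factor m \<in> polys_over U"
  by (rule Var_power_proportional[OF const_poly.comm_ring_hom_axioms const_poly_in_polys
        is_submodule_polys_over[OF U] line_in_polys_over jac_dual_line assms]) simp

text \<open>All \<open>f b\<close> are proportional along the line \<open>v + X w\<close>; but powers of the two coprime linear forms
  \<open>line l = \<delta>\<close> and \<open>line l' = X \<delta>\<close> are combinations of the \<open>f b\<close>.\<close>
lemma two_solutions_square: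
  assumes l: "l < n" "v l = \<delta>" "w l = 0" and l': "l' < n" "v l' = 0" "w l' = \<delta>" and b: "b < r"
  shows "(Var b * \<delta> ^ P) * (Var b * \<delta> ^ P) \<in> U"
proof -
  let ?u = "Var b * \<delta> ^ P" and ?F = "eval_mpoly const_poly line (f b)"
  have "Var_poly b * line l ^ P = [:?u:]" by (simp add: l poly_const_pow)
  with line_power_proportional[OF l(1) b] have at_l: "[:?u:] - ?F * power_factor l \<in> polys_over U"
    by (simp only:)
  have "line l' = monom \<delta> 1" by (simp add: l' monom_altdef)
  then have "Var_poly b * line l' ^ P = monom ?u P" by (simp add: monom_power smult_monom)
  with line_power_proportional[OF l'(1) b] have at_l': "monom ?u P - ?F * power_factor l'
      \<in> polys_over U"
    by (simp only:)
  have "?u \<in> poly_ring r" using b in_ring_vw(1)[of l] by (simp add: l)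
  moreover have "?F \<in> polys_over (poly_ring r)"
    by (rule eval_line_in_polys_over) (use f_S b in simp)
  ultimately show ?thesis
    by (rule square_in_submodule[OF U _ _ power_factor_in_polys_over[OF l(1)]
          power_factor_in_polys_over[OF l'(1)] degree_power_factor_less[OF l'(1)] at_l at_l'])
qed

end

abbreviation minors :: "nat \<Rightarrow> 'k mpoly set" where
  "minors c \<equiv> all_minors_ideal r N n c \<Theta>"

lemma Var_times_minor_power_square:
  assumes Suc_c: "Suc c < n" and \<rho>: "\<And>i. i < c \<Longrightarrow> \<rho> i < N" and \<sigma>: "\<And>k. k < c \<Longrightarrow> \<sigma> k < n" and b: "b < r"
  defines "\<delta> \<equiv> det_n c (\<lambda>i k. \<Theta> (\<rho> i) (\<sigma> k))"
  shows "(Var b * \<delta> ^ P) * (Var b * \<delta> ^ P) \<in> minors (Suc c)"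
proof -
  obtain l l' where l: "l < n" "l \<notin> \<sigma> ` {..<c}" and l': "l' < n" "l' \<notin> \<sigma> ` {..<c}" and "l \<noteq> l'"
    using exists_two_missing_indices[OF Suc_c] by metis
  have image: "(\<sigma>(c := m)) ` {..c} = insert m (\<sigma> ` {..<c})" for m by (auto simp: le_less image_iff)
  show ?thesis
  proof (rule two_solutions_square[OF is_submodule_all_minors_ideal])
    let ?v = "\<lambda>l. signed_minor c \<Theta> \<rho> (\<sigma>(c := l))"
    show "in_ring r (?v l m)" "in_ring r (?v l' m)" for m
      by (intro in_ring_signed_minor in_ring_jac_dual)+
    have "(\<Sum>m<n. \<Theta> j m * ?v l m) \<in> minors (Suc c)" if "j < N" "l < n" for j l
      by (rule row_times_signed_minor) (use \<rho> \<sigma> that in auto)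
    then show "(\<Sum>m<n. \<Theta> j m * ?v l m) \<in> minors (Suc c)" "(\<Sum>m<n. \<Theta> j m * ?v l' m) \<in> minors (Suc c)"
      if "j < N" for j using l(1) l'(1) that by auto
    show "?v l l = \<delta>" "?v l' l' = \<delta>" unfolding \<delta>_def by (rule signed_minor_upd_eq, fact)+
    show "?v l l' = 0" "?v l' l = 0"
      using l l' \<open>l \<noteq> l'\<close> by (intro signed_minor_eq_0; simp only: image; simp)+
  qed (fact l l' b)+
qed

lemma Var_in_radical_minors: "c < n \<Longrightarrow> b < r \<Longrightarrow> Var b \<in> radical r (minors c)"
proof (induction c)
  case 0
  have "1 \<in> minors 0" using minor_in_all_minors_ideal[of 0] by (simp add: det_n_def)
  then show ?case unfolding radical_def using 0 by (auto intro!: exI[of _ 0])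
next
  case (Suc c)
  let ?R = "radical r (minors (Suc c))"
  have R: "is_submodule (poly_ring r) ?R"
    by (rule is_submodule_radical[OF is_submodule_all_minors_ideal])
  have "minors c \<subseteq> {q \<in> poly_ring r. q * Var b \<in> ?R}"
  proof (rule all_minors_ideal_subset)
    show "is_submodule (poly_ring r) {q \<in> poly_ring r. q * Var b \<in> ?R}"
      by (rule submodule_colon[OF R]) (simp add: Suc.prems)
    fix \<rho> \<sigma> :: "nat \<Rightarrow> nat" assume "\<And>i. i < c \<Longrightarrow> \<rho> i < N" "\<And>k. k < c \<Longrightarrow> \<sigma> k < n"
    note square = Var_times_minor_power_square[OF Suc.prems(1) this Suc.prems(2)]
    let ?\<delta> = "det_n c (\<lambda>i k. \<Theta> (\<rho> i) (\<sigma> k))"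
    have ring: "in_ring r ?\<delta>" by (intro in_ring_det_n in_ring_jac_dual)
    have "P + P = (P + P - 2) + 2" using P_pos by simp
    then have "Var b ^ (P + P) = Var b ^ (P + P - 2) * (Var b * Var b :: 'k mpoly)"
      by (metis power2_eq_square power_add)
    then have "(?\<delta> * Var b) ^ (P + P) = Var b ^ (P + P - 2) * ((Var b * ?\<delta> ^ P) * (Var b * ?\<delta> ^ P))"
      by (simp add: power_mult_distrib power_add mult_ac)
    also have "\<dots> \<in> minors (Suc c)"
      by (rule submodule_mult[OF is_submodule_all_minors_ideal _ square]) (simp_all add: Suc.prems)
    finally show "?\<delta> \<in> {q \<in> poly_ring r. q * Var b \<in> ?R}"
      unfolding radical_def using ring Suc.prems by auto
  qed
  moreover obtain t where "Var b ^ t \<in> minors c" using Suc by (auto simp: radical_def)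
  ultimately have "Var b ^ Suc t \<in> ?R" by (auto simp: mult.commute)
  then show ?case by (rule radical_powerD) (use Suc.prems in simp)
qed

lemma coordinate_in_radical:
  assumes U: "is_submodule (poly_ring r) U" and v: "\<And>m. in_ring r (v m)"
    and F: "\<And>b. b < r \<Longrightarrow> subst v (f b) \<in> radical r U" and l: "l < n"
  shows "v l \<in> radical r U"
proof -
  note R = is_submodule_radical[OF U]
  have "v l ^ P = subst v (Var l ^ P)" by (simp add: subst.hom_power)
  also have "\<dots> = (\<Sum>b<r. subst v (g l b) * subst v (f b))"
    by (simp add: Var_power_eq[OF l] hom_distribs)
  also have "\<dots> \<in> radical r U"
  proof (intro submodule_sum[OF R] submodule_mult[OF R])
    fix b assume b: "b \<in> {..<r}"
    then have "in_ring n (g l b)" using g_forms[OF l] by (simp add: forms_def)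
    then show "subst v (g l b) \<in> poly_ring r" using in_ring_subst[OF _ v] by simp
    show "subst v (f b) \<in> radical r U" by (rule F) (use b in simp)
  qed
  finally show ?thesis by (rule radical_powerD) (rule v)
qed

lemma Var_in_radicalI:
  assumes U: "is_submodule (poly_ring r) U"
    and F: "\<And>b \<rho> \<tau>. b < r \<Longrightarrow> \<forall>i<n - 1. \<rho> i < N \<Longrightarrow> bij_betw \<tau> {..<n} {..<n} \<Longrightarrow>
      subst (signed_minor (n - 1) \<Theta> \<rho> \<tau>) (f b) \<in> radical r U"
    and b: "b < r"
  shows "Var b \<in> radical r U"
proof -
  have n_eq: "Suc (n - 1) = n" using n_pos by simp
  have "minors (n - 1) \<subseteq> radical r U"
  proof (rule all_minors_ideal_subset[OF is_submodule_radical[OF U]])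
    fix \<rho> \<sigma> :: "nat \<Rightarrow> nat"
    assume \<rho>: "\<And>i. i < n - 1 \<Longrightarrow> \<rho> i < N" and \<sigma>: "\<And>k. k < n - 1 \<Longrightarrow> \<sigma> k < n" "inj_on \<sigma> {..<n - 1}"
    obtain l where l: "l < n" "l \<notin> \<sigma> ` {..<n - 1}" "bij_betw (\<sigma>(n - 1 := l)) {..<n} {..<n}"
      using exists_bij_extension[OF \<sigma>(2), unfolded n_eq, OF \<sigma>(1)] by blast
    let ?v = "signed_minor (n - 1) \<Theta> \<rho> (\<sigma>(n - 1 := l))"
    have "?v l \<in> radical r U"
    proof (rule coordinate_in_radical[OF U, where v="?v"])
      show "in_ring r (?v m)" for m by (intro in_ring_signed_minor in_ring_jac_dual)
      show "subst ?v (f b) \<in> radical r U" if "b < r" for b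
        by (rule F[OF that _ l(3)]) (use \<rho> in blast)
    qed (fact l(1))
    then show "det_n (n - 1) (\<lambda>i k. \<Theta> (\<rho> i) (\<sigma> k)) \<in> radical r U"
      by (simp only: signed_minor_upd_eq[OF l(2)])
  qed
  moreover obtain t where "Var b ^ t \<in> minors (n - 1)"
    using Var_in_radical_minors[of "n - 1" b] n_pos b by (auto simp: radical_def)
  ultimately have "Var b ^ t \<in> radical r U" by blast
  then show ?thesis by (rule radical_powerD) (simp add: b)
qed

end

section \<open>Torsion of the defining ideal and of the Veronese subring\<close>

context linearly_presented_ideal_powers
begin

lemma is_submodule_J: "is_submodule (poly_ring r) J"
  unfolding minors_ideal_def by (rule is_submodule_gen_ideal)

lemma is_submodule_IW: "is_submodule (poly_ring r) (IW r f)"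
  by (rule is_submoduleI[OF is_subring_poly_ring]) (auto simp: IW_def hom_distribs)

lemma J_subset_IW: "J \<subseteq> IW r f"
  unfolding minors_ideal_def
proof (rule gen_ideal_least[OF is_submodule_IW], safe)
  fix \<rho> assume \<rho>: "inj_on \<rho> {..<n}" "\<rho> ` {..<n} \<subseteq> {..<N}"
  have "det_n n (\<lambda>i l. subst f (\<Theta> (\<rho> i) l)) = 0"
    by (rule det_n_singular[of _ _ Var 0]) (use \<rho> n_pos jac_dual_row_subst_f in auto)
  then show "det_n n (\<lambda>i l. \<Theta> (\<rho> i) l) \<in> IW r f"
    by (auto simp: IW_def subst_det_n intro!: in_ring_det_n in_ring_jac_dual)
qed

lemma maximal_minors_proportional:
  assumes \<rho>: "\<forall>i<n - 1. \<rho> i < N" and \<tau>: "bij_betw \<tau> {..<n} {..<n}" and b: "b < r" "b' < r"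
  shows "Var b * subst (signed_minor (n - 1) \<Theta> \<rho> \<tau>) (f b')
    - Var b' * subst (signed_minor (n - 1) \<Theta> \<rho> \<tau>) (f b) \<in> J"
proof -
  let ?v = "signed_minor (n - 1) \<Theta> \<rho> \<tau>"
  have v: "in_ring r (?v l)" for l by (intro in_ring_signed_minor in_ring_jac_dual)
  have \<tau>_less: "\<tau> k < n" if "k \<le> n - 1" for k using bij_betwE[OF \<tau>] that n_pos by auto
  have "(\<Sum>l<n. \<Theta> j l * ?v l) \<in> J" if "j < N" for j
    using row_times_signed_minor[of "n - 1" \<tau> n \<rho> N j \<Theta> r] \<tau>_less \<rho> that n_pos
    by (simp add: all_minors_ideal_maximal)
  then show ?thesis
    using eval_f_proportional[where h=Const and R="poly_ring r" and T=Var and y="?v",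
        OF Const.comm_ring_hom_axioms _ is_submodule_J _ _ b] v
    by (simp add: subst_Var_id flip: subst_eq_eval_mpoly)
qed

lemma Var_power_mult_in_J:
  assumes p: "p \<in> IW r f" "p \<in> forms r e" and b: "b < r"
  shows "\<exists>D. Var b ^ D * p \<in> J"
proof -
  let ?U = "{q \<in> poly_ring r. q * p \<in> J}"
  have "in_ring r p" using p by (simp add: forms_def)
  then have U: "is_submodule (poly_ring r) ?U" by (intro submodule_colon is_submodule_J) simp
  have "Var b \<in> radical r ?U"
  proof (rule Var_in_radicalI[OF U _ b])
    fix b \<rho> \<tau>
    assume b: "b < r" and \<rho>: "\<forall>i<n - 1. \<rho> i < N" and \<tau>: "bij_betw \<tau> {..<n} {..<n}"
    let ?v = "signed_minor (n - 1) \<Theta> \<rho> \<tau>"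
    let ?F = "\<lambda>i. subst ?v (f i)"
    have F: "in_ring r (?F i)" if "i < r" for i
      by (rule in_ring_subst[of n])
        (use f_S that in \<open>auto intro: in_ring_signed_minor in_ring_jac_dual\<close>)
    have "subst (\<lambda>i. ?F b * Var i) p - subst (\<lambda>i. Var b * ?F i) p \<in> J"
      by (rule subst_diff_in_submodule[OF is_submodule_J \<open>in_ring r p\<close>])
        (use maximal_minors_proportional[OF \<rho> \<tau> _ b] F b in \<open>simp add: mult.commute\<close>)
    moreover have "subst (\<lambda>i. ?F b * Var i) p = ?F b ^ e * p"
      using subst_scale[of e p "?F b" Var] p(2) by (simp add: forms_def subst_Var_id)
    moreover have "subst (\<lambda>i. Var b * ?F i) p = 0"
      using subst_scale[of e p "Var b" ?F] subst_subst[of ?v f p] p by (simp add: forms_def IW_def)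
    ultimately have "?F b ^ e * p \<in> J" by simp
    then show "?F b \<in> radical r ?U" using F[OF b] by (auto simp: radical_def)
  qed
  then show ?thesis by (auto simp: radical_def)
qed

lemma maximal_minors_subst_f_proportional:
  assumes \<rho>: "\<forall>i<n - 1. \<rho> i < N" and \<tau>: "bij_betw \<tau> {..<n} {..<n}" and l: "l < n" "l' < n"
  shows "Var l' * subst f (signed_minor (n - 1) \<Theta> \<rho> \<tau> l)
      = subst f (signed_minor (n - 1) \<Theta> \<rho> \<tau> l') * Var l"
proof -
  have n_eq: "Suc (n - 1) = n" using n_pos by simp
  let ?T = "\<lambda>j l. subst f (\<Theta> j l)" and ?v = "\<lambda>l. subst f (signed_minor (n - 1) \<Theta> \<rho> \<tau> l)"
  let ?x = "\<lambda>m. (if m = l then Var l' else 0) - (if m = l' then Var l else 0) :: 'k mpoly"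
  have x_sum: "(\<Sum>m<n. ?x m * w m) = Var l' * w l - Var l * w l'" for w
    using l by (simp add: left_diff_distrib sum_subtractf if_distrib[of "\<lambda>x. x * _"] cong: if_cong)
  have reindex: "(\<Sum>k<n. w (\<tau> k) * Var (\<tau> k)) = (\<Sum>m<n. w m * Var m)" for w :: "nat \<Rightarrow> 'k mpoly"
    by (rule sum.reindex_bij_betw[OF \<tau>])
  have "\<tau> k < n" if "k \<le> n - 1" for k using bij_betwE[OF \<tau>] that n_pos by auto
  then have "(\<Sum>m<n. ?x m * ?v m) = det_n n (\<lambda>i k. if i = n - 1 then ?x (\<tau> k) else ?T (\<rho> i) (\<tau> k))"
    using signed_minor_sum[of "n - 1" \<tau> n ?x ?T \<rho>] unfolding n_eq subst_signed_minor by simp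
  also have "\<dots> = 0"
  proof (rule det_n_singular[of _ _ "\<lambda>k. Var (\<tau> k)" 0])
    fix i assume i: "i < n"
    show "(\<Sum>k<n. (if i = n - 1 then ?x (\<tau> k) else ?T (\<rho> i) (\<tau> k)) * Var (\<tau> k)) = 0"
    proof (cases "i = n - 1")
      case True
      have "(\<Sum>k<n. ?x (\<tau> k) * Var (\<tau> k)) = Var l' * Var l - Var l * Var l'"
        unfolding reindex[of ?x] x_sum ..
      then show ?thesis using True by (simp add: mult.commute)
    next
      case False
      then show ?thesis using reindex[of "?T (\<rho> i)"] jac_dual_row_subst_f[of "\<rho> i"] \<rho> i by simp
    qed
  qed (use n_pos in auto)
  finally show ?thesis unfolding x_sum by (simp add: mult.commute)
qed

lemma maximal_minors_subst_forms:
  assumes \<rho>: "\<forall>i<n - 1. \<rho> i < N" and \<tau>: "bij_betw \<tau> {..<n} {..<n}" and q: "q \<in> forms n e"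
  defines "v \<equiv> \<lambda>l. subst f (signed_minor (n - 1) \<Theta> \<rho> \<tau> l)"
  shows "Var 0 ^ e * subst v q = v 0 ^ e * q"
proof -
  have proportional: "Var 0 * v l = v 0 * Var l" if "l < n" for l
    unfolding v_def using maximal_minors_subst_f_proportional[OF \<rho> \<tau> that, of 0] n_pos by simp
  have "Var 0 ^ e * subst v q = subst (\<lambda>l. Var 0 * v l) q"
    using subst_scale[of e q "Var 0" v] q by (simp add: forms_def)
  also have "\<dots> = subst (\<lambda>l. v 0 * Var l) q"
    by (rule subst_cong[of n]) (use q proportional in \<open>auto simp: forms_def\<close>)
  also have "\<dots> = v 0 ^ e * q"
    using subst_scale[of e q "v 0" Var] q by (simp add: forms_def subst_Var_id)
  finally show ?thesis .
qed

abbreviation A where "A \<equiv> subst f ` poly_ring r"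

lemma is_subring_A: "is_subring A"
  by (rule subring_image[OF is_subring_poly_ring subst.comm_ring_hom_axioms])

lemma f_power_mult_in_A:
  assumes s: "s \<in> forms n (d * t)" and b: "b < r"
  shows "\<exists>D. f b ^ D * s \<in> A"
proof -
  let ?U = "{q \<in> poly_ring r. subst f q * s \<in> A}"
  note A_closed = add_subgroup_zero[OF subring_add_subgroup[OF is_subring_A]]
    add_subgroup_add[OF subring_add_subgroup[OF is_subring_A]] subring_mult[OF is_subring_A]
  have U: "is_submodule (poly_ring r) ?U"
    using A_closed by (intro is_submoduleI is_subring_poly_ring)
      (auto simp: subst.hom_add subst.hom_mult distrib_right mult.assoc)
  have "Var b \<in> radical r ?U"
  proof (rule Var_in_radicalI[OF U _ b])
    fix b \<rho> \<tau>
    assume b: "b < r" and \<rho>: "\<forall>i<n - 1. \<rho> i < N" and \<tau>: "bij_betw \<tau> {..<n} {..<n}"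
    let ?\<Delta> = "signed_minor (n - 1) \<Theta> \<rho> \<tau>"
    let ?v = "\<lambda>l. subst f (?\<Delta> l)" and ?F = "subst ?\<Delta> (f b)"
    have ring: "in_ring r (subst ?\<Delta> q)" if "in_ring n q" for q
      using that by (rule in_ring_subst) (intro in_ring_signed_minor in_ring_jac_dual)
    note scale = maximal_minors_subst_forms[OF \<rho> \<tau>]
    have "Var 0 ^ (d * t) * (subst ?v (f b) ^ t * s) = (Var 0 ^ d * subst ?v (f b)) ^ t * s"
      by (simp add: power_mult_distrib power_mult)
    also have "\<dots> = f b ^ t * (?v 0 ^ (d * t) * s)"
      unfolding scale[OF f_forms[OF b]] by (simp add: power_mult_distrib power_mult mult_ac)
    also have "\<dots> = Var 0 ^ (d * t) * (f b ^ t * subst ?v s)"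
      unfolding scale[OF s, symmetric] by (simp add: mult_ac)
    finally have "subst ?v (f b) ^ t * s = f b ^ t * subst ?v s" by simp
    then have "subst f (?F ^ t) * s = subst f (Var b ^ t * subst ?\<Delta> s)"
      by (simp add: subst_subst subst.hom_power subst.hom_mult)
    moreover have "in_ring r (Var b ^ t * subst ?\<Delta> s)" using b s ring by (simp add: forms_def)
    moreover have "in_ring r ?F" by (rule ring) (use f_S b in simp)
    ultimately show "?F \<in> radical r ?U" by (auto simp: radical_def intro!: exI[of _ t])
  qed
  then obtain D where "Var b ^ D \<in> ?U" by (auto simp: radical_def)
  then show ?thesis by (auto simp: subst.hom_power)
qed

lemma A_Int_forms: "A \<inter> forms n (d * t) \<subseteq> subst f ` forms r t"
proof
  fix x assume "x \<in> A \<inter> forms n (d * t)"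
  then obtain q where q: "in_ring r q" "x = subst f q" and x: "x \<in> forms n (d * t)" by auto
  have "x = hom_comp (d * t) x" using x hom_comp_homog[of "d * t" x] by (simp add: forms_def)
  also have "\<dots> = subst f (hom_comp t q)"
    unfolding q(2) by (rule hom_comp_subst[OF q(1) _ d_pos]) (use f_deg in auto)
  finally show "x \<in> subst f ` forms r t" using forms_hom_comp[OF q(1)] by blast
qed

lemma subst_f_forms: "subst f ` forms r t \<subseteq> forms n (d * t)"
  using f_S f_deg by (auto simp: forms_def intro: in_ring_subst homog_subst)

end

section \<open>Powers of the ideal and linear resolutions\<close>

lemma exists_socle_element:
  fixes X Y :: "'a::comm_monoid_mult set" and \<phi> :: "nat \<Rightarrow> 'a"
  assumes p: "p \<in> X" "p \<notin> Y"
    and X: "\<And>b p. b < r \<Longrightarrow> p \<in> X \<Longrightarrow> \<phi> b * p \<in> X"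
    and Y: "\<And>b p. b < r \<Longrightarrow> p \<in> Y \<Longrightarrow> \<phi> b * p \<in> Y"
    and torsion: "\<And>b p. b < r \<Longrightarrow> p \<in> X \<Longrightarrow> \<exists>D. \<phi> b ^ D * p \<in> Y"
  obtains q where "q \<in> X" "q \<notin> Y" "\<And>b. b < r \<Longrightarrow> \<phi> b * q \<in> Y"
proof -
  have "m \<le> r \<Longrightarrow> \<exists>q\<in>X. q \<notin> Y \<and> (\<forall>b<m. \<phi> b * q \<in> Y)" for m
  proof (induction m)
    case 0 then show ?case using p by blast
  next
    case (Suc m)
    then obtain q where q: "q \<in> X" "q \<notin> Y" "\<And>b. b < m \<Longrightarrow> \<phi> b * q \<in> Y" by auto
    have m: "m < r" using Suc by simp
    have power_X: "\<phi> m ^ k * x \<in> X" if "x \<in> X" for k x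
      by (induction k) (use that X[OF m] in \<open>auto simp: mult.assoc\<close>)
    have power_Y: "\<phi> m ^ k * x \<in> Y" if "x \<in> Y" for k x
      by (induction k) (use that Y[OF m] in \<open>auto simp: mult.assoc\<close>)
    define D where "D = (LEAST D. \<phi> m ^ D * q \<in> Y)"
    have D: "\<phi> m ^ D * q \<in> Y" unfolding D_def using torsion[OF m q(1)] by (rule LeastI_ex)
    then obtain E where E: "D = Suc E" using q(2) by (cases D) auto
    have "\<phi> m ^ E * q \<notin> Y"
      using not_less_Least[of E "\<lambda>D. \<phi> m ^ D * q \<in> Y"] E unfolding D_def by simp
    moreover have "\<phi> b * (\<phi> m ^ E * q) \<in> Y" if "b < Suc m" for b
    proof (cases "b = m")
      case True then show ?thesis using D E by (simp add: mult.assoc)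
    next
      case False
      then have "\<phi> m ^ E * (\<phi> b * q) \<in> Y" using q(3) that by (intro power_Y) simp
      then show ?thesis by (simp add: mult.left_commute)
    qed
    ultimately show ?case using power_X[OF q(1)] by blast
  qed
  from this[of r] show ?thesis using that by blast
qed

lemma ideal_pow_gen_ideal:
  assumes y: "\<And>i. i < r \<Longrightarrow> in_ring n (y i)"
  shows "ideal_pow n (gen_ideal n (y ` {..<r})) t = gen_ideal n (subst y ` forms r t)"
proof (induction t)
  case 0
  have "gen_ideal n {1} \<subseteq> gen_ideal n (subst y ` forms r 0)"
    by (rule gen_ideal_mono) (auto intro!: image_eqI[of _ _ 1] simp: forms_def)
  moreover have "q \<in> gen_ideal n {1}" if "in_ring n q" for q :: "'a mpoly"
    using submodule_mult[OF is_submodule_gen_ideal, of q n 1 "{1}"] that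
    by (simp add: gen_ideal_base)
  then have "gen_ideal n (subst y ` forms r 0) \<subseteq> gen_ideal n {1}"
    using y by (intro gen_ideal_least is_submodule_gen_ideal) (auto simp: forms_def in_ring_subst)
  ultimately show ?case by simp
next
  case (Suc t)
  let ?G = "{g * h | g h. g \<in> subst y ` forms r t \<and> h \<in> y ` {..<r}}"
  have "?G \<subseteq> subst y ` forms r (Suc t)"
  proof safe
    fix q :: "'a mpoly" and i assume "q \<in> forms r t" "i < r"
    then show "subst y q * y i \<in> subst y ` forms r (Suc t)"
      by (intro image_eqI[of _ _ "Var i * q"])
        (auto simp: forms_Var_mult subst.hom_mult mult.commute[of "subst y q"])
  qed
  then have "gen_ideal n ?G \<subseteq> gen_ideal n (subst y ` forms r (Suc t))" by (rule gen_ideal_mono)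
  moreover have "subst y p \<in> gen_ideal n ?G" if "p \<in> forms r (Suc t)" for p
  proof -
    from that obtain w where w: "\<And>l. l < r \<Longrightarrow> w l \<in> forms r t" "p = (\<Sum>l<r. Var l * w l)"
      by (rule forms_Suc_generated) (rule that)
    have "subst y p = (\<Sum>l<r. subst y (w l) * y l)" by (simp add: w(2) hom_distribs mult.commute)
    also have "\<dots> \<in> gen_ideal n ?G"
      by (intro submodule_sum[OF is_submodule_gen_ideal] gen_ideal_base) (use w(1) in blast)
    finally show ?thesis .
  qed
  then have "gen_ideal n (subst y ` forms r (Suc t)) \<subseteq> gen_ideal n ?G"
    by (intro gen_ideal_least is_submodule_gen_ideal) auto
  ultimately show ?case by (simp add: Suc ideal_prod_gen_ideal)
qed

lemma gen_ideal_Int_forms_constant_coeffs: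
  assumes G: "G \<subseteq> forms n D" and x: "x \<in> gen_ideal n G" "x \<in> forms n D"
  obtains F c where "finite F" "F \<subseteq> G" "x = (\<Sum>g\<in>F. Const (c g) * g)"
proof -
  obtain F c where F: "finite F" "F \<subseteq> G" "x = (\<Sum>g\<in>F. c g * g)"
    using x(1) unfolding gen_ideal_def by blast
  have "x = (\<Sum>g\<in>F. hom_comp 0 (c g) * g)"
    by (rule homog_combination[of _ n 0 D, OF _ _ F(3)]) (use x(2) G F(2) in \<open>auto simp: forms_def\<close>)
  then show ?thesis unfolding hom_comp_0 by (rule that[OF F(1,2)])
qed

context linearly_presented_ideal_powers
begin

lemma ideal_pow_eq_iff:
  "ideal_pow n I t = ideal_pow n (max_ideal n) (d * t) \<longleftrightarrow> forms n (d * t) \<subseteq> subst f ` forms r t"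
proof -
  have I_pow: "ideal_pow n I t = gen_ideal n (subst f ` forms r t)"
    by (rule ideal_pow_gen_ideal) (use f_S in simp)
  have "subst Var ` forms n (d * t) = (forms n (d * t) :: 'k mpoly set)" by (simp add: subst_Var_id)
  then have max_pow: "ideal_pow n (max_ideal n) (d * t)
      = (gen_ideal n (forms n (d * t)) :: 'k mpoly set)"
    unfolding max_ideal_def
    using ideal_pow_gen_ideal[of n n "Var :: nat \<Rightarrow> 'k mpoly" "d * t"] by simp
  have "forms n (d * t) \<subseteq> subst f ` forms r t"
    if eq: "gen_ideal n (subst f ` forms r t) = gen_ideal n (forms n (d * t))"
  proof
    fix x :: "'k mpoly" assume x: "x \<in> forms n (d * t)"
    then have "x \<in> gen_ideal n (subst f ` forms r t)" unfolding eq by (rule gen_ideal_base)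
    then obtain F c where F: "F \<subseteq> subst f ` forms r t" "x = (\<Sum>g\<in>F. Const (c g) * g)"
      by (rule gen_ideal_Int_forms_constant_coeffs[OF subst_f_forms _ x]) (rule that)
    have "Const c \<in> A" for c by (intro image_eqI[of _ _ "Const c"]) auto
    moreover have "subst f ` forms r t \<subseteq> A" by (auto simp: forms_def)
    ultimately have "x \<in> A"
      unfolding F(2) using F(1)
      by (intro add_subgroup_sum[OF subring_add_subgroup[OF is_subring_A]]
          subring_mult[OF is_subring_A]) auto
    then show "x \<in> subst f ` forms r t" using x A_Int_forms by blast
  qed
  then show ?thesis unfolding I_pow max_pow using subst_f_forms[of t] by (metis subset_antisym)
qed

lemma operator_map_subst_f: "operator_map (mult_ops Var) (mult_ops f) (subst f)"
  by unfold_locales (simp_all add: hom_distribs)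

lemma r_pos: "r \<ge> 1"
  using exists_f_nonzero by auto

lemma IW_forms_in_J:
  assumes exact: "koszul_vanishing r n J"
    and p: "p \<in> IW r f" "p \<in> forms r e" "e \<ge> n"
  shows "p \<in> J"
proof (rule ccontr)
  assume "p \<notin> J"
  let ?X = "{p \<in> IW r f. \<exists>e\<ge>n. p \<in> forms r e}"
  obtain q where q: "q \<in> ?X" "q \<notin> J" "\<And>b. b < r \<Longrightarrow> Var b * q \<in> J"
  proof (rule exists_socle_element[of p ?X J r Var])
    show "p \<in> ?X" "p \<notin> J" using p \<open>p \<notin> J\<close> by auto
    show "Var b * q \<in> ?X" if "b < r" "q \<in> ?X" for b q
    proof -
      from that obtain e where "e \<ge> n" "q \<in> forms r e" by blast
      then have "Var b * q \<in> forms r (Suc e)" "Suc e \<ge> n" using forms_Var_mult[OF that(1)] by auto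
      then show ?thesis using that submodule_mult[OF is_submodule_IW, of "Var b" q] by auto
    qed
    show "Var b * q \<in> J" if "b < r" "q \<in> J" for b q
      using that by (simp add: submodule_mult[OF is_submodule_J])
    show "\<exists>D. Var b ^ D * q \<in> J" if "b < r" "q \<in> ?X" for b q using Var_power_mult_in_J that by blast
  qed (rule that)
  from q(1) obtain e where e: "e \<ge> n" "q \<in> forms r e" by blast
  obtain s where s: "r = Suc s" using r_pos by (cases r) auto
  have "q \<in> J \<inter> forms r e"
  proof (rule mult_ops.koszul_exact_socle)
    show "koszul_exact (Suc s) (mult_ops Var) s (J \<inter> forms r e) (J \<inter> forms r (Suc e))"
      using exact e(1) s by (simp add: koszul_vanishing_def)
    show "is_add_subgroup (J \<inter> forms r (Suc e))"
      by (intro is_add_subgroup_Int submodule_add_subgroup[OF is_submodule_J] is_add_subgroup_forms)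
    show "Var b * q \<in> J \<inter> forms r (Suc e)" if "b < Suc s" for b
      using that q(3) e(2) s forms_Var_mult by auto
    show "inj ((*) (Var 0 :: 'k mpoly))" by (rule injI) simp
  qed simp
  then show False using q(2) by simp
qed

lemma J_Int_forms:
  assumes "koszul_vanishing r n J"
    and "e \<ge> n"
  shows "J \<inter> forms r e = {p \<in> forms r e. subst f p = 0}"
  using IW_forms_in_J[OF assms(1), of _ e] J_subset_IW assms(2) by (auto simp: IW_def forms_def)

lemma koszul_exact_image_f:
  assumes "koszul_vanishing r n J" and t: "t \<ge> n - 1"
  shows "koszul_exact r (mult_ops f) i (subst f ` forms r t) (subst f ` forms r (Suc t))"
proof -
  interpret operator_map "mult_ops Var" "mult_ops f" "subst f" by (rule operator_map_subst_f)
  have Suc_t: "Suc t \<ge> n" "Suc (Suc t) \<ge> n" using t by auto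
  show ?thesis
  proof (rule koszul_exact_image[where W="forms r (Suc (Suc t))"])
    show "koszul_exact r (mult_ops Var) j {p \<in> forms r (Suc t). subst f p = 0}
        {p \<in> forms r (Suc (Suc t)). subst f p = 0}" for j
      using assms(1) Suc_t unfolding koszul_vanishing_def
      by (simp flip: J_Int_forms[OF assms(1) Suc_t(1)] J_Int_forms[OF assms(1) Suc_t(2)])
  qed (intro koszul_exact_Var is_add_subgroup_forms forms_Var_mult)+
qed

lemma forms_in_A:
  assumes exact: "koszul_vanishing r n J" and x: "x \<in> forms n (d * t)" "t \<ge> n - 1"
  shows "x \<in> A"
proof (rule ccontr)
  assume "x \<notin> A"
  let ?X = "{x. \<exists>t\<ge>n - 1. x \<in> forms n (d * t)}"
  obtain q where q: "q \<in> ?X" "q \<notin> A" "\<And>b. b < r \<Longrightarrow> f b * q \<in> A"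
  proof (rule exists_socle_element[of x ?X A r f])
    show "x \<in> ?X" "x \<notin> A" using x \<open>x \<notin> A\<close> by auto
    show "f b * q \<in> ?X" if "b < r" "q \<in> ?X" for b q
    proof -
      from that obtain t where "t \<ge> n - 1" "q \<in> forms n (d * t)" by blast
      then have "f b * q \<in> forms n (d * Suc t)" "Suc t \<ge> n - 1"
        using forms_mult[OF f_forms[OF that(1)], of q "d * t"] by auto
      then show ?thesis by blast
    qed
    show "f b * q \<in> A" if "b < r" "q \<in> A" for b q
    proof -
      have "f b \<in> A" using that(1) by (intro image_eqI[of _ _ "Var b"]) auto
      then show ?thesis using that(2) by (rule subring_mult[OF is_subring_A])
    qed
    show "\<exists>D. f b ^ D * q \<in> A" if "b < r" "q \<in> ?X" for b q using f_power_mult_in_A that by blast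
  qed (rule that)
  from q(1) obtain t where t: "t \<ge> n - 1" "q \<in> forms n (d * t)" by blast
  obtain s where s: "r = Suc s" using r_pos by (cases r) auto
  obtain b where b: "b < r" "f b \<noteq> 0" using exists_f_nonzero by blast
  have "q \<in> subst f ` forms r t"
  proof (rule mult_ops.koszul_exact_socle)
    show "koszul_exact (Suc s) (mult_ops f) s (subst f ` forms r t) (subst f ` forms r (Suc t))"
      using koszul_exact_image_f[OF exact t(1)] s by simp
    show "is_add_subgroup (subst f ` forms r (Suc t))"
      by (rule add_subgroup_image[OF is_add_subgroup_forms additive_subst])
    show "f b * q \<in> subst f ` forms r (Suc t)" if "b < Suc s" for b
      using that s q(3) A_Int_forms[of "Suc t"] forms_mult[OF f_forms t(2), of b] by auto
    show "inj ((*) (f b))" by (rule injI) (simp add: b(2))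
    show "b < Suc s" using b(1) s by simp
  qed
  then show False using q(2) by (auto simp: forms_def)
qed

theorem ideal_pow_eq_if_linear_resolution:
  assumes "linear_resolution r n J"
  shows "ideal_pow n I (n - 1) = ideal_pow n (max_ideal n) (d * (n - 1))"
  unfolding ideal_pow_eq_iff
proof
  fix x :: "'k mpoly" assume x: "x \<in> forms n (d * (n - 1))"
  have "x \<in> A" by (rule forms_in_A[OF linear_resolution_imp_koszul_vanishing[OF assms] x]) simp
  then show "x \<in> subst f ` forms r (n - 1)" using x A_Int_forms by blast
qed

lemma koszul_exact_f:
  assumes "e \<ge> n"
  shows "koszul_exact r (mult_ops f) i (forms n (d * (e - 1))) (forms n (d * e))"
proof -
  have "d * (e - 1) + d = d * e" using assms n_pos by (cases e) auto
  moreover have "n * d \<le> d * e" using assms by (simp add: mult.commute)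
  ultimately have "n * d < d * (e - 1) + d + n" using n_pos by linarith
  from koszul_exact_forms[OF P_pos this] show ?thesis by (simp only: \<open>d * (e - 1) + d = d * e\<close>)
qed

lemma forms_subset_image:
  assumes base: "forms n (d * (n - 1)) \<subseteq> subst f ` forms r (n - 1)" and t: "t \<ge> n - 1"
  shows "forms n (d * t) \<subseteq> subst f ` forms r t"
  using t
proof (induction t rule: nat_induct_at_least)
  case base then show ?case by fact
next
  case (Suc t)
  show ?case
  proof
    fix x :: "'k mpoly" assume x: "x \<in> forms n (d * Suc t)"
    have "koszul_exact r (mult_ops f) 0 (forms n (d * t)) (forms n (d * Suc t))"
      using koszul_exact_f[of "Suc t" 0] Suc.hyps by simp
    then obtain w where w: "\<And>l. l < r \<Longrightarrow> w l \<in> forms n (d * t)" "x = (\<Sum>l<r. f l * w l)"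
      using x by (rule mult_ops.koszul_exact_0_generates) (rule that)
    then have "\<exists>q. q \<in> forms r t \<and> w l = subst f q" if "l < r" for l using Suc.IH that by blast
    then obtain q where q: "\<And>l. l < r \<Longrightarrow> q l \<in> forms r t" "\<And>l. l < r \<Longrightarrow> w l = subst f (q l)" by metis
    have "x = subst f (\<Sum>l<r. Var l * q l)" by (simp add: w(2) hom_distribs q(2))
    moreover have "(\<Sum>l<r. Var l * q l) \<in> forms r (Suc t)"
      by (intro forms_sum forms_Var_mult q(1)) auto
    ultimately show "x \<in> subst f ` forms r (Suc t)" by blast
  qed
qed

lemma hom_comp_IW: "p \<in> IW r f \<Longrightarrow> hom_comp e p \<in> IW r f"
  using hom_comp_subst[where r=r and p=p and y=f and d=d and e=e] f_deg d_pos
  by (auto simp: IW_def in_ring_hom_comp hom_comp.zero)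

lemma ideal_ge_IW: "ideal_ge r n (IW r f) = {p \<in> IW r f. \<forall>m\<in>keys p. tdeg m \<ge> n}" (is "_ = ?R")
proof
  have "is_submodule (poly_ring r) ?R"
  proof (rule is_submoduleI[OF is_subring_poly_ring])
    show "p + q \<in> ?R" if "p \<in> ?R" "q \<in> ?R" for p q
      using that keys_add[of p q] submodule_add[OF is_submodule_IW] by blast
  next
    fix c p :: "'k mpoly" assume c: "c \<in> poly_ring r" "p \<in> ?R"
    have "tdeg m \<ge> n" if "m \<in> keys (c * p)" for m
    proof -
      from that obtain m1 m2 where "m = m1 + m2" "m2 \<in> keys p" using keys_mult[of c p] by blast
      then show ?thesis using c by (auto simp: tdeg_add intro: trans_le_add2)
    qed
    then show "c * p \<in> ?R" using c submodule_mult[OF is_submodule_IW] by blast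
  qed (use submodule_zero[OF is_submodule_IW] in auto)
  then show "ideal_ge r n (IW r f) \<subseteq> ?R"
    unfolding ideal_ge_def by (rule gen_ideal_least) (auto simp: homog_def)
  show "?R \<subseteq> ideal_ge r n (IW r f)"
  proof
    fix p assume p: "p \<in> ?R"
    have "p = (\<Sum>e\<in>tdeg ` keys p. hom_comp e p)" by (rule sum_hom_comp[symmetric]) auto
    also have "\<dots> \<in> ideal_ge r n (IW r f)"
      unfolding ideal_ge_def
    proof (rule submodule_sum[OF is_submodule_gen_ideal], rule gen_ideal_base)
      fix e assume "e \<in> tdeg ` keys p"
      then show "hom_comp e p \<in> {p \<in> IW r f. \<exists>e\<ge>n. homog e p}"
        using p hom_comp_IW homog_hom_comp by fastforce
    qed
    finally show "p \<in> ideal_ge r n (IW r f)" .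
  qed
qed

theorem linear_resolution_if_ideal_pow_eq:
  assumes J_eq: "J = ideal_ge r n (IW r f)"
    and pow: "ideal_pow n I (n - 1) = ideal_pow n (max_ideal n) (d * (n - 1))"
  shows "linear_resolution r n J"
proof (rule linear_resolution_if_koszul_vanishing)
  interpret operator_map "mult_ops Var" "mult_ops f" "subst f" by (rule operator_map_subst_f)
  note J_high = J_eq[unfolded ideal_ge_IW]
  show "homogeneous_ideal r J"
    using is_submodule_J hom_comp_IW unfolding homogeneous_ideal_def J_high
    by (auto simp: IW_def keys_hom_comp)
  show "J \<inter> forms r e \<subseteq> {0}" if "e < n" for e
  proof safe
    fix p assume "p \<in> J" "p \<in> forms r e"
    then have "keys p = {}" using that unfolding J_high by (auto simp: forms_def homog_def)
    then show "p = 0" by simp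
  qed
  have surj: "subst f ` forms r t = forms n (d * t)" if "t \<ge> n - 1" for t
    using subst_f_forms forms_subset_image[OF pow[unfolded ideal_pow_eq_iff] that] by blast
  have J_forms: "J \<inter> forms r e = {p \<in> forms r e. subst f p = 0}" if "e \<ge> n" for e
    using that unfolding J_high by (auto simp: forms_def homog_def IW_def)
  have "koszul_exact r (mult_ops Var) i {p \<in> forms r e. subst f p = 0}
      {p \<in> forms r (Suc e). subst f p = 0}"
    if e: "e \<ge> n" for i e
  proof (rule koszul_exact_kernel[where V="forms r (e - 1)"])
    show "koszul_exact r (mult_ops f) (Suc i) (subst f ` forms r (e - 1)) (subst f ` forms r e)"
      using koszul_exact_f[OF e] e by (simp add: surj)
    show "Var l * p \<in> forms r e" if "l < r" "p \<in> forms r (e - 1)" for l p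
      using forms_Var_mult[OF that] e n_pos by simp
  qed (rule koszul_exact_Var is_add_subgroup_forms)+
  then show "koszul_vanishing r n J" by (simp add: koszul_vanishing_def J_forms)
qed

end

theorem theorem3p8:
  fixes n r d N :: nat
    and f :: "nat \<Rightarrow> 'k::field mpoly"
    and a :: "nat \<Rightarrow> nat \<Rightarrow> 'k mpoly"
  assumes n_pos: "n \<ge> 1"
    and f_S: "\<forall>i<r. in_ring n (f i)"
    and f_deg: "\<forall>i<r. homog d (f i)"
    and lin_pres: "linearly_presented n r f"
    and m_primary: "primary_for n (max_ideal n) (gen_ideal n (f ` {..<r}))"
    and basis: "lin_syz_basis n r f N a"
  shows "(linear_resolution r n (minors_ideal r N n (jac_dual r a)) \<longrightarrow>
            ideal_pow n (gen_ideal n (f ` {..<r})) (n - 1) = ideal_pow n (max_ideal n) (d * (n - 1)))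
       \<and> (minors_ideal r N n (jac_dual r a) = ideal_ge r n (IW r f) \<longrightarrow>
            (linear_resolution r n (minors_ideal r N n (jac_dual r a)) \<longleftrightarrow>
             ideal_pow n (gen_ideal n (f ` {..<r})) (n - 1) = ideal_pow n (max_ideal n) (d * (n - 1))))"
proof -
  interpret linearly_presented_ideal n r d N f a by unfold_locales (fact assms)+
  obtain P g where "variable_powers n r d P f g" using exists_variable_powers by blast
  then interpret linearly_presented_ideal_powers n r d N f a P g
    by (intro linearly_presented_ideal_powers.intro linearly_presented_ideal_axioms)
  show ?thesis using ideal_pow_eq_if_linear_resolution linear_resolution_if_ideal_pow_eq by blast
qed

end
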